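(* Let $0<p,\alpha,R,\epsilon<\infty$, $\delta\in(0,1)$, and let $w\in A^{\mathrm{restricted}}_{\infty}$. Then there exists $r_0=r_0(p,\alpha,R,\epsilon,\delta,w)>0$ such that each $r\in(0,r_0)$ satisfies the following property: whenever $\mu$ is a positive Borel measure on $\mathbb{C}$ for which $\|\widehat{\mu}_w\|_{L^{\infty}}<\infty$ and for which the set $$G:=\left\{z\in\mathbb{C}:\frac{\mu\big(D(z,r)\big)}{\widehat{w}\big(D(z,r)\big)}>\epsilon \|\widehat{\mu}_w\|_{L^{\infty}}\right\}$$ satisfies $$\widehat{w}\big(G\cap D(a,R)\big)>\delta\,\widehat{w}\big(D(a,R)\big)\quad\text{for all }a\in\mathbb{C},$$ the measure $\mu$ is a reverse Carleson measure for $F^p_{\alpha,w}$.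
   Context: $dA$ is Lebesgue measure on $\mathbb{C}$, and $D(a,R)$ is the Euclidean disk with center $a$ and radius $R$. A weight is a non-negative locally integrable function $w$ on $\mathbb{C}$, and $w(E):=\int_E w\,dA$ for measurable $E$. Squares $Q\subset\mathbb{C}$ have sides parallel to the coordinate axes and side length $\ell(Q)$. For $1<p<\infty$ with conjugate exponent $p'$ ($1/p+1/p'=1$), $A_p^{\mathrm{restricted}}$ is the class of weights $w$ such that for some (equivalently any) fixed $r>0$, $$\sup_{Q:\ell(Q)=r}\Big(\frac{1}{A(Q)}\int_{Q}w\,dA\Big)\Big(\frac{1}{A(Q)}\int_{Q}w^{-p'/p}dA\Big)^{p/p'}<\infty,$$ and $A_1^{\mathrm{restricted}}$ is the class of weights such that for some (equivalently any) fixed $r>0$, $\sup_{Q:\ell(Q)=r}\big(\frac{1}{A(Q)}\int_Q w\,dA\big)\|w^{-1}\|_{L^\infty(Q)}<\infty$ (convention $0\cdot\infty=\infty$, so $w>0$ a.e.). $A_\infty^{\mathrm{restricted}}:=\bigcup_{1\le p<\infty}A_p^{\mathrm{restricted}}$. $\widehat{w}(z):=w(D(z,1))/A(D(z,1))$ for $z\in\mathbb{C}$, and $\widehat w(E):=\int_E\widehat w\,dA$. For a positive Borel measure $\mu$ on $\mathbb{C}$, $\widehat{\mu}_w(z):=\mu(D(z,1))/w(D(z,1))$. $F^p_{\alpha,w}$ is the space of entire functions $f$ on $\mathbb{C}$ with $\|f\|^p_{F^p_{\alpha,w}}:=\int_{\mathbb{C}}|f(z)|^pe^{-\frac{p\alpha}{2}|z|^2}w(z)\,dA(z)<\infty$.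 A positive Borel measure $\mu$ on $\mathbb{C}$ is a reverse Carleson measure for $F^p_{\alpha,w}$ if there is $C>0$ such that $\|f\|^p_{F^p_{\alpha,w}}\le C\int_{\mathbb{C}}|f(z)|^pe^{-\frac{p\alpha}{2}|z|^2}d\mu(z)$ for all $f\in F^p_{\alpha,w}$. *)

theory Defs
  imports "HOL-Complex_Analysis.Complex_Analysis" "HOL-Probability.Essential_Supremum"
begin

definition is_weight :: "(complex \<Rightarrow> real) \<Rightarrow> bool" where
  "is_weight w \<longleftrightarrow> (\<forall>z. 0 \<le> w z) \<and> (\<forall>K. compact K \<longrightarrow> set_integrable lebesgue K w)"

text \<open>Integral over \<open>E\<close> of a density with respect to Lebesgue measure on the plane;
  this gives both \<open>w(E)\<close> and the mass of \<open>E\<close> under the averaged weight.\<close>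

definition mass :: "(complex \<Rightarrow> ennreal) \<Rightarrow> complex set \<Rightarrow> ennreal" where
  "mass g E = (\<integral>\<^sup>+z\<in>E. g z \<partial>lebesgue)"

definition mean :: "(complex \<Rightarrow> ennreal) \<Rightarrow> complex set \<Rightarrow> ennreal" where
  "mean g E = mass g E / emeasure lebesgue E"

text \<open>Real powers of extended nonnegative numbers, with \<open>0\<close> and \<open>\<infinity>\<close> exchanged by
  negative exponents.  The real-valued \<open>powr\<close> would give \<open>0\<close> at \<open>0\<close> for every exponent.\<close>

definition epowr :: "ennreal \<Rightarrow> real \<Rightarrow> ennreal" where
  "epowr x s =
    (if s = 0 then 1
     else if x = 0 then (if s > 0 then 0 else \<infinity>)
     else if x = \<infinity> then (if s > 0 then \<infinity> else 0)
     else ennreal (enn2real x powr s))"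

text \<open>Multiplication with the convention \<open>0 \<cdot> \<infinity> = \<infinity>\<close>
  (the multiplication of \<^typ>\<open>ennreal\<close> has \<open>0 \<cdot> \<infinity> = 0\<close>).  Under this
  convention a weight that vanishes on a set of positive measure has
  an infinite \<open>A\<^sub>p\<close> characteristic.\<close>

definition inf_mult :: "ennreal \<Rightarrow> ennreal \<Rightarrow> ennreal" where
  "inf_mult x y = (if x = \<infinity> \<or> y = \<infinity> then \<infinity> else x * y)"

definition square :: "complex \<Rightarrow> real \<Rightarrow> complex set" where
  "square c r = cbox c (c + Complex r r)"

definition Ap_restricted :: "real \<Rightarrow> (complex \<Rightarrow> real) set" where
  "Ap_restricted p = {w. is_weight w \<and>
     (let p' = p / (p - 1) in
       \<exists>r>0. (SUP c. inf_mult (mean (\<lambda>z. ennreal (w z)) (square c r))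
                (epowr (mean (\<lambda>z. epowr (ennreal (w z)) (- p' / p)) (square c r)) (p / p'))) < \<infinity>)}"

text \<open>Here \<open>inverse 0 = \<infinity>\<close>, as the values are of type \<^typ>\<open>ennreal\<close>.\<close>

definition A1_restricted :: "(complex \<Rightarrow> real) set" where
  "A1_restricted = {w. is_weight w \<and>
     (\<exists>r>0. (SUP c. inf_mult (mean (\<lambda>z. ennreal (w z)) (square c r))
               (esssup (restrict_space lebesgue (square c r)) (\<lambda>z. inverse (ennreal (w z))))) < \<infinity>)}"

definition Ainf_restricted :: "(complex \<Rightarrow> real) set" where
  "Ainf_restricted = A1_restricted \<union> (\<Union>p\<in>{1<..}. Ap_restricted p)"

definition hat_weight :: "(complex \<Rightarrow> real) \<Rightarrow> complex \<Rightarrow> ennreal" where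
  "hat_weight w z = mean (\<lambda>u. ennreal (w u)) (ball z 1)"

definition hat_measure :: "(complex \<Rightarrow> real) \<Rightarrow> complex measure \<Rightarrow> complex \<Rightarrow> ennreal" where
  "hat_measure w \<mu> z = emeasure \<mu> (ball z 1) / mass (\<lambda>u. ennreal (w u)) (ball z 1)"

definition hat_measure_norm :: "(complex \<Rightarrow> real) \<Rightarrow> complex measure \<Rightarrow> ennreal" where
  "hat_measure_norm w \<mu> = esssup lebesgue (hat_measure w \<mu>)"

definition fock_integrand :: "real \<Rightarrow> real \<Rightarrow> (complex \<Rightarrow> complex) \<Rightarrow> complex \<Rightarrow> real" where
  "fock_integrand p \<alpha> f z = norm (f z) powr p * exp (- (p * \<alpha> / 2) * (norm z)\<^sup>2)"

text \<open>The \<open>p\<close>-th power of the weighted Fock (quasi-)norm.\<close>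

definition fock_norm_pow :: "real \<Rightarrow> real \<Rightarrow> (complex \<Rightarrow> real) \<Rightarrow> (complex \<Rightarrow> complex) \<Rightarrow> ennreal" where
  "fock_norm_pow p \<alpha> w f = (\<integral>\<^sup>+z. ennreal (fock_integrand p \<alpha> f z * w z) \<partial>lebesgue)"

definition fock_space :: "real \<Rightarrow> real \<Rightarrow> (complex \<Rightarrow> real) \<Rightarrow> (complex \<Rightarrow> complex) set" where
  "fock_space p \<alpha> w = {f. f holomorphic_on UNIV \<and> fock_norm_pow p \<alpha> w f < \<infinity>}"

definition reverse_Carleson ::
    "real \<Rightarrow> real \<Rightarrow> (complex \<Rightarrow> real) \<Rightarrow> complex measure \<Rightarrow> bool" where
  "reverse_Carleson p \<alpha> w \<mu> \<longleftrightarrow>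
     (\<exists>C::real. C > 0 \<and> (\<forall>f\<in>fock_space p \<alpha> w.
        fock_norm_pow p \<alpha> w f \<le> ennreal C * (\<integral>\<^sup>+z. ennreal (fock_integrand p \<alpha> f z) \<partial>\<mu>)))"

definition good_set ::
    "(complex \<Rightarrow> real) \<Rightarrow> complex measure \<Rightarrow> real \<Rightarrow> real \<Rightarrow> complex set" where
  "good_set w \<mu> r \<epsilon> =
     {z. emeasure \<mu> (ball z r) / mass (hat_weight w) (ball z r) > ennreal \<epsilon> * hat_measure_norm w \<mu>}"

end

theory Submission
  imports Defs
begin

text \<open>
  Write \<open>N(z) = |f(z)|\<^sup>p e\<^bsup>-p\<alpha>|z|\<^sup>2/2\<^esup>\<close>, and let \<open>V(z)\<close> be the \<open>w\<close>-mass of the unit disk at \<open>z\<close>, which is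
  comparable at points of bounded distance.  By subharmonicity and the \<open>A\<^sub>p\<close> condition
  \<open>\<integral> N w\<close> and \<open>X = \<integral> N V\<close> are comparable.  Since \<open>|f|\<^sup>s\<close> has the sub-mean value property for every
  \<open>s > 0\<close>, using a very small \<open>s\<close> gives \<open>N(a) \<le> \<eta> \<integral>\<^bsub>D(a,R)\<^esub> N + C\<^sub>\<eta> \<integral>\<^bsub>D(a,R) \<inter> G\<^esub> N\<close> with \<open>\<eta>\<close> as small
  as we please, as soon as \<open>G\<close> has density bounded below in \<open>D(a,R)\<close>; integrating against \<open>V\<close> and
  absorbing the first term yields \<open>X \<le> C \<integral>\<^sub>G N V\<close>, with \<open>C\<close> independent of \<open>r\<close> and \<open>\<mu>\<close>.  On \<open>G\<close> one may
  replace \<open>V(z)\<close> by \<open>\<mu>(D(z,r))/r\<^sup>2\<close>, and \<open>N(z) \<le> C N(u) + C r\<^sup>p \<integral>\<^bsub>D(z,2)\<^esub> N\<close> for \<open>|u - z| < r\<close>.  This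
  bounds \<open>\<integral>\<^sub>G N V\<close> by \<open>\<integral> N d\<mu>\<close> plus \<open>O(r\<^sup>p) X\<close>, and the last term is absorbed for small \<open>r\<close>.
\<close>

section \<open>Sub-mean value property of powers of entire functions\<close>

text \<open>The restricted condition controls \<open>w\<close> only at one fixed scale, so
  \<open>w\<close> may vary wildly on the small disks of radius \<open>r\<close>. Local estimates
  therefore use \<open>V\<close>, and \<open>w\<close> enters only when the two norms are compared;
  doubling also turns the density of \<open>G\<close>, assumed for the averaged weight, into a
  Lebesgue density. The obstacle is to make \<open>\<eta>\<close> small while the density of
  \<open>G\<close> is fixed: with the exponent \<open>p\<close> alone, the values off
  \<open>G\<close> could carry the whole mean. A concave power of \<open>N\<close> flattens large
  values. Off \<open>G\<close> its normalised mean is at most about the missing proportion of area,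
  and on \<open>G\<close> it is small unless \<open>N\<close> already has a fixed share of its
  integral there. Both absorptions subtract a multiple of \<open>X\<close>, so they need
  \<open>X\<close> finite; this is where membership in the Fock space enters. The threshold for
  \<open>r\<close> is free of \<mu> because, with \<open>m\<close> the norm of the averaged \<mu>,
  the lower bound on \<open>G\<close> and the upper bound for \<mu> on disks are both linear in
  \<open>m\<close>, which cancels. Only the final constant retains a factor
  \<open>1/m\<close>.\<close>

lemma entire_factor_zero:
  assumes f: "f holomorphic_on UNIV" and nz: "f b \<noteq> 0" and a: "f a = 0"
  obtains g m where "0 < m" "g holomorphic_on UNIV" "g a \<noteq> 0" "\<And>z. f z = (z - a) ^ m * g z"
proof -
  have nc: "\<not> f constant_on UNIV"
  proof
    assume "f constant_on UNIV"
    then have "f b = f a" unfolding constant_on_def by force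
    then show False using nz a by simp
  qed
  obtain g0 r m where m: "0 < m" and r: "0 < r" and g0: "g0 holomorphic_on ball a r"
    and fg: "\<And>w. w \<in> ball a r \<Longrightarrow> f w = (w - a) ^ m * g0 w"
    and g0nz: "\<And>w. w \<in> ball a r \<Longrightarrow> g0 w \<noteq> 0"
    by (rule holomorphic_factor_zero_nonconstant[where f = f and S = UNIV and \<xi> = a])
       (use f a nc in auto)
  \<comment> \<open>The local factor near \<open>a\<close> and the quotient away from
    \<open>a\<close> agree where both are defined, so they glue to an entire function.\<close>
  define g where "g z = (if z = a then g0 a else f z / (z - a) ^ m)" for z
  have "g holomorphic_on ball a r"
    by (rule holomorphic_transform[OF g0]) (use fg in \<open>auto simp: g_def\<close>)
  moreover have "g holomorphic_on - {a}"
  proof (rule holomorphic_transform)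
    show "(\<lambda>z. f z / (z - a) ^ m) holomorphic_on - {a}"
      using f by (intro holomorphic_intros) (auto intro: holomorphic_on_subset)
  qed (auto simp: g_def)
  ultimately have "g holomorphic_on ball a r \<union> - {a}"
    by (intro holomorphic_on_Un) auto
  moreover have "ball a r \<union> - {a} = UNIV"
    using r by auto
  ultimately have "g holomorphic_on UNIV" by simp
  moreover have "f z = (z - a) ^ m * g z" for z
    using a m by (auto simp: g_def)
  moreover have "g a \<noteq> 0"
    using g0nz r by (auto simp: g_def)
  ultimately show ?thesis using m that by blast
qed

text \<open>The factor \<open>z - a\<close> of a zero \<open>a\<close> is replaced by \<open>\<rho> - cnj a * z / \<rho>\<close>, which has the same
  modulus on the circle and no zero in the disk.\<close>

lemma reflect_zeros:
  assumes "f holomorphic_on UNIV" "0 < \<rho>" "\<And>z. norm z = \<rho> \<Longrightarrow> f z \<noteq> 0"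
    and "finite {z \<in> ball 0 \<rho>. f z = 0}"
  obtains h where "h holomorphic_on UNIV" "\<And>z. norm z \<le> \<rho> \<Longrightarrow> h z \<noteq> 0"
    "\<And>z. norm z = \<rho> \<Longrightarrow> norm (h z) = norm (f z)" "norm (f 0) \<le> norm (h 0)"
  using assms
proof (induction "card {z \<in> ball 0 \<rho>. f z = 0}" arbitrary: f thesis)
  case 0
  then have e: "{z \<in> ball 0 \<rho>. f z = 0} = {}" by simp
  then have "f z \<noteq> 0" if "norm z \<le> \<rho>" for z
    using 0(5) that by (cases "norm z = \<rho>") auto
  then show ?case using 0 by blast
next
  case (Suc n)
  have "card {z \<in> ball 0 \<rho>. f z = 0} \<noteq> 0" using Suc.hyps(2) by simp
  then have "{z \<in> ball 0 \<rho>. f z = 0} \<noteq> {}" by (metis card.empty)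
  then obtain a where a: "norm a < \<rho>" "f a = 0" by auto
  have fne: "f (of_real \<rho>) \<noteq> 0" using Suc.prems(3,4) by simp
  obtain g m where m: "0 < m" and g: "g holomorphic_on UNIV" "g a \<noteq> 0"
    and fg: "\<And>z. f z = (z - a) ^ m * g z"
    by (rule entire_factor_zero[where f = f and a = a and b = "of_real \<rho>"]) (use Suc.prems(2) a fne in auto)
  define f1 where "f1 z = (of_real \<rho> - cnj a * z / of_real \<rho>) ^ m * g z" for z
  have ne: "of_real \<rho> - cnj a * z / of_real \<rho> \<noteq> 0" if "norm z \<le> \<rho>" for z
  proof
    assume "of_real \<rho> - cnj a * z / of_real \<rho> = 0"
    then have "norm (cnj a * z / of_real \<rho>) = norm (complex_of_real \<rho>)"
      by (metis eq_iff_diff_eq_0)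
    then have "norm a * norm z = \<rho> * \<rho>"
      using \<open>0 < \<rho>\<close> by (simp add: norm_mult norm_divide field_simps)
    moreover have "norm a * norm z \<le> norm a * \<rho>"
      using that by (intro mult_left_mono) auto
    moreover have "norm a * \<rho> < \<rho> * \<rho>"
      using a \<open>0 < \<rho>\<close> by simp
    ultimately show False by simp
  qed
  have 1: "f1 holomorphic_on UNIV"
    unfolding f1_def using g \<open>0 < \<rho>\<close> by (intro holomorphic_intros) auto
  \<comment> \<open>The zero \<open>a\<close> goes with its full multiplicity, so the number of
    distinct zeros drops by exactly one.\<close>
  have zeros: "{z \<in> ball 0 \<rho>. f1 z = 0} = {z \<in> ball 0 \<rho>. f z = 0} - {a}"
    using ne g by (auto simp: f1_def fg)
  have "a \<in> {z \<in> ball 0 \<rho>. f z = 0}" using a by auto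
  then have n: "n = card {z \<in> ball 0 \<rho>. f1 z = 0}"
    unfolding zeros using Suc.hyps Suc.prems(5) by (simp add: card_Diff_singleton)
  have sph: "norm (f1 z) = norm (f z)" if z: "norm z = \<rho>" for z
  proof -
    have "of_real \<rho> - cnj a * z / of_real \<rho> = z * cnj (z - a) / of_real \<rho>"
      using \<open>0 < \<rho>\<close> complex_norm_square[of z] z by (simp add: field_simps power2_eq_square)
    then have "norm (of_real \<rho> - cnj a * z / of_real \<rho>) = norm (z - a)"
      using z \<open>0 < \<rho>\<close> by (simp add: norm_mult norm_divide flip: complex_cnj_diff)
    then show ?thesis by (simp add: f1_def fg norm_mult norm_power)
  qed
  \<comment> \<open>At 0 a factor of modulus \<open>norm a\<close> becomes one of the larger modulus
    \<rho>. The value at the centre can only grow, which is the direction a sub-mean value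
    inequality can afford.\<close>
  have "norm (f 0) \<le> norm (f1 0)"
    using a by (auto simp: f1_def fg norm_mult norm_power intro!: mult_right_mono power_mono)
  obtain h where "h holomorphic_on UNIV" "\<And>z. norm z \<le> \<rho> \<Longrightarrow> h z \<noteq> 0"
    "\<And>z. norm z = \<rho> \<Longrightarrow> norm (h z) = norm (f1 z)" "norm (f1 0) \<le> norm (h 0)"
  proof (rule Suc.hyps(1)[OF n])
    show "f1 z \<noteq> 0" if "norm z = \<rho>" for z
      using sph[OF that] Suc.prems(4)[OF that] by auto
    show "finite {z \<in> ball 0 \<rho>. f1 z = 0}" unfolding zeros using Suc.prems by simp
  qed (use 1 \<open>0 < \<rho>\<close> in auto)
  then show ?case
    using Suc.prems(1)[of h] sph \<open>norm (f 0) \<le> norm (f1 0)\<close> by simp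
qed

lemma entire_finite_zeros:
  assumes f: "f holomorphic_on UNIV" and nz: "f b \<noteq> 0"
  shows "finite {z \<in> cball 0 \<rho>. f z = 0}"
proof -
  have "\<not> f constant_on UNIV \<or> (\<forall>z. f z \<noteq> 0)"
    using nz by (auto simp: constant_on_def)
  then show ?thesis
  proof
    assume "\<not> f constant_on UNIV"
    then show ?thesis
      using holomorphic_compact_finite_zeros[OF f open_UNIV connected_UNIV compact_cball[of 0 \<rho>]]
      by auto
  qed auto
qed

lemma norm_circle_average_le:
  fixes u :: "complex \<Rightarrow> complex"
  assumes "continuous_on (sphere 0 (norm z)) u"
  shows "ennreal (norm (integral {0..1} (\<lambda>t. u (z * exp (2 * of_real pi * \<i> * of_real t)))))
    \<le> (\<integral>\<^sup>+t\<in>{0..1}. ennreal (norm (u (z * exp (2 * of_real pi * \<i> * of_real t)))) \<partial>lborel)"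
proof -
  let ?u = "\<lambda>t. u (z * exp (2 * of_real pi * \<i> * of_real t))"
  have c: "continuous_on {0..1} ?u"
    by (rule continuous_on_compose2[OF assms]) (auto intro!: continuous_intros simp: norm_mult norm_exp_eq_Re)
  then have i: "set_integrable lborel {0..1::real} ?u"
    unfolding set_integrable_def by (intro borel_integrable_compact) auto
  then have "norm (integral {0..1} ?u) = norm (LINT t:{0..1}|lborel. ?u t)"
    by (simp add: set_borel_integral_eq_integral)
  also have "ennreal \<dots> \<le> (\<integral>\<^sup>+t. norm (indicator {0..1} t *\<^sub>R ?u t) \<partial>lborel)"
    unfolding set_lebesgue_integral_def by (rule integral_norm_bound_ennreal) (use i in \<open>auto simp: set_integrable_def\<close>)
  also have "\<dots> = (\<integral>\<^sup>+t\<in>{0..1}. ennreal (norm (?u t)) \<partial>lborel)"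
    by (intro nn_integral_cong) (auto simp: indicator_def)
  finally show ?thesis .
qed

text \<open>Reflecting the zeros leaves a function \<open>h\<close> that is zero-free on the disk,
  has the same modulus on the circle and no smaller modulus at 0. Such an \<open>h\<close> has a
  holomorphic \<open>s\<close>-th power, and Cauchy's formula for that power gives the claim. The
  circle is parametrised from the point \<open>z\<close> to match averaging over rotations
  later.\<close>

lemma circle_submean:
  assumes f: "f holomorphic_on UNIV" and z: "z \<noteq> 0" and nz: "\<And>w. norm w = norm z \<Longrightarrow> f w \<noteq> 0"
    and s: "0 < s"
  shows "ennreal (norm (f 0) powr s)
    \<le> (\<integral>\<^sup>+t\<in>{0..1}. ennreal (norm (f (z * exp (2 * of_real pi * \<i> * of_real t))) powr s) \<partial>lborel)"
proof -
  have fin: "finite {w \<in> ball 0 (norm z). f w = 0}"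
    by (rule finite_subset[OF _ entire_finite_zeros[OF f, of z "norm z"]]) (use nz in auto)
  obtain h where h: "h holomorphic_on UNIV" and hnz: "\<And>w. norm w \<le> norm z \<Longrightarrow> h w \<noteq> 0"
    and hf: "\<And>w. norm w = norm z \<Longrightarrow> norm (h w) = norm (f w)" and h0: "norm (f 0) \<le> norm (h 0)"
    by (rule reflect_zeros[OF f, of "norm z"]) (use z nz fin in auto)
  \<comment> \<open>The logarithm is taken on an open disk, so zero-freeness has to reach slightly
    beyond the closed one: the closed zero set keeps a positive distance \<open>d\<close> from the
    compact disk.\<close>
  have "closed {w. h w = 0}"
    using h by (intro closed_Collect_eq) (auto intro: holomorphic_on_imp_continuous_on)
  then obtain d where d: "0 < d" "\<And>x y. x \<in> cball 0 (norm z) \<Longrightarrow> y \<in> {w. h w = 0} \<Longrightarrow> d \<le> dist x y"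
    using separate_compact_closed[of "cball 0 (norm z)" "{w. h w = 0}"] hnz by fastforce
  define \<rho> where "\<rho> = norm z + d"
  have nz': "h w \<noteq> 0" if "w \<in> ball 0 \<rho>" for w
  proof
    assume hw: "h w = 0"
    then have "norm z < norm w" using hnz not_le by blast
    define x where "x = of_real (norm z / norm w) * w"
    have "norm x = norm z" using \<open>norm z < norm w\<close> by (auto simp: x_def norm_mult norm_divide)
    moreover have "dist x w = norm w - norm z"
    proof -
      have "x - w = of_real (norm z / norm w - 1) * w" by (simp add: x_def algebra_simps)
      then have "dist x w = \<bar>norm z / norm w - 1\<bar> * norm w"
        by (simp add: dist_norm norm_mult del: of_real_diff of_real_divide)
      also have "\<dots> = norm w - norm z"
        using \<open>norm z < norm w\<close> by (auto simp: abs_if field_simps)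
      finally show ?thesis .
    qed
    ultimately show False using d(2)[of x w] hw that by (auto simp: \<rho>_def)
  qed
  have "h holomorphic_on ball 0 \<rho>" using h by (rule holomorphic_on_subset) auto
  then obtain L where L: "L holomorphic_on ball 0 \<rho>" "\<And>w. w \<in> ball 0 \<rho> \<Longrightarrow> h w = exp (L w)"
    using contractible_imp_holomorphic_log[of h "ball 0 \<rho>"] nz' convex_imp_contractible[OF convex_ball] by metis
  define F where "F w = exp (of_real s * L w)" for w
  have F: "F holomorphic_on ball 0 \<rho>" unfolding F_def using L by (intro holomorphic_intros) auto
  have nF: "norm (F w) = norm (h w) powr s" if "w \<in> ball 0 \<rho>" for w
    using L(2)[OF that] by (simp add: F_def powr_def)
  have sub: "cball 0 (norm z) \<subseteq> ball 0 \<rho>" using d by (auto simp: \<rho>_def)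
  let ?e = "\<lambda>t. z * exp (2 * of_real pi * \<i> * of_real t)"
  have ne: "norm (?e t) = norm z" for t by (simp add: norm_mult norm_exp_eq_Re)
  \<comment> \<open>\<open>circlepath\<close> starts on the positive real axis; turning
    \<open>F\<close> by the argument of \<open>z\<close> makes the path start at \<open>z\<close>
    instead.\<close>
  obtain \<phi> where \<phi>: "z = of_real (norm z) * exp (\<i> * of_real \<phi>)"
    by (rule that[OF Arg_eq[OF z]])
  define G where "G w = F (exp (\<i> * of_real \<phi>) * w)" for w
  have "G holomorphic_on ball 0 \<rho>"
    unfolding G_def
    by (rule holomorphic_on_compose_gen[OF _ F, unfolded o_def]) (auto intro!: holomorphic_intros simp: norm_mult norm_exp_eq_Re)
  then have "((\<lambda>u. G u / (u - 0)) has_contour_integral (2 * of_real pi * \<i> * G 0)) (circlepath 0 (norm z))"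
    using sub z
    by (intro Cauchy_integral_circlepath_simple) (auto intro: holomorphic_on_subset)
  then have "((\<lambda>t. G (circlepath 0 (norm z) t) / circlepath 0 (norm z) t
       * vector_derivative (circlepath 0 (norm z)) (at t within {0..1}))
      has_integral (2 * of_real pi * \<i> * G 0)) {0..1}"
    unfolding has_contour_integral_def by simp
  moreover have "G (circlepath 0 (norm z) t) / circlepath 0 (norm z) t
       * vector_derivative (circlepath 0 (norm z)) (at t within {0..1}) = (2 * of_real pi * \<i>) * F (?e t)"
    if t: "t \<in> {0..1}" for t
  proof -
    define E where "E = exp (2 * of_real pi * \<i> * complex_of_real t)"
    have "circlepath 0 (norm z) t = of_real (norm z) * E"
      by (simp add: circlepath E_def)
    moreover have "G (of_real (norm z) * E) = F (z * E)"
      unfolding G_def by (subst (2) \<phi>) (simp add: mult_ac)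
    moreover have "vector_derivative (circlepath 0 (norm z)) (at t within {0..1})
        = 2 * of_real pi * \<i> * of_real (norm z) * E"
      using t vector_derivative_circlepath01[of t 0 "norm z"] by (simp add: E_def)
    moreover have "E \<noteq> 0" by (simp add: E_def)
    moreover have "F (?e t) = F (z * E)" by (simp add: E_def)
    ultimately show ?thesis using z by (simp add: field_simps)
  qed
  ultimately have "((\<lambda>t. (2 * of_real pi * \<i>) * F (?e t)) has_integral (2 * of_real pi * \<i> * G 0)) {0..1}"
    by (rule has_integral_eq[rotated])
  moreover define K where "K = 2 * of_real pi * \<i>"
  ultimately have "((\<lambda>t. K * F (?e t)) has_integral K * F 0) {0..1}"
    by (simp add: G_def)
  moreover have "K \<noteq> 0" by (simp add: K_def)
  ultimately have "((\<lambda>t. F (?e t)) has_integral F 0) {0..1}"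
    by (auto dest: has_integral_mult_right[of _ _ _ "inverse K"] simp: mult.assoc[symmetric])
  then have "F 0 = integral {0..1} (\<lambda>t. F (?e t))" by (simp add: integral_unique)
  then have "ennreal (norm (F 0)) \<le> (\<integral>\<^sup>+t\<in>{0..1}. ennreal (norm (F (?e t))) \<partial>lborel)"
    using norm_circle_average_le[of z F] F sub
    by (metis holomorphic_on_imp_continuous_on holomorphic_on_subset order_trans sphere_cball)
  also have "\<dots> = (\<integral>\<^sup>+t\<in>{0..1}. ennreal (norm (f (?e t)) powr s) \<partial>lborel)"
  proof (intro nn_integral_cong, goal_cases)
    case (1 t)
    have "?e t \<in> ball 0 \<rho>" using ne[of t] d(1) by (simp add: \<rho>_def)
    from nF[OF this] show ?case using hf[OF ne[of t]] by simp
  qed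
  finally show ?thesis
    using h0 nF[of 0] s d by (elim order_trans[rotated]) (auto simp: \<rho>_def add_nonneg_pos intro!: ennreal_leI powr_mono2)
qed

section \<open>Rotation invariance of planar Lebesgue measure and the area mean\<close>

definition complex_of_vec :: "real ^ 2 \<Rightarrow> complex" where
  "complex_of_vec v = Complex (v $ 1) (v $ 2)"

lemma continuous_complex_of_vec: "continuous_on S complex_of_vec"
  unfolding complex_of_vec_def Complex_eq by (intro continuous_intros)

lemma complex_of_vec_measurable [measurable]: "complex_of_vec \<in> borel \<rightarrow>\<^sub>M borel"
  by (intro borel_measurable_continuous_onI continuous_complex_of_vec)

lemma distr_complex_of_vec: "distr lborel borel complex_of_vec = lborel"
proof (rule lborel_eqI[symmetric])
  fix l u :: complex assume le: "\<And>b. b \<in> Basis \<Longrightarrow> l \<bullet> b \<le> u \<bullet> b"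
  have B2: "(Basis :: (real ^ 2) set) = {axis 1 1, axis 2 1}"
    by (auto simp: Basis_vec_def UNIV_2)
  have ne: "axis 1 1 \<noteq> (axis 2 1 :: real ^ 2)" by (simp add: axis_eq_axis)
  have "complex_of_vec -` box l u = box (vector [Re l, Im l]) (vector [Re u, Im u])"
    by (auto simp: complex_of_vec_def box_def Basis_complex_def B2 inner_axis vector_2)
  then have "emeasure (distr lborel borel complex_of_vec) (box l u)
      = emeasure lborel (box (vector [Re l, Im l]) (vector [Re u, Im u]) :: (real ^ 2) set)"
    by (simp add: emeasure_distr)
  also have "\<dots> = (\<Prod>b\<in>Basis. (u - l) \<bullet> b)"
    using le[of 1] le[of \<i>] by (subst emeasure_lborel_box)
      (auto simp: B2 ne Basis_complex_def inner_axis vector_2 inner_diff_left)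
  finally show "emeasure (distr lborel borel complex_of_vec) (box l u) = (\<Prod>b\<in>Basis. (u - l) \<bullet> b)" .
qed simp

text \<open>The rotation is transported through \<open>complex_of_vec\<close> to
  \<open>real ^ 2\<close>, where \<open>measure_orthogonal_image\<close> applies; measures need only
  be compared on boxes.\<close>

lemma lborel_distr_rotation:
  assumes c: "norm c = 1"
  shows "distr lborel borel ((*) c) = (lborel :: complex measure)"
proof (rule lborel_eqI[symmetric])
  fix l u :: complex assume le: "\<And>b. b \<in> Basis \<Longrightarrow> l \<bullet> b \<le> u \<bullet> b"
  \<comment> \<open>\<open>T\<close> is multiplication by \<open>cnj c\<close>, the inverse of
    \<open>c\<close>, because the preimage of a box under multiplication by \<open>c\<close> has to
    be written as an image.\<close>
  define T :: "real ^ 2 \<Rightarrow> real ^ 2"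
    where "T v = (\<chi> i. if i = 1 then Re (cnj c * complex_of_vec v) else Im (cnj c * complex_of_vec v))" for v
  have gT: "complex_of_vec (T v) = cnj c * complex_of_vec v" for v
    by (simp add: T_def complex_of_vec_def complex_eq_iff)
  have nrm: "norm (complex_of_vec v) = norm v" for v
    by (simp add: complex_of_vec_def norm_vec_def L2_set_def cmod_def UNIV_2)
  have inj: "complex_of_vec v = complex_of_vec v' \<Longrightarrow> v = v'" for v v'
    by (auto simp: complex_of_vec_def vec_eq_iff forall_2)
  have add: "complex_of_vec (v + v') = complex_of_vec v + complex_of_vec v'" for v v'
    by (simp add: complex_of_vec_def complex_eq_iff)
  have scl: "complex_of_vec (a *\<^sub>R v) = a *\<^sub>R complex_of_vec v" for a v
    by (simp add: complex_of_vec_def complex_eq_iff)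
  have "linear T"
    by (rule linearI; rule inj) (simp_all add: gT add scl algebra_simps)
  moreover have "norm (T v) = norm v" for v
    using c by (simp add: norm_mult gT flip: nrm)
  ultimately have orth: "orthogonal_transformation T"
    by (simp add: orthogonal_transformation)
  define S where "S = complex_of_vec -` box l u"
  have oS: "open S"
    unfolding S_def by (rule open_vimage[OF open_box]) (rule continuous_complex_of_vec)
  have mS: "emeasure lborel S = (\<Prod>b\<in>Basis. (u - l) \<bullet> b)"
    using le by (subst emeasure_lborel_box[symmetric]) (auto simp: S_def emeasure_distr simp flip: distr_complex_of_vec)
  have lS: "S \<in> lmeasurable"
    using oS mS by (intro fmeasurableI) (auto simp: ennreal_mult_less_top)
  have im: "T ` S = complex_of_vec -` ((*) c -` box l u)"
  proof (intro set_eqI iffI)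
    fix v assume "v \<in> T ` S"
    then obtain x where "v = T x" "complex_of_vec x \<in> box l u" by (auto simp: S_def)
    moreover have "c * (cnj c * complex_of_vec x) = complex_of_vec x"
      using c complex_norm_square[of c] by (simp add: mult.assoc[symmetric])
    ultimately show "v \<in> complex_of_vec -` ((*) c -` box l u)" by (simp only: vimage_eq gT)
  next
    fix v assume v: "v \<in> complex_of_vec -` ((*) c -` box l u)"
    define x :: "real ^ 2" where "x = (\<chi> i. if i = 1 then Re (c * complex_of_vec v) else Im (c * complex_of_vec v))"
    have x: "complex_of_vec x = c * complex_of_vec v"
      by (simp add: x_def complex_of_vec_def complex_eq_iff)
    have "cnj c * (c * complex_of_vec v) = complex_of_vec v"
      using c complex_norm_square[of c] by (simp add: mult.assoc[symmetric] mult.commute)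
    then have "v = T x" by (intro inj) (simp add: gT x)
    moreover have "x \<in> S" using v by (simp add: S_def x)
    ultimately show "v \<in> T ` S" by blast
  qed
  have oT: "open (T ` S)"
    unfolding im using continuous_complex_of_vec
    by (auto intro!: open_vimage continuous_intros)
  have "open ((*) c -` box l u)" by (intro open_vimage continuous_intros) auto
  then have [measurable]: "(*) c -` box l u \<in> sets borel" by (rule borel_open)
  have "emeasure (distr lborel borel ((*) c)) (box l u) = emeasure lborel (T ` S)"
    unfolding im by (subst distr_complex_of_vec[symmetric]) (simp add: emeasure_distr)
  also have "\<dots> = emeasure lebesgue (T ` S)"
    using oT by simp
  also have "\<dots> = emeasure lebesgue S"
    using measure_orthogonal_image[OF orth lS] measurable_orthogonal_image[OF orth lS] lS
    by (simp add: emeasure_eq_measure2)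
  also have "\<dots> = emeasure lborel S" using oS by simp
  finally show "emeasure (distr lborel borel ((*) c)) (box l u) = (\<Prod>b\<in>Basis. (u - l) \<bullet> b)"
    using mS by simp
qed simp

text \<open>Averaging over rotations of the disk reduces this to \<open>circle_submean\<close> without polar
  coordinates; circles through a zero of \<open>f\<close> form a null set.\<close>

lemma area_submean:
  assumes f: "f holomorphic_on UNIV" and s: "0 < s"
  shows "emeasure lborel (ball (0::complex) \<rho>) * ennreal (norm (f 0) powr s)
    \<le> (\<integral>\<^sup>+z\<in>ball 0 \<rho>. ennreal (norm (f z) powr s) \<partial>lborel)"
proof (cases "f 0 = 0")
  case False
  let ?e = "\<lambda>t. exp (2 * of_real pi * \<i> * complex_of_real t)"
  have cf: "continuous_on UNIV f" using f by (rule holomorphic_on_imp_continuous_on)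
  have [measurable]: "f \<in> borel \<rightarrow>\<^sub>M borel" using cf by (rule borel_measurable_continuous_onI)
  have [measurable]: "?e \<in> borel \<rightarrow>\<^sub>M borel"
    by (intro borel_measurable_continuous_onI continuous_intros)
  have ne: "norm (?e t) = 1" for t by (simp add: norm_exp_eq_Re)
  define Z where "Z = {z \<in> cball 0 \<rho>. f z = 0}"
  have finZ: "finite Z" unfolding Z_def by (rule entire_finite_zeros[OF f False])
  \<comment> \<open>The point 0 belongs to the exceptional set because \<open>circle_submean\<close>
    requires a circle of positive radius.\<close>
  define N :: "complex set" where "N = insert 0 (\<Union>a\<in>Z. sphere 0 (norm a))"
  have "negligible N"
    unfolding N_def using finZ by (intro negligible_insert[THEN iffD2] negligible_Union) (auto simp: negligible_sphere)
  then have "N \<in> null_sets lebesgue" by (simp add: negligible_iff_null_sets)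
  moreover have "N \<in> sets lborel"
  proof -
    have "closed N"
      unfolding N_def using finZ by (intro closed_insert closed_UN) auto
    then show ?thesis by simp
  qed
  ultimately have N: "N \<in> null_sets lborel"
    by (simp add: null_sets_completion_iff)
  let ?g = "\<lambda>z. ennreal (norm (f z) powr s)"
  define G where "G z = ?g z * indicator (ball 0 \<rho>) z" for z
  have [measurable]: "G \<in> borel \<rightarrow>\<^sub>M borel"
    unfolding G_def by (intro borel_measurable_times_ennreal borel_measurable_indicator) auto
  have "emeasure lborel (ball (0::complex) \<rho>) * ennreal (norm (f 0) powr s)
      = (\<integral>\<^sup>+z\<in>ball (0::complex) \<rho>. ennreal (norm (f 0) powr s) \<partial>lborel)"
    by (subst nn_integral_cmult_indicator) (simp_all add: mult.commute)
  also have "\<dots> \<le> (\<integral>\<^sup>+z\<in>ball 0 \<rho>. (\<integral>\<^sup>+t\<in>{0..1}. ?g (z * ?e t) \<partial>lborel) \<partial>lborel)"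
  proof (intro nn_integral_mono_AE, rule AE_mp[OF AE_not_in[OF N]], intro AE_I2 impI)
    fix z :: complex assume z: "z \<notin> N"
    show "ennreal (norm (f 0) powr s) * indicator (ball 0 \<rho>) z
       \<le> (\<integral>\<^sup>+t\<in>{0..1}. ?g (z * ?e t) \<partial>lborel) * indicator (ball 0 \<rho>) z"
    proof (cases "z \<in> ball 0 \<rho>")
      case True
      have "f w \<noteq> 0" if "norm w = norm z" for w
        using z True that by (auto simp: N_def Z_def)
      then have "ennreal (norm (f 0) powr s) \<le> (\<integral>\<^sup>+t\<in>{0..1}. ?g (z * ?e t) \<partial>lborel)"
        using z by (intro circle_submean[OF f _ _ s]) (auto simp: N_def)
      then show ?thesis using True by simp
    qed simp
  qed
  also have "\<dots> = (\<integral>\<^sup>+z. \<integral>\<^sup>+t. indicator {0..1} t * G (?e t * z) \<partial>lborel \<partial>lborel)"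
  proof (intro nn_integral_cong, goal_cases)
    case (1 z)
    have "indicator (ball 0 \<rho>) (?e t * z) = (indicator (ball 0 \<rho>) z :: ennreal)" for t
      using ne[of t] by (simp add: indicator_def norm_mult)
    then show ?case
      by (subst nn_integral_multc[symmetric]) (simp_all add: G_def mult_ac)
  qed
  also have "\<dots> = (\<integral>\<^sup>+t. \<integral>\<^sup>+z. indicator {0..1} t * G (?e t * z) \<partial>lborel \<partial>lborel)"
    by (rule lborel_pair.Fubini'[symmetric]) measurable
  also have "\<dots> = (\<integral>\<^sup>+(t::real). indicator {0..1} t * (\<integral>\<^sup>+z. G z \<partial>lborel) \<partial>lborel)"
  proof (intro nn_integral_cong, goal_cases)
    case (1 t)
    have "(\<integral>\<^sup>+z. G (?e t * z) \<partial>lborel) = (\<integral>\<^sup>+z. G z \<partial>distr lborel borel ((*) (?e t)))"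
      by (subst nn_integral_distr) auto
    then show ?case
      using lborel_distr_rotation[OF ne[of t]] by (simp add: nn_integral_cmult)
  qed
  also have "\<dots> = (\<integral>\<^sup>+z. G z \<partial>lborel)"
    by (simp add: nn_integral_multc)
  also have "\<dots> = (\<integral>\<^sup>+z. ?g z * indicator (ball 0 \<rho>) z \<partial>lborel)"
    by (simp add: G_def)
  finally show ?thesis .
qed simp

section \<open>Gaining a small factor from a set of positive density\<close>

lemma measurable_pred_ball [measurable (raw)]:
  fixes f g :: "'a \<Rightarrow> complex"
  assumes [measurable]: "f \<in> M \<rightarrow>\<^sub>M borel" "g \<in> M \<rightarrow>\<^sub>M borel"
  shows "Measurable.pred M (\<lambda>x. f x \<in> ball (g x) r)"
  unfolding mem_ball by measurable

text \<open>Young's inequality with second factor 1. It serves off the dense set, where a constant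
  term 1 is affordable since it is integrated over the missing area only.\<close>

lemma powr_inverse_le_affine:
  fixes x :: real
  assumes "0 \<le> x" "1 \<le> Q"
  shows "x powr (1 / Q) \<le> x / Q + 1"
proof (cases "x = 0")
  case False
  have "x powr (1 / Q) \<le> x / Q + (1 - 1 / Q)"
    using Youngs_inequality_0[of "1 / Q" "1 - 1 / Q" x 1] assms False by simp
  moreover have "1 / Q \<ge> 0" using assms by simp
  ultimately show ?thesis by linarith
qed simp

text \<open>Below the threshold \<tau>^Q the power is at most \<tau>; above it concavity lets the
  linear term win, with a coefficient fixed by that threshold. It serves on the dense set with
  \<tau> = 1/Q: the constant becomes tiny, and the large coefficient only enters the harmless
  integral over that set.\<close>

lemma powr_inverse_le_linear:
  fixes x :: real
  assumes "0 \<le> x" "1 \<le> Q" "0 < \<tau>"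
  shows "x powr (1 / Q) \<le> \<tau> + \<tau> powr (1 - Q) * x"
proof (cases "x \<le> \<tau> powr Q")
  case True
  then have "x powr (1 / Q) \<le> (\<tau> powr Q) powr (1 / Q)"
    using assms by (intro powr_mono2) auto
  also have "\<dots> = \<tau>" using assms by (simp add: powr_powr)
  also have "\<dots> \<le> \<tau> + \<tau> powr (1 - Q) * x" using assms by simp
  finally show ?thesis .
next
  case False
  then have x: "\<tau> powr Q < x" "0 < x" using assms by (auto intro: order_le_less_trans[of 0 "\<tau> powr Q"])
  have "x powr (1 / Q) = x powr (1 / Q - 1) * x"
    using x powr_add[of x "1 / Q - 1" 1] by simp
  also have "x powr (1 / Q - 1) \<le> (\<tau> powr Q) powr (1 / Q - 1)"
    using x assms by (intro powr_mono2') auto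
  also have "(\<tau> powr Q) powr (1 / Q - 1) = \<tau> powr (1 - Q)"
    using assms by (simp add: powr_powr right_diff_distrib)
  finally show ?thesis using x assms by (smt (verit) mult_right_mono)
qed

lemma ennreal_ball_integral_finite:
  fixes u :: "complex \<Rightarrow> real"
  assumes "continuous_on UNIV u" "\<And>z. 0 \<le> u z"
  shows "(\<integral>\<^sup>+z\<in>ball a \<rho>. ennreal (u z) \<partial>lborel) < \<infinity>"
proof -
  have "compact (u ` cball a \<rho>)"
    by (intro compact_continuous_image continuous_on_subset[OF assms(1)]) auto
  then have "bounded (u ` cball a \<rho>)" by (rule compact_imp_bounded)
  then obtain B where "\<forall>x\<in>u ` cball a \<rho>. norm x \<le> B" unfolding bounded_iff by blast
  then have B: "\<And>z. z \<in> cball a \<rho> \<Longrightarrow> u z \<le> B" using assms(2) by auto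
  have "(\<integral>\<^sup>+z\<in>ball a \<rho>. ennreal (u z) \<partial>lborel) \<le> (\<integral>\<^sup>+z\<in>ball a \<rho>. ennreal B \<partial>lborel)"
    by (intro nn_integral_mono) (auto simp: indicator_def intro!: ennreal_leI B)
  also have "\<dots> = ennreal B * emeasure lborel (ball a \<rho>)"
    by (subst nn_integral_cmult_indicator) auto
  also have "\<dots> < \<infinity>"
    using emeasure_bounded_finite[of "ball a \<rho>"] by (simp add: ennreal_mult_less_top)
  finally show ?thesis .
qed

text \<open>Applying the mean value inequality with the small exponent \<open>p / Q\<close> makes the contribution
  of the complement of \<open>E\<close> at most \<open>1 - \<theta> + O(1/Q)\<close> of the total; the \<open>Q\<close>-th power of this
  factor is as small as we please.\<close>

lemma density_submean:
  fixes p \<theta> \<eta> :: real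
  assumes p: "0 < p" and \<theta>: "0 < \<theta>" "\<theta> \<le> 1" and \<eta>: "0 < \<eta>"
  obtains C where "0 < C"
    "\<And>f \<rho> E. f holomorphic_on UNIV \<Longrightarrow> 0 < \<rho> \<Longrightarrow> E \<in> sets borel \<Longrightarrow> E \<subseteq> ball (0::complex) \<rho>
      \<Longrightarrow> ennreal \<theta> * emeasure lborel (ball (0::complex) \<rho>) \<le> emeasure lborel E
      \<Longrightarrow> emeasure lborel (ball (0::complex) \<rho>) * ennreal (norm (f 0) powr p)
        \<le> ennreal \<eta> * (\<integral>\<^sup>+z\<in>ball 0 \<rho>. ennreal (norm (f z) powr p) \<partial>lborel)
          + ennreal C * (\<integral>\<^sup>+z\<in>E. ennreal (norm (f z) powr p) \<partial>lborel)"
proof -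
  have "(\<lambda>n. (1 - \<theta> / 4) ^ n) \<longlonglongrightarrow> 0"
    using \<theta> by (intro LIMSEQ_realpow_zero) auto
  then have "eventually (\<lambda>n. (1 - \<theta> / 4) ^ n < \<eta>) sequentially"
    using \<eta> order_tendstoD(2) by blast
  then obtain n0 where n0: "\<And>n. n0 \<le> n \<Longrightarrow> (1 - \<theta> / 4) ^ n < \<eta>"
    by (auto simp: eventually_sequentially)
  obtain n1 :: nat where n1: "4 / \<theta> \<le> real n1" using real_arch_simple by blast
  define n where "n = max (max n0 n1) 1"
  \<comment> \<open>Two errors of size \<open>V / Q\<close> occur below. As \<open>Q\<close> is at
    least 4/\<theta>, each is at most \<theta>V/4; with a third error of that size, a quarter of the
    gain \<theta> survives.\<close>
  define Q where "Q = real n"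
  have Q1: "1 \<le> Q" and Q\<theta>: "4 / \<theta> \<le> Q" and Q\<eta>: "(1 - \<theta> / 4) ^ n < \<eta>"
    using n0 n1 by (auto simp: Q_def n_def)
  define K where "K = (1 / Q) powr (1 - Q)"
  have K: "0 < K" using Q1 by (simp add: K_def)
  \<comment> \<open>\<open>K\<close> is the coefficient from \<open>powr_inverse_le_linear\<close>
    at \<tau> = 1/Q. The factor 4/\<theta> makes \<open>K / m * J\<close> at most \<theta>V/4 in the
    case \<open>C * J < I\<close>.\<close>
  define C where "C = 4 / \<theta> * K"
  have C: "0 < C" using K \<theta> by (simp add: C_def)
  show ?thesis
  proof (rule that[OF C])
    fix f \<rho> and E :: "complex set"
    assume f: "f holomorphic_on UNIV" and \<rho>: "0 < \<rho>" and E[measurable]: "E \<in> sets borel"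
      and sub: "E \<subseteq> ball (0::complex) \<rho>"
      and dens: "ennreal \<theta> * emeasure lborel (ball (0::complex) \<rho>) \<le> emeasure lborel E"
    let ?B = "ball (0::complex) \<rho>"
    have cf: "continuous_on UNIV f" using f by (rule holomorphic_on_imp_continuous_on)
    have [measurable]: "f \<in> borel \<rightarrow>\<^sub>M borel" using cf by (rule borel_measurable_continuous_onI)
    define u where "u z = norm (f z) powr p" for z
    have u0: "0 \<le> u z" for z by (simp add: u_def)
    have [measurable]: "u \<in> borel \<rightarrow>\<^sub>M borel" unfolding u_def by measurable
    have cu: "continuous_on UNIV u"
      unfolding u_def using cf p by (intro continuous_on_powr' continuous_intros) auto
    define V where "V = measure lborel ?B"
    define e where "e = measure lborel E"
    have V: "emeasure lborel ?B = ennreal V"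
      unfolding V_def using emeasure_bounded_finite[of ?B] by (intro emeasure_eq_ennreal_measure) auto
    have "emeasure lborel ?B > 0" using \<rho> by (simp add: emeasure_ball)
    then have V0: "0 < V" using V by simp
    have eV: "emeasure lborel E \<le> emeasure lborel ?B" using sub by (intro emeasure_mono) auto
    have e: "emeasure lborel E = ennreal e"
      unfolding e_def using eV V by (intro emeasure_eq_ennreal_measure) (auto simp: top_unique)
    have e0: "0 \<le> e" by (simp add: e_def)
    have eV': "e \<le> V" using eV V0 by (simp add: V e)
    have \<theta>e: "\<theta> * V \<le> e" using dens \<theta> V0 e0 by (simp add: V e flip: ennreal_mult)
    define I where "I = enn2real (\<integral>\<^sup>+z\<in>?B. ennreal (u z) \<partial>lborel)"
    define J where "J = enn2real (\<integral>\<^sup>+z\<in>E. ennreal (u z) \<partial>lborel)"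
    have finI: "(\<integral>\<^sup>+z\<in>?B. ennreal (u z) \<partial>lborel) < \<infinity>"
      by (rule ennreal_ball_integral_finite[OF cu u0])
    have JI: "(\<integral>\<^sup>+z\<in>E. ennreal (u z) \<partial>lborel) \<le> (\<integral>\<^sup>+z\<in>?B. ennreal (u z) \<partial>lborel)"
      using sub by (intro nn_integral_mono) (auto simp: indicator_def)
    have I: "(\<integral>\<^sup>+z\<in>?B. ennreal (u z) \<partial>lborel) = ennreal I"
      unfolding I_def using finI by simp
    have J: "(\<integral>\<^sup>+z\<in>E. ennreal (u z) \<partial>lborel) = ennreal J"
      unfolding J_def using le_less_trans[OF JI finI] by simp
    have I0: "0 \<le> I" and J0: "0 \<le> J" by (simp_all add: I_def J_def)
    have "ennreal V * ennreal (u 0) \<le> ennreal I"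
      using area_submean[OF f p, of \<rho>] by (simp add: V I flip: u_def)
    then have sm: "V * u 0 \<le> I" using V0 u0 I0 by (simp flip: ennreal_mult)
    have "V * u 0 \<le> \<eta> * I + C * J"
    \<comment> \<open>If \<open>E\<close> already carries a fixed share of the integral, the mean
      value inequality with exponent \<open>p\<close> suffices. Only the opposite case needs the
      small exponent.\<close>
    proof (cases "I = 0 \<or> I \<le> C * J")
      case True
      then show ?thesis using sm \<eta> C J0 I0 by (smt (verit) mult_nonneg_nonneg)
    next
      case False
      then have I1: "0 < I" and IJ: "C * J < I" using I0 by auto
      \<comment> \<open>\<open>m\<close> is the mean of \<open>u\<close>; dividing by it makes the
        estimate for the small power scale-free.\<close>
      define m where "m = I / V"
      have m: "0 < m" using I1 V0 by (simp add: m_def)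
      define c where "c = m powr (1 / Q)"
      have c: "0 < c" using m by (simp add: c_def)
      define x where "x z = (u z / m) powr (1 / Q)" for z
      have x0: "0 \<le> x z" for z by (simp add: x_def)
      have [measurable]: "x \<in> borel \<rightarrow>\<^sub>M borel" unfolding x_def by measurable
      have fx: "norm (f z) powr (p / Q) = c * x z" for z
        using m u0[of z] by (simp add: c_def x_def powr_divide u_def powr_powr)
      have "ennreal (V * x 0) * ennreal c = ennreal V * ennreal (norm (f 0) powr (p / Q))"
        using V0 c x0[of 0] by (simp add: fx mult_ac flip: ennreal_mult)
      also have "\<dots> \<le> (\<integral>\<^sup>+z\<in>?B. ennreal (norm (f z) powr (p / Q)) \<partial>lborel)"
        using area_submean[OF f, of "p / Q" \<rho>] p Q1 by (simp add: V)
      also have "\<dots> = (\<integral>\<^sup>+z. (ennreal (x z) * indicator ?B z) * ennreal c \<partial>lborel)"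
        using c x0 by (intro nn_integral_cong) (simp add: fx ennreal_mult mult_ac)
      also have "\<dots> = (\<integral>\<^sup>+z. ennreal (x z) * indicator ?B z \<partial>lborel) * ennreal c"
        by (intro nn_integral_multc) measurable
      finally have "ennreal (V * x 0) \<le> (\<integral>\<^sup>+z. ennreal (x z) * indicator ?B z \<partial>lborel)"
        using c by (simp add: mult.commute[of _ "ennreal c"] ennreal_mult_le_mult_iff)
      \<comment> \<open>The linear bound is used on \<open>E\<close> and the affine bound elsewhere.
        The \<open>u\<close> term of the latter is integrated over the whole disk, which costs only
        \<open>V / Q\<close>.\<close>
      also have "\<dots> \<le> (\<integral>\<^sup>+z. ennreal (1 / (Q * m)) * (ennreal (u z) * indicator ?B z)
          + (indicator (?B - E) z + (ennreal (1 / Q) * indicator E z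
          + ennreal (K / m) * (ennreal (u z) * indicator E z))) \<partial>lborel)"
      proof (intro nn_integral_mono, goal_cases)
        case (1 z)
        have a: "x z \<le> u z / m / Q + 1"
          unfolding x_def using u0[of z] m Q1 by (intro powr_inverse_le_affine) auto
        have b: "x z \<le> 1 / Q + K * (u z / m)"
          unfolding x_def K_def using u0[of z] m Q1 by (intro powr_inverse_le_linear) auto
        consider "z \<in> E" "z \<in> ?B" | "z \<notin> E" "z \<in> ?B" | "z \<notin> E" "z \<notin> ?B" using sub by blast
        then show ?case
        proof cases
          case 1
          have "ennreal (x z) \<le> ennreal (1 / Q + K * (u z / m))" using b by (rule ennreal_leI)
          also have "\<dots> = ennreal (1 / Q) + ennreal (K / m) * ennreal (u z)"
            using m K Q1 u0[of z] by (simp add: ennreal_plus flip: ennreal_mult)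
          finally show ?thesis using 1 by (simp add: add_increasing)
        next
          case 2
          have "ennreal (x z) \<le> ennreal (u z / m / Q + 1)" using a by (rule ennreal_leI)
          also have "\<dots> = ennreal (1 / (Q * m)) * ennreal (u z) + 1"
            using m Q1 u0[of z] by (simp add: ennreal_plus mult.commute flip: ennreal_mult)
          finally show ?thesis using 2 by simp
        qed simp
      qed
      also have "\<dots> = ennreal (1 / (Q * m)) * ennreal I + (emeasure lborel (?B - E)
          + (ennreal (1 / Q) * ennreal e + ennreal (K / m) * ennreal J))"
        by (simp add: nn_integral_add nn_integral_cmult I J e[symmetric])
      also have "emeasure lborel (?B - E) = ennreal (V - e)"
        using sub V0 e0 by (subst emeasure_Diff) (auto simp: V e ennreal_minus)
      also have "ennreal (1 / (Q * m)) * ennreal I + (ennreal (V - e)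
          + (ennreal (1 / Q) * ennreal e + ennreal (K / m) * ennreal J))
          = ennreal (1 / (Q * m) * I + ((V - e) + (1 / Q * e + K / m * J)))"
        using Q1 m I0 J0 e0 eV' K by (simp add: ennreal_plus flip: ennreal_mult)
      finally have "V * x 0 \<le> 1 / (Q * m) * I + ((V - e) + (1 / Q * e + K / m * J))"
        using Q1 m I0 J0 e0 eV' K by (subst (asm) ennreal_le_iff) (auto intro!: add_nonneg_nonneg)
      also have "1 / (Q * m) * I = V / Q"
        using m V0 I1 by (simp add: m_def)
      also have "1 / Q * e \<le> V / Q" using eV' Q1 by (simp add: divide_right_mono)
      also have "K / m * J \<le> V * \<theta> / 4"
      proof -
        have "4 * (K * J) \<le> \<theta> * I" using IJ \<theta> by (simp add: C_def field_simps)
        also have "\<theta> * I = \<theta> * V * m" using V0 by (simp add: m_def)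
        finally show ?thesis using m by (simp add: field_simps)
      qed
      finally have "V * x 0 \<le> V / Q + (V - e + (V / Q + V * \<theta> / 4))" by simp
      also have "\<dots> \<le> V / Q + (V - \<theta> * V + (V / Q + V * \<theta> / 4))" using \<theta>e by (simp add: mult.commute[of V \<theta>])
      also have "V / Q \<le> V * (\<theta> / 4)"
      proof -
        have "1 / Q \<le> \<theta> / 4" using Q\<theta> Q1 \<theta> by (simp add: field_simps)
        then show ?thesis using V0 mult_left_mono[of "1 / Q" "\<theta> / 4" V] by simp
      qed
      finally have "V * x 0 \<le> V * (1 - \<theta> / 4)" by (simp add: algebra_simps)
      then have "x 0 \<le> 1 - \<theta> / 4" using V0 by simp
      then have "x 0 ^ n \<le> (1 - \<theta> / 4) ^ n" using x0 by (rule power_mono)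
      also have "x 0 ^ n = u 0 / m"
      proof (cases "u 0 = 0")
        case True then show ?thesis using Q1 by (simp add: x_def Q_def)
      next
        case False
        then have "0 < u 0 / m" using m u0[of 0] by simp
        moreover have "0 < x 0" using False m by (simp add: x_def)
        then have "x 0 ^ n = x 0 powr Q" by (simp add: Q_def powr_realpow)
        ultimately show ?thesis using Q1 u0[of 0] m by (simp add: x_def powr_powr)
      qed
      finally have "u 0 / m \<le> \<eta>" using Q\<eta> by simp
      then have "V * u 0 \<le> \<eta> * I" using m V0 by (simp add: m_def field_simps)
      then show ?thesis using C J0 by (smt (verit) mult_nonneg_nonneg)
    qed
    then have "ennreal (V * u 0) \<le> ennreal (\<eta> * I + C * J)" by (rule ennreal_leI)
    then show "emeasure lborel ?B * ennreal (norm (f 0) powr p)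
        \<le> ennreal \<eta> * (\<integral>\<^sup>+z\<in>?B. ennreal (norm (f z) powr p) \<partial>lborel)
          + ennreal C * (\<integral>\<^sup>+z\<in>E. ennreal (norm (f z) powr p) \<partial>lborel)"
      using V0 u0 \<eta> C I0 J0 by (simp add: V I J ennreal_plus ennreal_mult flip: u_def)
  qed
qed

lemma nn_integral_lborel_translate:
  fixes a :: "'a::euclidean_space"
  assumes [measurable]: "F \<in> borel \<rightarrow>\<^sub>M borel"
  shows "(\<integral>\<^sup>+z. F (a + z) \<partial>lborel) = (\<integral>\<^sup>+z. F z \<partial>lborel)"
proof -
  have "(\<integral>\<^sup>+z. F z \<partial>lborel) = (\<integral>\<^sup>+z. F z \<partial>distr lborel borel ((+) a))"
    by (simp add: lborel_distr_plus)
  also have "\<dots> = (\<integral>\<^sup>+z. F (a + z) \<partial>lborel)"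
    by (subst nn_integral_distr) auto
  finally show ?thesis by simp
qed

lemma emeasure_lborel_translate:
  fixes a :: "'a::euclidean_space"
  assumes [measurable]: "E \<in> sets borel"
  shows "emeasure lborel {z. a + z \<in> E} = emeasure lborel E"
proof -
  have "emeasure lborel E = emeasure (distr lborel borel ((+) a)) E"
    by (simp add: lborel_distr_plus)
  also have "\<dots> = emeasure lborel {z. a + z \<in> E}"
    by (subst emeasure_distr) (auto simp: vimage_def)
  finally show ?thesis by simp
qed

lemma emeasure_ball_translate: "emeasure lborel (ball (a::complex) \<rho>) = emeasure lborel (ball (0::complex) \<rho>)"
  by (cases "0 \<le> \<rho>") (simp_all add: emeasure_ball ball_empty)

section \<open>Fock integrands\<close>

text \<open>The Weyl translation of the Fock space: the exponential is the holomorphic factor that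
  turns the Gaussian centred at 0, translated by \<open>a\<close>, back into the centred one.
  Estimates at the origin thus hold at every \<open>a\<close> with the same constants.\<close>

definition fock_shift :: "real \<Rightarrow> (complex \<Rightarrow> complex) \<Rightarrow> complex \<Rightarrow> complex \<Rightarrow> complex" where
  "fock_shift \<alpha> f a z = f (a + z) * exp (- of_real \<alpha> * cnj a * z - of_real (\<alpha> / 2 * (norm a)\<^sup>2))"

lemma fock_shift_holomorphic:
  "f holomorphic_on UNIV \<Longrightarrow> fock_shift \<alpha> f a holomorphic_on UNIV"
  unfolding fock_shift_def
  by (intro holomorphic_intros holomorphic_on_compose_gen[where g = f and f = "\<lambda>z. a + z", unfolded o_def]) auto

lemma fock_integrand_shift:
  "fock_integrand p \<alpha> f (a + z) = norm (fock_shift \<alpha> f a z) powr p * exp (- (p * \<alpha> / 2) * (norm z)\<^sup>2)"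
proof -
  have sq: "(norm (a + z))\<^sup>2 = (norm a)\<^sup>2 + 2 * Re (cnj a * z) + (norm z)\<^sup>2"
    unfolding cmod_power2 by (simp add: power2_eq_square algebra_simps)
  have "norm (fock_shift \<alpha> f a z) powr p
      = norm (f (a + z)) powr p * exp (p * (- \<alpha> * Re (cnj a * z) - \<alpha> / 2 * (norm a)\<^sup>2))"
    by (simp add: fock_shift_def norm_mult powr_mult powr_def[of "exp _"] mult.assoc)
  then show ?thesis
    unfolding fock_integrand_def sq by (simp add: mult.assoc mult_exp_exp) (simp add: algebra_simps)
qed

lemma fock_integrand_nonneg: "0 \<le> fock_integrand p \<alpha> f z"
  by (simp add: fock_integrand_def)

lemma fock_integrand_continuous:
  "f holomorphic_on UNIV \<Longrightarrow> 0 < p \<Longrightarrow> continuous_on UNIV (fock_integrand p \<alpha> f)"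
  unfolding fock_integrand_def
  by (intro continuous_on_powr' continuous_intros holomorphic_on_imp_continuous_on) auto

lemma fock_integrand_measurable:
  "f holomorphic_on UNIV \<Longrightarrow> 0 < p \<Longrightarrow> fock_integrand p \<alpha> f \<in> borel \<rightarrow>\<^sub>M borel"
  by (intro borel_measurable_continuous_onI fock_integrand_continuous)

lemma fock_integrand_centre: "fock_integrand p \<alpha> f a = norm (fock_shift \<alpha> f a 0) powr p"
  using fock_integrand_shift[of p \<alpha> f a 0] by simp

lemma fock_shift_le:
  assumes "0 < p" "0 < \<alpha>" "norm z \<le> \<rho>"
  shows "norm (fock_shift \<alpha> f a z) powr p \<le> exp (p * \<alpha> / 2 * \<rho>\<^sup>2) * fock_integrand p \<alpha> f (a + z)"
proof -
  have "norm (fock_shift \<alpha> f a z) powr p = exp (p * \<alpha> / 2 * (norm z)\<^sup>2) * fock_integrand p \<alpha> f (a + z)"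
    by (simp add: fock_integrand_shift exp_minus)
  also have "\<dots> \<le> exp (p * \<alpha> / 2 * \<rho>\<^sup>2) * fock_integrand p \<alpha> f (a + z)"
    using assms by (intro mult_right_mono fock_integrand_nonneg) (auto intro!: mult_left_mono power_mono)
  finally show ?thesis .
qed

lemma fock_density_submean:
  fixes p \<alpha> \<theta> \<eta> \<rho> :: real
  assumes p: "0 < p" and \<alpha>: "0 < \<alpha>" and \<rho>: "0 < \<rho>" and \<theta>: "0 < \<theta>" "\<theta> \<le> 1" and \<eta>: "0 < \<eta>"
  obtains C where "0 < C"
    "\<And>f a E. f holomorphic_on UNIV \<Longrightarrow> E \<in> sets borel
      \<Longrightarrow> ennreal \<theta> * emeasure lborel (ball a \<rho>) \<le> emeasure lborel (E \<inter> ball a \<rho>)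
      \<Longrightarrow> ennreal (fock_integrand p \<alpha> f a)
        \<le> ennreal \<eta> * (\<integral>\<^sup>+z\<in>ball a \<rho>. ennreal (fock_integrand p \<alpha> f z) \<partial>lborel)
          + ennreal C * (\<integral>\<^sup>+z\<in>E \<inter> ball a \<rho>. ennreal (fock_integrand p \<alpha> f z) \<partial>lborel)"
proof -
  define V where "V = measure lborel (ball (0::complex) \<rho>)"
  have V: "emeasure lborel (ball (0::complex) \<rho>) = ennreal V"
    unfolding V_def using emeasure_bounded_finite[of "ball (0::complex) \<rho>"]
    by (intro emeasure_eq_ennreal_measure) auto
  have "emeasure lborel (ball (0::complex) \<rho>) > 0" using \<rho> by (simp add: emeasure_ball)
  then have V0: "0 < V" using V by simp
  define K where "K = exp (p * \<alpha> / 2 * \<rho>\<^sup>2)"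
  have K: "0 < K" by (simp add: K_def)
  \<comment> \<open>\<open>density_submean\<close> is invoked with this value because its left-hand
    side carries the area \<open>V\<close>, and returning from the shifted function to the Fock
    integrand costs the factor \<open>K\<close>.\<close>
  have "0 < \<eta> * V / K" using \<eta> V0 K by simp
  then obtain C0 where C0: "0 < C0" and *:
    "\<And>f r E. f holomorphic_on UNIV \<Longrightarrow> 0 < r \<Longrightarrow> E \<in> sets borel \<Longrightarrow> E \<subseteq> ball (0::complex) r
      \<Longrightarrow> ennreal \<theta> * emeasure lborel (ball (0::complex) r) \<le> emeasure lborel E
      \<Longrightarrow> emeasure lborel (ball (0::complex) r) * ennreal (norm (f 0) powr p)
        \<le> ennreal (\<eta> * V / K) * (\<integral>\<^sup>+z\<in>ball 0 r. ennreal (norm (f z) powr p) \<partial>lborel)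
          + ennreal C0 * (\<integral>\<^sup>+z\<in>E. ennreal (norm (f z) powr p) \<partial>lborel)"
    using density_submean[OF p \<theta>] by blast
  define C where "C = C0 * K / V"
  have C: "0 < C" using C0 K V0 by (simp add: C_def)
  show ?thesis
  proof (rule that[OF C])
    fix f :: "complex \<Rightarrow> complex" and a :: complex and E assume f: "f holomorphic_on UNIV" and E[measurable]: "E \<in> sets borel"
      and dens: "ennreal \<theta> * emeasure lborel (ball a \<rho>) \<le> emeasure lborel (E \<inter> ball a \<rho>)"
    define N where "N z = ennreal (fock_integrand p \<alpha> f z)" for z
    have [measurable]: "N \<in> borel \<rightarrow>\<^sub>M borel"
      using fock_integrand_measurable[OF f p, of \<alpha>] unfolding N_def by measurable
    define g where "g = fock_shift \<alpha> f a"
    have g: "g holomorphic_on UNIV" unfolding g_def by (rule fock_shift_holomorphic[OF f])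
    have tr: "(\<integral>\<^sup>+z\<in>{z. a + z \<in> A}. ennreal (norm (g z) powr p) \<partial>lborel) \<le> ennreal K * (\<integral>\<^sup>+z\<in>A. N z \<partial>lborel)"
      if [measurable]: "A \<in> sets borel" and A: "A \<subseteq> ball a \<rho>" for A
    proof -
      have "(\<integral>\<^sup>+z\<in>{z. a + z \<in> A}. ennreal (norm (g z) powr p) \<partial>lborel)
          \<le> (\<integral>\<^sup>+z. ennreal K * (N (a + z) * indicator A (a + z)) \<partial>lborel)"
      proof (intro nn_integral_mono, goal_cases)
        case (1 z)
        show ?case
        proof (cases "a + z \<in> A")
          case True
          then have "norm z \<le> \<rho>" using A by (force simp: dist_norm)
          then have "ennreal (norm (g z) powr p) \<le> ennreal K * N (a + z)"
            unfolding g_def K_def N_def using fock_shift_le[OF p \<alpha>, of z \<rho> f a] fock_integrand_nonneg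
            by (simp flip: ennreal_mult)
          then show ?thesis using True by simp
        qed simp
      qed
      also have "\<dots> = (\<integral>\<^sup>+z. ennreal K * (N z * indicator A z) \<partial>lborel)"
        by (rule nn_integral_lborel_translate[of "\<lambda>z. ennreal K * (N z * indicator A z)"]) measurable
      also have "\<dots> = ennreal K * (\<integral>\<^sup>+z\<in>A. N z \<partial>lborel)"
        by (rule nn_integral_cmult) measurable
      finally show ?thesis .
    qed
    define E0 where "E0 = {z. a + z \<in> E \<inter> ball a \<rho>}"
    have "E0 = (+) a -` (E \<inter> ball a \<rho>) \<inter> space borel" by (auto simp: E0_def)
    also have "\<dots> \<in> sets borel" by (rule measurable_sets[of _ borel borel]) auto
    finally have E0m: "E0 \<in> sets borel" .
    have E0b: "E0 \<subseteq> ball 0 \<rho>" by (auto simp: E0_def dist_norm)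
    have ball0: "ball 0 \<rho> = {z. a + z \<in> ball a \<rho>}" by (auto simp: dist_norm)
    have "emeasure lborel E0 = emeasure lborel (E \<inter> ball a \<rho>)"
      unfolding E0_def by (rule emeasure_lborel_translate) measurable
    then have "ennreal \<theta> * emeasure lborel (ball (0::complex) \<rho>) \<le> emeasure lborel E0"
      using dens emeasure_ball_translate[of a \<rho>] by simp
    from *[OF g \<rho> E0m E0b this]
    have "ennreal V * N a
        \<le> ennreal (\<eta> * V / K) * (\<integral>\<^sup>+z\<in>ball 0 \<rho>. ennreal (norm (g z) powr p) \<partial>lborel)
          + ennreal C0 * (\<integral>\<^sup>+z\<in>E0. ennreal (norm (g z) powr p) \<partial>lborel)"
      by (simp add: V N_def fock_integrand_centre g_def)
    also have "\<dots> \<le> ennreal (\<eta> * V / K) * (ennreal K * (\<integral>\<^sup>+z\<in>ball a \<rho>. N z \<partial>lborel))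
          + ennreal C0 * (ennreal K * (\<integral>\<^sup>+z\<in>E \<inter> ball a \<rho>. N z \<partial>lborel))"
      unfolding ball0 E0_def by (intro add_mono mult_left_mono tr) auto
    also have "\<dots> = ennreal V * (ennreal \<eta> * (\<integral>\<^sup>+z\<in>ball a \<rho>. N z \<partial>lborel)
          + ennreal C * (\<integral>\<^sup>+z\<in>E \<inter> ball a \<rho>. N z \<partial>lborel))"
    proof -
      have e1: "ennreal (\<eta> * V / K) * ennreal K = ennreal V * ennreal \<eta>"
        using \<eta> V0 K by (simp add: mult.commute flip: ennreal_mult)
      have e2: "ennreal C0 * ennreal K = ennreal V * ennreal C"
        using V0 K C0 by (simp add: C_def flip: ennreal_mult)
      show ?thesis by (simp only: distrib_left e1 e2 flip: mult.assoc)
    qed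
    finally show "ennreal (fock_integrand p \<alpha> f a)
        \<le> ennreal \<eta> * (\<integral>\<^sup>+z\<in>ball a \<rho>. ennreal (fock_integrand p \<alpha> f z) \<partial>lborel)
          + ennreal C * (\<integral>\<^sup>+z\<in>E \<inter> ball a \<rho>. ennreal (fock_integrand p \<alpha> f z) \<partial>lborel)"
      using V0 unfolding N_def by (simp add: ennreal_mult_le_mult_iff)
  qed
qed

text \<open>For \<open>E = UNIV\<close> and density 1 the two integrals in
  \<open>fock_density_submean\<close> coincide, so their constants add up.\<close>

lemma fock_submean:
  fixes p \<alpha> \<rho> :: real
  assumes p: "0 < p" and \<alpha>: "0 < \<alpha>" and \<rho>: "0 < \<rho>"
  obtains C where "0 < C"
    "\<And>f a. f holomorphic_on UNIV \<Longrightarrow> ennreal (fock_integrand p \<alpha> f a)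
        \<le> ennreal C * (\<integral>\<^sup>+z\<in>ball a \<rho>. ennreal (fock_integrand p \<alpha> f z) \<partial>lborel)"
proof (rule fock_density_submean[OF p \<alpha> \<rho> zero_less_one order_refl zero_less_one])
  fix C :: real
  assume C: "0 < C" and *:
    "\<And>(f :: complex \<Rightarrow> complex) (a :: complex) E. f holomorphic_on UNIV \<Longrightarrow> E \<in> sets borel
      \<Longrightarrow> ennreal 1 * emeasure lborel (ball a \<rho>) \<le> emeasure lborel (E \<inter> ball a \<rho>)
      \<Longrightarrow> ennreal (fock_integrand p \<alpha> f a)
        \<le> ennreal 1 * (\<integral>\<^sup>+z\<in>ball a \<rho>. ennreal (fock_integrand p \<alpha> f z) \<partial>lborel)
          + ennreal C * (\<integral>\<^sup>+z\<in>E \<inter> ball a \<rho>. ennreal (fock_integrand p \<alpha> f z) \<partial>lborel)"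
  show ?thesis
  proof (rule that[of "1 + C"])
    fix f :: "complex \<Rightarrow> complex" and a :: complex assume f: "f holomorphic_on UNIV"
    show "ennreal (fock_integrand p \<alpha> f a)
        \<le> ennreal (1 + C) * (\<integral>\<^sup>+z\<in>ball a \<rho>. ennreal (fock_integrand p \<alpha> f z) \<partial>lborel)"
      using *[OF f, of UNIV a] C by (simp add: distrib_right)
  qed (use C in simp)
qed

section \<open>Oscillation of Fock integrands on small disks\<close>

lemma norm_diff_le_of_bounded:
  assumes g: "g holomorphic_on UNIV" and B: "\<And>z. norm z \<le> 1 \<Longrightarrow> norm (g z) \<le> B"
    and v: "norm v \<le> 1 / 2"
  shows "norm (g 0 - g v) \<le> 2 * B * norm v"
proof -
  have d: "norm (deriv g z) \<le> 2 * B" if z: "z \<in> cball 0 (1 / 2)" for z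
  proof -
    \<comment> \<open>Cauchy disks of radius 1/2 about points of the half disk stay in the unit
      disk, where the bound \<open>B\<close> is available.\<close>
    have "norm ((deriv ^^ 1) g z) \<le> fact 1 * B / (1 / 2) ^ 1"
    proof (rule Cauchy_inequality)
      show "g holomorphic_on ball z (1 / 2)" using g by (rule holomorphic_on_subset) auto
      show "continuous_on (cball z (1 / 2)) g"
        using g by (intro holomorphic_on_imp_continuous_on) (auto intro: holomorphic_on_subset)
      show "norm (g x) \<le> B" if "norm (z - x) = 1 / 2" for x
        using z that norm_triangle_ineq4[of z "z - x"] by (intro B) auto
    qed auto
    then show ?thesis by simp
  qed
  have "norm (g 0 - g v) \<le> 2 * B * norm (0 - v)"
  proof (rule field_differentiable_bound[of "cball 0 (1 / 2)" g "deriv g"])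
    show "(g has_field_derivative deriv g z) (at z within cball 0 (1 / 2))" for z
      by (rule has_field_derivative_at_within) (rule holomorphic_derivI[OF g open_UNIV UNIV_I])
  qed (use d v in auto)
  then show ?thesis by simp
qed

text \<open>After shifting \<open>a\<close> to 0, the sub-mean value property bounds
  \<open>norm (g z)\<close> on the unit disk by \<open>B\<close>, where \<open>B powr p\<close> is
  comparable to the integral of the Fock integrand over \<open>ball a 2\<close>. Cauchy's estimate
  makes the change of \<open>g\<close> over distance \<open>r\<close> at most
  \<open>2 * B * r\<close>, and its \<open>p\<close>-th power supplies the small factor
  \<open>r powr p\<close>.\<close>

lemma fock_near:
  fixes p \<alpha> :: real
  assumes p: "0 < p" and \<alpha>: "0 < \<alpha>"
  obtains C1 C2 where "0 < C1" "0 < C2"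
    "\<And>f a u r. f holomorphic_on UNIV \<Longrightarrow> dist a u < r \<Longrightarrow> r \<le> 1 / 2 \<Longrightarrow> ennreal (fock_integrand p \<alpha> f a)
        \<le> ennreal C1 * ennreal (fock_integrand p \<alpha> f u)
          + ennreal (C2 * r powr p) * (\<integral>\<^sup>+z\<in>ball a 2. ennreal (fock_integrand p \<alpha> f z) \<partial>lborel)"
proof -
  obtain C where C: "0 < C" and sm: "\<And>f a. f holomorphic_on UNIV \<Longrightarrow> ennreal (fock_integrand p \<alpha> f a)
        \<le> ennreal C * (\<integral>\<^sup>+z\<in>ball a 1. ennreal (fock_integrand p \<alpha> f z) \<partial>lborel)"
    using fock_submean[OF p \<alpha>, of 1] by auto
  define K where "K = exp (p * \<alpha> / 2)"
  have K: "0 < K" by (simp add: K_def)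
  define C2 where "C2 = 4 powr p * K * C"
  have C2: "0 < C2" using K C by (simp add: C2_def)
  have C1: "0 < 2 powr p * K" using K by simp
  show ?thesis
  proof (rule that[OF C1 C2])
    fix f :: "complex \<Rightarrow> complex" and a u :: complex and r :: real assume f: "f holomorphic_on UNIV" and au: "dist a u < r" and r: "r \<le> 1 / 2"
    let ?N = "fock_integrand p \<alpha> f"
    have r0: "0 < r" using au zero_le_dist[of a u] by linarith
    define J where "J = (\<integral>\<^sup>+z\<in>ball a 2. ennreal (?N z) \<partial>lborel)"
    have "J < \<infinity>" unfolding J_def
      by (intro ennreal_ball_integral_finite fock_integrand_continuous[OF f p] fock_integrand_nonneg)
    then obtain I where I: "J = ennreal I" "0 \<le> I" by (cases J) auto
    define g where "g = fock_shift \<alpha> f a"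
    have g: "g holomorphic_on UNIV" unfolding g_def by (rule fock_shift_holomorphic[OF f])
    define B where "B = (K * C * I) powr (1 / p)"
    have gB: "norm (g z) \<le> B" if z: "norm z \<le> 1" for z
    proof -
      have "ennreal (?N (a + z)) \<le> ennreal C * (\<integral>\<^sup>+y\<in>ball (a + z) 1. ennreal (?N y) \<partial>lborel)"
        by (rule sm[OF f])
      also have "\<dots> \<le> ennreal C * J"
      proof -
        have "ball (a + z) 1 \<subseteq> ball a 2"
          using z by (intro ball_subset_ball_iff[THEN iffD2]) (simp add: dist_norm)
        then show ?thesis
          unfolding J_def by (intro mult_left_mono nn_integral_mono) (auto simp: indicator_def)
      qed
      finally have "?N (a + z) \<le> C * I"
        using C I by (simp flip: ennreal_mult)
      then have "norm (g z) powr p \<le> K * (C * I)"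
        using fock_shift_le[OF p \<alpha> z, of f a] K unfolding g_def K_def
        by (smt (verit) mult_left_mono one_power2 mult_cancel_left2 mult.right_neutral)
      then have "(norm (g z) powr p) powr (1 / p) \<le> B"
        unfolding B_def using p by (intro powr_mono2) (auto simp: mult.assoc)
      then show ?thesis using p by (simp add: powr_powr)
    qed
    have B0: "0 \<le> B" by (simp add: B_def)
    define v where "v = u - a"
    have v: "norm v < r" "norm v \<le> 1 / 2" "a + v = u"
      using au r by (auto simp: v_def dist_norm norm_minus_commute)
    have "norm (g 0) \<le> norm (g v) + norm (g 0 - g v)" by (metis add.commute diff_add_cancel norm_triangle_ineq)
    also have "norm (g 0 - g v) \<le> 2 * B * norm v"
      by (rule norm_diff_le_of_bounded[OF g gB v(2)])
    also have "2 * B * norm v \<le> 2 * B * r" using v B0 by (intro mult_left_mono) auto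
    finally have g0: "norm (g 0) \<le> norm (g v) + 2 * B * r" by simp
    \<comment> \<open>Comparing which summand of the previous bound is larger avoids convexity of
      the power, so all \<open>p > 0\<close> are covered at once.\<close>
    have "norm (g 0) powr p \<le> (2 * norm (g v)) powr p + (4 * B * r) powr p"
    proof (cases "norm (g v) \<le> 2 * B * r")
      case True
      then have "norm (g 0) powr p \<le> (4 * B * r) powr p"
        using g0 p by (intro powr_mono2) auto
      then show ?thesis by (smt (verit) powr_ge_zero)
    next
      case False
      then have "norm (g 0) powr p \<le> (2 * norm (g v)) powr p"
        using g0 p by (intro powr_mono2) auto
      then show ?thesis by (smt (verit) powr_ge_zero)
    qed
    also have "(2 * norm (g v)) powr p = 2 powr p * norm (g v) powr p"
      by (simp add: powr_mult)
    also have "norm (g v) powr p \<le> K * ?N u"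
      using fock_shift_le[OF p \<alpha>, of v 1 f a] v by (simp add: g_def K_def)
    also have "(4 * B * r) powr p = C2 * r powr p * I"
    proof -
      have "B powr p = K * C * I"
        using p K C I by (simp add: B_def powr_powr)
      then show ?thesis using B0 r0 by (simp add: powr_mult C2_def)
    qed
    finally have "?N a \<le> 2 powr p * K * ?N u + C2 * r powr p * I"
      by (simp add: fock_integrand_centre g_def mult.assoc)
    then have "ennreal (?N a) \<le> ennreal (2 powr p * K * ?N u + C2 * r powr p * I)"
      by (rule ennreal_leI)
    also have "\<dots> = ennreal (2 powr p * K) * ennreal (?N u) + ennreal (C2 * r powr p) * J"
      using K C2 I fock_integrand_nonneg[of p \<alpha> f u] by (simp add: ennreal_plus flip: ennreal_mult)
    finally show "ennreal (?N a) \<le> ennreal (2 powr p * K) * ennreal (?N u)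
        + ennreal (C2 * r powr p) * (\<integral>\<^sup>+z\<in>ball a 2. ennreal (?N z) \<partial>lborel)"
      unfolding J_def .
  qed
qed

section \<open>Restricted weights\<close>

lemma mem_square: "z \<in> square c s \<longleftrightarrow> Re c \<le> Re z \<and> Re z \<le> Re c + s \<and> Im c \<le> Im z \<and> Im z \<le> Im c + s"
  by (auto simp: square_def in_cbox_complex_iff)

lemma square_borel [measurable]: "square c s \<in> sets borel"
  by (simp add: square_def)

lemma emeasure_square:
  assumes "0 \<le> s"
  shows "emeasure lborel (square c s) = ennreal (s\<^sup>2)"
  using assms unfolding square_def
  by (subst emeasure_lborel_cbox) (auto simp: Basis_complex_def inner_complex_def power2_eq_square)

text \<open>By Hoelder's inequality the restricted \<open>A\<^sub>q\<close> condition gives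
  \<open>(\<integral>\<^sub>Q h)\<^sup>q W(Q) \<le> K\<^sup>q \<integral>\<^sub>Q h\<^sup>q W\<close> for all \<open>h \<ge> 0\<close>; \<open>test\<close> says this without powers of
  extended reals.\<close>

locale restricted_weight =
  fixes W :: "complex \<Rightarrow> ennreal" and q r K :: real
  assumes measurable_weight [measurable]: "W \<in> borel \<rightarrow>\<^sub>M borel"
    and q: "1 \<le> q" and r: "0 < r" and K: "0 < K"
    and square_fin: "(\<integral>\<^sup>+z\<in>square c r. W z \<partial>lborel) < \<infinity>"
    and square_pos: "0 < (\<integral>\<^sup>+z\<in>square c r. W z \<partial>lborel)"
    and test: "\<lbrakk>h \<in> borel \<rightarrow>\<^sub>M borel; \<And>z. 0 \<le> h z; 0 < y;
      (\<integral>\<^sup>+z\<in>square c r. ennreal (h z powr q) * W z \<partial>lborel) \<le> ennreal y * (\<integral>\<^sup>+z\<in>square c r. W z \<partial>lborel)\<rbrakk>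
      \<Longrightarrow> (\<integral>\<^sup>+z\<in>square c r. ennreal (h z) \<partial>lborel) \<le> ennreal (K * y powr (1 / q))"
begin

section \<open>Doubling at bounded distance\<close>

definition \<nu> :: "complex measure" where "\<nu> = density lborel W"

lemma sets_\<nu> [simp, measurable_cong]: "sets \<nu> = sets borel"
  by (simp add: \<nu>_def)

lemma emeasure_\<nu>: "E \<in> sets borel \<Longrightarrow> emeasure \<nu> E = (\<integral>\<^sup>+z\<in>E. W z \<partial>lborel)"
  by (simp add: \<nu>_def emeasure_density)

lemma square_real:
  obtains a where "0 < a" "emeasure \<nu> (square c r) = ennreal a"
proof -
  have "emeasure \<nu> (square c r) < \<infinity>" "0 < emeasure \<nu> (square c r)"
    using square_fin[of c] square_pos[of c] by (simp_all add: emeasure_\<nu>)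
  then show ?thesis using that by (cases "emeasure \<nu> (square c r)") auto
qed

text \<open>Testing with the indicator of \<open>E\<close> shows that a set with too small a share
  of the mass of the square would also have too small an area.\<close>

lemma square_le_subset:
  assumes E[measurable]: "E \<in> sets borel" and sub: "E \<subseteq> square c r"
    and \<kappa>: "0 < \<kappa>" "ennreal \<kappa> \<le> emeasure lborel E"
  shows "emeasure \<nu> (square c r) \<le> ennreal ((2 * K / \<kappa>) powr q) * emeasure \<nu> E"
proof -
  obtain a where a: "0 < a" "emeasure \<nu> (square c r) = ennreal a" by (rule square_real)
  have "emeasure \<nu> E \<le> emeasure \<nu> (square c r)" using sub by (intro emeasure_mono) auto
  then obtain e where e: "0 \<le> e" "emeasure \<nu> E = ennreal e"
    using a by (cases "emeasure \<nu> E") (auto simp: top_unique)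
  have "a \<le> (2 * K / \<kappa>) powr q * e"
  proof (rule ccontr)
    assume "\<not> ?thesis"
    then have lt: "(2 * K / \<kappa>) powr q * e < a" by simp
    \<comment> \<open>Chosen so that \<open>K * y powr (1 / q)\<close> equals \<kappa>/2; the factor
      1/2 turns the bound on the area of \<open>E\<close> into a contradiction.\<close>
    define y where "y = (\<kappa> / (2 * K)) powr q"
    have y0: "0 < y" using K \<kappa> by (simp add: y_def)
    have "y * (2 * K / \<kappa>) powr q = 1"
      using K \<kappa> by (simp add: y_def flip: powr_mult)
    then have ey: "e \<le> y * a"
      using mult_strict_left_mono[OF lt y0] by (simp add: mult.assoc[symmetric])
    have "(\<integral>\<^sup>+z\<in>square c r. ennreal (indicator E z powr q) * W z \<partial>lborel) = emeasure \<nu> E"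
      using sub q unfolding emeasure_\<nu>[OF E] by (intro nn_integral_cong) (auto simp: indicator_def)
    also have "\<dots> \<le> ennreal y * (\<integral>\<^sup>+z\<in>square c r. W z \<partial>lborel)"
      using e a ey y0 by (simp add: emeasure_\<nu> flip: ennreal_mult)
    finally have "(\<integral>\<^sup>+z\<in>square c r. ennreal (indicator E z) \<partial>lborel) \<le> ennreal (K * y powr (1 / q))"
      by (intro test y0) auto
    also have "(\<integral>\<^sup>+z\<in>square c r. ennreal (indicator E z) \<partial>lborel) = emeasure lborel E"
    proof -
      have "(\<integral>\<^sup>+z\<in>square c r. ennreal (indicator E z) \<partial>lborel) = (\<integral>\<^sup>+z. indicator E z \<partial>lborel)"
        using sub by (intro nn_integral_cong) (auto simp: indicator_def)
      then show ?thesis by simp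
    qed
    also have "K * y powr (1 / q) = \<kappa> / 2"
      using K \<kappa> q by (simp add: y_def powr_powr)
    finally show False using \<kappa> by (metis ennreal_le_iff field_sum_of_halves half_gt_zero less_add_same_cancel1 less_eq_real_def not_le order_trans)
  qed
  then show ?thesis using a e by (simp add: ennreal_leI flip: ennreal_mult)
qed

text \<open>The constant of \<open>square_le_subset\<close> for a subsquare of side
  \<open>r / 2\<close>. Two squares displaced by at most \<open>r / 2\<close> in each coordinate
  share such a subsquare.\<close>

definition "shift_const = (2 * K / (r / 2)\<^sup>2) powr q"

lemma shift_const_pos: "0 < shift_const"
  using K r by (simp add: shift_const_def)

lemma square_le_shift_half:
  assumes "\<bar>Re d\<bar> \<le> r / 2" "\<bar>Im d\<bar> \<le> r / 2"
  shows "emeasure \<nu> (square c r) \<le> ennreal shift_const * emeasure \<nu> (square (c + d) r)"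
proof -
  define E where "E = square (c + Complex (max 0 (Re d)) (max 0 (Im d))) (r / 2)"
  have E1: "E \<subseteq> square c r" and E2: "E \<subseteq> square (c + d) r"
    using assms by (auto simp: E_def mem_square)
  have [measurable]: "E \<in> sets borel" by (simp add: E_def)
  have "emeasure \<nu> (square c r) \<le> ennreal shift_const * emeasure \<nu> E"
    unfolding shift_const_def
    using r E1 by (intro square_le_subset) (auto simp: E_def emeasure_square)
  also have "\<dots> \<le> ennreal shift_const * emeasure \<nu> (square (c + d) r)"
    using E2 by (intro mult_left_mono emeasure_mono) auto
  finally show ?thesis .
qed

lemma square_le_shift:
  assumes "\<bar>Re d\<bar> \<le> real n * (r / 2)" "\<bar>Im d\<bar> \<le> real n * (r / 2)"
  shows "emeasure \<nu> (square c r) \<le> ennreal (shift_const ^ n) * emeasure \<nu> (square (c + d) r)"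
  using assms
proof (induction n arbitrary: d)
  case 0
  then have "d = 0" by (simp add: complex_eq_iff)
  then show ?case by simp
next
  case (Suc n)
  \<comment> \<open>The displacement is cut into \<open>n + 1\<close> equal steps;
    \<open>s *\<^sub>R d\<close> is the last of them.\<close>
  define s where "s = 1 / (real n + 1)"
  have s: "0 < s" "(1 - s) * (real n + 1) = real n" "s * (real n + 1) = 1" "s \<le> 1"
    by (auto simp: s_def field_simps)
  define d' where "d' = (1 - s) *\<^sub>R d"
  have split: "\<bar>(1 - s) * x\<bar> \<le> real n * (r / 2) \<and> \<bar>s * x\<bar> \<le> r / 2"
    if x: "\<bar>x\<bar> \<le> real (Suc n) * (r / 2)" for x
  proof
    have x': "\<bar>x\<bar> \<le> (real n + 1) * (r / 2)" using x by (simp add: add.commute)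
    have "\<bar>(1 - s) * x\<bar> = (1 - s) * \<bar>x\<bar>" using s by (simp add: abs_mult)
    also have "\<dots> \<le> (1 - s) * ((real n + 1) * (r / 2))"
      using s x' by (intro mult_left_mono) auto
    finally have "\<bar>(1 - s) * x\<bar> \<le> (1 - s) * ((real n + 1) * (r / 2))" .
    then show "\<bar>(1 - s) * x\<bar> \<le> real n * (r / 2)" using s(2) by (metis mult.assoc)
    have "\<bar>s * x\<bar> = s * \<bar>x\<bar>" using s by (simp add: abs_mult)
    also have "\<dots> \<le> s * ((real n + 1) * (r / 2))"
      using s x' by (intro mult_left_mono) auto
    finally have "\<bar>s * x\<bar> \<le> s * ((real n + 1) * (r / 2))" .
    then show "\<bar>s * x\<bar> \<le> r / 2" using s(3) by (metis mult.assoc mult_1)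
  qed
  have "emeasure \<nu> (square c r) \<le> ennreal (shift_const ^ n) * emeasure \<nu> (square (c + d') r)"
    using split[OF Suc.prems(1)] split[OF Suc.prems(2)] by (intro Suc.IH) (auto simp: d'_def)
  also have "\<dots> \<le> ennreal (shift_const ^ n) * (ennreal shift_const * emeasure \<nu> (square (c + d' + s *\<^sub>R d) r))"
    using split[OF Suc.prems(1)] split[OF Suc.prems(2)]
    by (intro mult_left_mono square_le_shift_half) auto
  also have "c + d' + s *\<^sub>R d = c + d" by (simp add: d'_def algebra_simps)
  finally show ?case
    using shift_const_pos by (simp add: ennreal_mult mult_ac)
qed

text \<open>A single finite cover of the disk at the origin is translated to every centre, so the
  number of squares is uniform; \<open>square_le_shift\<close> then compares each of them with the
  square at \<open>z'\<close>. Open boxes are used for compactness and closed up to squares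
  afterwards.\<close>

lemma ball_le_square:
  fixes T \<rho> :: real
  obtains C where "0 < C" "\<And>z z'. dist z z' \<le> T \<Longrightarrow> emeasure \<nu> (ball z \<rho>) \<le> ennreal C * emeasure \<nu> (square z' r)"
proof -
  have cover: "cball (0::complex) \<rho> \<subseteq> (\<Union>x\<in>UNIV. box (x - Complex (r / 2) (r / 2)) (x + Complex (r / 2) (r / 2)))"
  proof
    fix x :: complex
    have "x \<in> box (x - Complex (r / 2) (r / 2)) (x + Complex (r / 2) (r / 2))"
      using r by (simp add: in_box_complex_iff)
    then show "x \<in> (\<Union>x\<in>UNIV. box (x - Complex (r / 2) (r / 2)) (x + Complex (r / 2) (r / 2)))" by blast
  qed
  obtain F where "F \<subseteq> UNIV" and F: "finite F"
    "cball (0::complex) \<rho> \<subseteq> (\<Union>x\<in>F. box (x - Complex (r / 2) (r / 2)) (x + Complex (r / 2) (r / 2)))"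
    by (rule compactE_image[where S = "cball (0::complex) \<rho>" and C = UNIV
          and f = "\<lambda>x. box (x - Complex (r / 2) (r / 2)) (x + Complex (r / 2) (r / 2))"])
       (use cover in auto)
  define f where "f x = x - Complex (r / 2) (r / 2)" for x
  have "bounded (f ` F)" using F by (intro finite_imp_bounded) auto
  then obtain B where B: "\<And>x. x \<in> F \<Longrightarrow> norm (f x) \<le> B" unfolding bounded_iff by blast
  obtain n :: nat where n: "(T + B) / (r / 2) \<le> real n" using real_arch_simple by blast
  then have n': "T + B \<le> real n * (r / 2)" using r by (simp add: field_simps)
  \<comment> \<open>The summand 1 keeps \<open>C\<close> positive when the disk, and with it the
    cover, is empty.\<close>
  define C where "C = (real (card F) + 1) * shift_const ^ n"
  have C: "0 < C" using shift_const_pos by (simp add: C_def)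
  show ?thesis
  proof (rule that[OF C])
    fix z z' :: complex assume zz: "dist z z' \<le> T"
    have "ball z \<rho> \<subseteq> (\<Union>x\<in>F. square (z + f x) r)"
    proof
      fix y assume "y \<in> ball z \<rho>"
      then have "y - z \<in> cball 0 \<rho>" by (simp add: dist_norm norm_minus_commute)
      then obtain x where "x \<in> F" "y - z \<in> box (x - Complex (r / 2) (r / 2)) (x + Complex (r / 2) (r / 2))"
        using F by blast
      then have "y \<in> square (z + f x) r"
        by (auto simp: in_box_complex_iff mem_square f_def)
      then show "y \<in> (\<Union>x\<in>F. square (z + f x) r)" using \<open>x \<in> F\<close> by blast
    qed
    then have "emeasure \<nu> (ball z \<rho>) \<le> emeasure \<nu> (\<Union>x\<in>F. square (z + f x) r)"
      using F by (intro emeasure_mono) (auto intro!: sets.finite_UN)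
    also have "\<dots> \<le> (\<Sum>x\<in>F. emeasure \<nu> (square (z + f x) r))"
      using F by (intro emeasure_subadditive_finite) auto
    also have "\<dots> \<le> (\<Sum>x\<in>F. ennreal (shift_const ^ n) * emeasure \<nu> (square z' r))"
    proof (rule sum_mono)
      fix x assume "x \<in> F"
      define d where "d = z' - (z + f x)"
      have "norm d \<le> norm (z' - z) + norm (f x)"
        unfolding d_def by (metis diff_diff_eq norm_triangle_ineq4)
      also have "\<dots> \<le> T + B" using zz B[OF \<open>x \<in> F\<close>] by (simp add: dist_norm norm_minus_commute)
      finally have "norm d \<le> real n * (r / 2)" using n' by simp
      then have "\<bar>Re d\<bar> \<le> real n * (r / 2)" "\<bar>Im d\<bar> \<le> real n * (r / 2)"
        using abs_Re_le_cmod[of d] abs_Im_le_cmod[of d] by auto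
      from square_le_shift[OF this, of "z + f x"]
      show "emeasure \<nu> (square (z + f x) r) \<le> ennreal (shift_const ^ n) * emeasure \<nu> (square z' r)"
        by (simp add: d_def)
    qed
    also have "\<dots> = ennreal (real (card F) * shift_const ^ n) * emeasure \<nu> (square z' r)"
      using shift_const_pos by (simp add: ennreal_mult mult.assoc ennreal_of_nat_eq_real_of_nat)
    also have "\<dots> \<le> ennreal C * emeasure \<nu> (square z' r)"
      unfolding C_def using shift_const_pos by (intro mult_right_mono ennreal_leI) auto
    finally show "emeasure \<nu> (ball z \<rho>) \<le> ennreal C * emeasure \<nu> (square z' r)" .
  qed
qed

lemma square_le_ball:
  fixes \<rho> :: real
  assumes \<rho>: "0 < \<rho>"
  obtains C where "0 < C" "\<And>z. emeasure \<nu> (square z r) \<le> ennreal C * emeasure \<nu> (ball z \<rho>)"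
proof -
  \<comment> \<open>A square of side \<open>t\<close> with corner \<open>z\<close> lies within
    distance \<open>2 * t\<close> of \<open>z\<close>, hence in the disk of radius \<rho>, and
    within the square of side \<open>r\<close>.\<close>
  define t where "t = min r (\<rho> / 3)"
  have t: "0 < t" "t \<le> r" "3 * t \<le> \<rho>" using r \<rho> by (auto simp: t_def)
  define C where "C = (2 * K / t\<^sup>2) powr q"
  have "0 < C" using K t by (simp add: C_def)
  moreover have "emeasure \<nu> (square z r) \<le> ennreal C * emeasure \<nu> (ball z \<rho>)" for z
  proof -
    have "emeasure \<nu> (square z r) \<le> ennreal C * emeasure \<nu> (square z t)"
      unfolding C_def using t by (intro square_le_subset) (auto simp: mem_square emeasure_square)
    also have "\<dots> \<le> ennreal C * emeasure \<nu> (ball z \<rho>)"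
    proof (intro mult_left_mono emeasure_mono subsetI)
      fix x assume "x \<in> square z t"
      then have "norm (x - z) \<le> 2 * t"
        using cmod_le[of "x - z"] by (auto simp: mem_square)
      then show "x \<in> ball z \<rho>" using t by (simp add: dist_norm norm_minus_commute)
    qed auto
    finally show ?thesis .
  qed
  ultimately show ?thesis using that by blast
qed

lemma ball_fin: "emeasure \<nu> (ball z \<rho>) < \<infinity>"
proof -
  obtain C where C: "0 < C" "\<And>z z'. dist z z' \<le> 0 \<Longrightarrow> emeasure \<nu> (ball z \<rho>) \<le> ennreal C * emeasure \<nu> (square z' r)"
    by (rule ball_le_square[of 0 \<rho>]) blast
  obtain a where "0 < a" "emeasure \<nu> (square z r) = ennreal a" by (rule square_real)
  then show ?thesis
    using C(2)[of z z] by (auto simp: ennreal_mult_less_top elim: order_le_less_trans)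
qed

lemma ball_pos:
  assumes "0 < \<rho>"
  shows "0 < emeasure \<nu> (ball z \<rho>)"
proof -
  obtain C where C: "0 < C" "\<And>z. emeasure \<nu> (square z r) \<le> ennreal C * emeasure \<nu> (ball z \<rho>)"
    by (rule square_le_ball[OF assms]) blast
  obtain a where a: "0 < a" "emeasure \<nu> (square z r) = ennreal a" by (rule square_real)
  show ?thesis
  proof (rule ccontr)
    assume "\<not> ?thesis"
    then have "emeasure \<nu> (ball z \<rho>) = 0" by simp
    then show False using C(2)[of z] a by simp
  qed
qed

lemma doubling:
  fixes T \<rho> \<rho>' :: real
  assumes "0 < \<rho>'"
  obtains C where "0 < C" "\<And>z z'. dist z z' \<le> T \<Longrightarrow> emeasure \<nu> (ball z \<rho>) \<le> ennreal C * emeasure \<nu> (ball z' \<rho>')"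
proof -
  obtain C1 where C1: "0 < C1" "\<And>z z'. dist z z' \<le> T \<Longrightarrow> emeasure \<nu> (ball z \<rho>) \<le> ennreal C1 * emeasure \<nu> (square z' r)"
    by (rule ball_le_square[of T \<rho>]) blast
  obtain C2 where C2: "0 < C2" "\<And>z. emeasure \<nu> (square z r) \<le> ennreal C2 * emeasure \<nu> (ball z \<rho>')"
    by (rule square_le_ball[OF assms]) blast
  have "emeasure \<nu> (ball z \<rho>) \<le> ennreal (C1 * C2) * emeasure \<nu> (ball z' \<rho>')" if "dist z z' \<le> T" for z z'
  proof -
    have "emeasure \<nu> (ball z \<rho>) \<le> ennreal C1 * (ennreal C2 * emeasure \<nu> (ball z' \<rho>'))"
      by (rule order_trans[OF C1(2)[OF that]]) (intro mult_left_mono C2(2), simp)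
    then show ?thesis using C1 C2 by (simp add: ennreal_mult mult.assoc)
  qed
  then show ?thesis using that[of "C1 * C2"] C1 C2 by simp
qed

text \<open>The mean value inequality is applied to the exponent \<open>p / q\<close>, giving an
  unweighted mean of \<open>h\<close> with \<open>h powr q = N\<close>. The test inequality converts
  that mean into a weighted mean of \<open>N\<close>, and \<open>ball_le_square\<close> replaces the
  mass of the square by that of the unit disk.\<close>

lemma weighted_submean:
  assumes p: "0 < p" and \<alpha>: "0 < \<alpha>"
  obtains C where "0 < C"
    "\<And>f z. f holomorphic_on UNIV \<Longrightarrow> ennreal (fock_integrand p \<alpha> f z) * emeasure \<nu> (ball z 1)
      \<le> ennreal C * (\<integral>\<^sup>+u\<in>ball z (2 * r). ennreal (fock_integrand p \<alpha> f u) * W u \<partial>lborel)"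
proof -
  have pq: "0 < p / q" using p q by simp
  obtain C0 where C0: "0 < C0" and sm: "\<And>f a. f holomorphic_on UNIV \<Longrightarrow> ennreal (fock_integrand (p / q) \<alpha> f a)
        \<le> ennreal C0 * (\<integral>\<^sup>+z\<in>ball a (r / 2). ennreal (fock_integrand (p / q) \<alpha> f z) \<partial>lborel)"
    by (rule fock_submean[OF pq \<alpha>, of "r / 2"]) (use r in auto)
  obtain C1 where C1: "0 < C1" and db: "\<And>z z'. dist z z' \<le> r \<Longrightarrow> emeasure \<nu> (ball z 1) \<le> ennreal C1 * emeasure \<nu> (square z' r)"
    by (rule ball_le_square[of r 1]) blast
  define L where "L = (C0 * K) powr q"
  have L: "0 < L" using C0 K by (simp add: L_def)
  define C where "C = C1 * L"
  have C: "0 < C" using C1 L by (simp add: C_def)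
  show ?thesis
  proof (rule that[OF C])
    fix f :: "complex \<Rightarrow> complex" and z :: complex
    assume f: "f holomorphic_on UNIV"
    define N where "N = fock_integrand p \<alpha> f"
    define h where "h = fock_integrand (p / q) \<alpha> f"
    have [measurable]: "N \<in> borel \<rightarrow>\<^sub>M borel" "h \<in> borel \<rightarrow>\<^sub>M borel"
      unfolding N_def h_def by (rule fock_integrand_measurable[OF f p] fock_integrand_measurable[OF f pq])+
    have h0: "0 \<le> h u" and N0: "0 \<le> N u" for u
      by (simp_all add: h_def N_def fock_integrand_nonneg)
    have hN: "h u powr q = N u" for u
      using q by (simp add: h_def N_def fock_integrand_def powr_mult powr_powr powr_def[of "exp _"])
    define c where "c = z - Complex (r / 2) (r / 2)"
    let ?Q = "square c r"
    have Q1: "ball z (r / 2) \<subseteq> ?Q"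
    proof
      fix x assume "x \<in> ball z (r / 2)"
      then have "norm (x - z) < r / 2" by (simp add: dist_norm norm_minus_commute)
      then show "x \<in> ?Q" using abs_Re_le_cmod[of "x - z"] abs_Im_le_cmod[of "x - z"]
        by (simp add: mem_square c_def) linarith
    qed
    have Q2: "?Q \<subseteq> ball z (2 * r)"
    proof
      fix x assume "x \<in> ?Q"
      then have "\<bar>Re (x - z)\<bar> \<le> r / 2" "\<bar>Im (x - z)\<bar> \<le> r / 2"
        unfolding mem_square c_def abs_le_iff by auto
      then have "norm (x - z) \<le> r" using cmod_le[of "x - z"] by linarith
      then show "x \<in> ball z (2 * r)" using r by (simp add: dist_norm norm_minus_commute)
    qed
    have "norm (z - c) \<le> r" using cmod_le[of "z - c"] r by (simp add: c_def)
    then have dz: "emeasure \<nu> (ball z 1) \<le> ennreal C1 * emeasure \<nu> ?Q"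
      by (intro db) (simp add: dist_norm)
    define S where "S = (\<integral>\<^sup>+u\<in>?Q. ennreal (N u) * W u \<partial>lborel)"
    have SQ: "S \<le> (\<integral>\<^sup>+u\<in>ball z (2 * r). ennreal (N u) * W u \<partial>lborel)"
      unfolding S_def using Q2 by (intro nn_integral_mono) (auto simp: indicator_def)
    have "ennreal (N z) * emeasure \<nu> ?Q \<le> ennreal L * S"
    proof (cases S)
      case top
      then show ?thesis using L by (simp add: ennreal_mult_top)
    next
      case (real s)
      obtain a where a: "0 < a" "emeasure \<nu> ?Q = ennreal a" by (rule square_real)
      \<comment> \<open>\<open>test\<close> requires \<open>y > 0\<close>, while \<open>s\<close>
        may vanish; hence the additive \<epsilon>, removed by
        \<open>field_le_epsilon\<close>.\<close>
      have "N z \<le> L * (s / a + \<epsilon>)" if \<epsilon>: "0 < \<epsilon>" for \<epsilon>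
      proof -
        define y where "y = s / a + \<epsilon>"
        have y: "0 < y" using real a \<epsilon> by (simp add: y_def add_nonneg_pos)
        have "s \<le> y * a" using a \<epsilon> by (simp add: y_def distrib_right)
        then have "(\<integral>\<^sup>+u\<in>?Q. ennreal (h u powr q) * W u \<partial>lborel) \<le> ennreal y * (\<integral>\<^sup>+u\<in>?Q. W u \<partial>lborel)"
          using real a y by (simp add: hN S_def[symmetric] emeasure_\<nu>[symmetric] flip: ennreal_mult)
        then have 1: "(\<integral>\<^sup>+u\<in>?Q. ennreal (h u) \<partial>lborel) \<le> ennreal (K * y powr (1 / q))"
          by (intro test h0 y) auto
        have "ennreal (h z) \<le> ennreal C0 * (\<integral>\<^sup>+u\<in>ball z (r / 2). ennreal (h u) \<partial>lborel)"
          unfolding h_def by (rule sm[OF f])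
        also have "\<dots> \<le> ennreal C0 * (\<integral>\<^sup>+u\<in>?Q. ennreal (h u) \<partial>lborel)"
          using Q1 by (intro mult_left_mono nn_integral_mono) (auto simp: indicator_def)
        also have "\<dots> \<le> ennreal C0 * ennreal (K * y powr (1 / q))"
          using 1 by (intro mult_left_mono) auto
        finally have "h z \<le> C0 * (K * y powr (1 / q))"
          using C0 K by (simp flip: ennreal_mult)
        then have "h z powr q \<le> (C0 * (K * y powr (1 / q))) powr q"
          using h0 q by (intro powr_mono2) auto
        also have "\<dots> = L * y"
          using C0 K q y by (simp add: L_def powr_mult powr_powr)
        finally show ?thesis by (simp add: hN y_def)
      qed
      then have *: "N z \<le> L * (s / a) + L * \<epsilon>" if "0 < \<epsilon>" for \<epsilon>
        using that by (simp add: distrib_left)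
      have "N z \<le> L * (s / a)"
      proof (rule field_le_epsilon)
        fix e :: real assume "0 < e"
        then show "N z \<le> L * (s / a) + e" using *[of "e / L"] L by simp
      qed
      then have "N z * a \<le> L * s" using a by (simp add: field_simps)
      then show ?thesis using real a L N0 by (simp flip: ennreal_mult)
    qed
    then have "ennreal C1 * (ennreal (N z) * emeasure \<nu> ?Q) \<le> ennreal C1 * (ennreal L * S)"
      by (intro mult_left_mono) auto
    moreover have "ennreal (N z) * emeasure \<nu> (ball z 1) \<le> ennreal (N z) * (ennreal C1 * emeasure \<nu> ?Q)"
      using dz by (intro mult_left_mono) auto
    ultimately have "ennreal (N z) * emeasure \<nu> (ball z 1) \<le> ennreal C * S"
      using C1 L by (simp add: C_def ennreal_mult mult_ac)
    also have "\<dots> \<le> ennreal C * (\<integral>\<^sup>+u\<in>ball z (2 * r). ennreal (N u) * W u \<partial>lborel)"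
      using SQ by (intro mult_left_mono) auto
    finally show "ennreal (fock_integrand p \<alpha> f z) * emeasure \<nu> (ball z 1)
        \<le> ennreal C * (\<integral>\<^sup>+u\<in>ball z (2 * r). ennreal (fock_integrand p \<alpha> f u) * W u \<partial>lborel)"
      unfolding N_def .
  qed
qed

end

section \<open>From the restricted classes to the test inequality\<close>

lemma is_weight_measurable:
  assumes "is_weight w"
  shows "w \<in> borel_measurable lebesgue"
proof (rule borel_measurable_LIMSEQ_real)
  show "(\<lambda>z. indicator (cball 0 (real n)) z *\<^sub>R w z) \<in> borel_measurable lebesgue" for n
    using assms unfolding is_weight_def set_integrable_def by (intro borel_measurable_integrable) auto
  show "(\<lambda>n. indicator (cball 0 (real n)) z *\<^sub>R w z) \<longlonglongrightarrow> w z" for z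
  proof (rule tendsto_eventually)
    obtain n0 :: nat where "norm z \<le> real n0" using real_arch_simple by blast
    then show "eventually (\<lambda>n. indicator (cball 0 (real n)) z *\<^sub>R w z = w z) sequentially"
      by (intro eventually_sequentiallyI[of n0]) (auto simp: indicator_def)
  qed
qed

text \<open>A Borel version lets later integrals run over \<open>lborel\<close>, where joint
  measurability and Fubini are at hand.\<close>

lemma is_weight_borel_version:
  assumes "is_weight w"
  obtains W :: "complex \<Rightarrow> ennreal" where "W \<in> borel \<rightarrow>\<^sub>M borel" "AE z in lborel. ennreal (w z) = W z"
proof -
  have "(\<lambda>z. ennreal (w z)) \<in> borel_measurable (completion lborel)"
    using is_weight_measurable[OF assms] by measurable
  then show ?thesis
    using completion_ex_borel_measurable[of "\<lambda>z. ennreal (w z)" lborel] that by auto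
qed

lemma mass_eq_nn_integral_lborel: "mass g E = (\<integral>\<^sup>+z\<in>E. g z \<partial>lborel)"
  by (simp add: mass_def nn_integral_completion)

lemma epowr_measurable [measurable]: "(\<lambda>x. epowr x s) \<in> borel \<rightarrow>\<^sub>M borel"
  unfolding epowr_def by measurable

text \<open>Hoelder's inequality obtained by integrating Young's inequality for
  \<open>h * W powr (1 / q)\<close> and \<open>W powr (- 1 / q)\<close> with a free scale
  \<open>t\<close>.\<close>

lemma holder_test:
  fixes W :: "complex \<Rightarrow> ennreal"
  assumes W[measurable]: "W \<in> borel \<rightarrow>\<^sub>M borel" and fin: "AE z in lborel. W z < \<infinity>"
    and q: "1 < q" and Q[measurable]: "Q \<in> sets borel"
    and Y: "0 < Y" and S: "0 < S" "(\<integral>\<^sup>+z\<in>Q. epowr (W z) (- 1 / (q - 1)) \<partial>lborel) = ennreal S"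
    and h[measurable]: "h \<in> borel \<rightarrow>\<^sub>M borel" and h0: "\<And>z. 0 \<le> h z"
    and le: "(\<integral>\<^sup>+z\<in>Q. ennreal (h z powr q) * W z \<partial>lborel) \<le> ennreal Y"
  shows "(\<integral>\<^sup>+z\<in>Q. ennreal (h z) \<partial>lborel) \<le> ennreal (Y powr (1 / q) * S powr (1 - 1 / q))"
proof -
  define q' where "q' = q / (q - 1)"
  have q': "1 < q'" "1 / q + 1 / q' = 1" "q' / q = 1 / (q - 1)"
    using q by (simp_all add: q'_def field_simps)
  define \<sigma> where "\<sigma> z = epowr (W z) (- 1 / (q - 1))" for z
  have [measurable]: "\<sigma> \<in> borel \<rightarrow>\<^sub>M borel"
    unfolding \<sigma>_def by (rule measurable_compose[OF W epowr_measurable])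
  \<comment> \<open>This scale balances the two sides: both \<open>t powr q * Y\<close> and
    \<open>t powr (- q') * S\<close> become
    \<open>Y powr (1 / q) * S powr (1 - 1 / q)\<close>.\<close>
  define t where "t = (S / Y) powr (1 / (q * q'))"
  have t: "0 < t" using S Y by (simp add: t_def)
  have pw: "ennreal (h z) \<le> ennreal (t powr q / q) * (ennreal (h z powr q) * W z) + ennreal (t powr (- q') / q') * \<sigma> z"
    if Wz: "W z < \<infinity>" for z
  proof (cases "W z = 0")
    case True
    \<comment> \<open>Where \<open>W\<close> vanishes the bound rests on \<open>epowr\<close>
      sending 0 to infinity for a negative exponent.\<close>
    then have "\<sigma> z = \<infinity>" using q by (simp add: \<sigma>_def epowr_def)
    then show ?thesis using t q' by (simp add: ennreal_mult_top)
  next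
    case False
    then obtain x where x: "0 < x" "W z = ennreal x" using Wz by (cases "W z") auto
    have \<sigma>: "\<sigma> z = ennreal (x powr (- 1 / (q - 1)))"
      using x q by (simp add: \<sigma>_def epowr_def)
    let ?a = "t * h z * x powr (1 / q)" and ?b = "inverse t * x powr (- 1 / q)"
    have "?a * ?b \<le> ?a powr q / q + ?b powr q' / q'"
      using q q' t h0[of z] x by (intro Youngs_inequality) auto
    also have "?a * ?b = h z"
      using t x by (simp add: powr_minus field_simps)
    also have "?a powr q = t powr q * (h z powr q * x)"
      using t x h0[of z] q by (simp add: powr_mult powr_powr mult.assoc)
    also have "?b powr q' = t powr (- q') * x powr (- 1 / (q - 1))"
    proof -
      have "(inverse t) powr q' = t powr (- q')" using t by (simp add: powr_minus powr_divide inverse_eq_divide)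
      moreover have "(x powr (- 1 / q)) powr q' = x powr (- 1 / (q - 1))"
        using q' by (simp add: powr_powr)
      ultimately show ?thesis using t x by (simp add: powr_mult)
    qed
    finally have "h z \<le> t powr q / q * (h z powr q * x) + t powr (- q') / q' * x powr (- 1 / (q - 1))"
      by simp
    then have "ennreal (h z) \<le> ennreal (t powr q / q * (h z powr q * x) + t powr (- q') / q' * x powr (- 1 / (q - 1)))"
      by (rule ennreal_leI)
    also have "\<dots> = ennreal (t powr q / q) * (ennreal (h z powr q) * W z) + ennreal (t powr (- q') / q') * \<sigma> z"
      using q q' x by (simp add: \<sigma> ennreal_plus flip: ennreal_mult)
    finally show ?thesis .
  qed
  have "(\<integral>\<^sup>+z\<in>Q. ennreal (h z) \<partial>lborel)
      \<le> (\<integral>\<^sup>+z. ennreal (t powr q / q) * (ennreal (h z powr q) * W z * indicator Q z)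
          + ennreal (t powr (- q') / q') * (\<sigma> z * indicator Q z) \<partial>lborel)"
  proof (rule nn_integral_mono_AE)
    show "AE z in lborel. ennreal (h z) * indicator Q z
        \<le> ennreal (t powr q / q) * (ennreal (h z powr q) * W z * indicator Q z)
          + ennreal (t powr (- q') / q') * (\<sigma> z * indicator Q z)"
      using fin
    proof eventually_elim
      case (elim z)
      show ?case using pw[OF elim] by (simp add: indicator_def)
    qed
  qed
  also have "\<dots> = ennreal (t powr q / q) * (\<integral>\<^sup>+z\<in>Q. ennreal (h z powr q) * W z \<partial>lborel)
      + ennreal (t powr (- q') / q') * (\<integral>\<^sup>+z\<in>Q. \<sigma> z \<partial>lborel)"
    by (subst nn_integral_add) (simp_all add: nn_integral_cmult)
  also have "\<dots> \<le> ennreal (t powr q / q) * ennreal Y + ennreal (t powr (- q') / q') * ennreal S"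
    using S(2) by (intro add_mono mult_left_mono le) (auto simp: \<sigma>_def)
  also have "\<dots> = ennreal (t powr q * Y / q + t powr (- q') * S / q')"
    using Y S q q' by (simp add: ennreal_plus flip: ennreal_mult)
  also have "t powr q * Y / q + t powr (- q') * S / q' = Y powr (1 / q) * S powr (1 - 1 / q)"
  proof -
    have e: "1 / q' = 1 - 1 / q" using q'(2) by simp
    have "t powr q = (S / Y) powr (1 / q')" using q q' by (simp add: t_def powr_powr)
    then have 1: "t powr q * Y = Y powr (1 / q) * S powr (1 - 1 / q)"
      using S Y by (simp add: e powr_divide powr_diff field_simps)
    have "t powr (- q') = (S / Y) powr (- 1 / q)" using q q' by (simp add: t_def powr_powr)
    also have "\<dots> * S = Y powr (1 / q) * S powr (1 - 1 / q)"
      using S(1) Y by (simp add: powr_divide powr_diff powr_minus field_simps)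
    finally have 2: "t powr (- q') * S = Y powr (1 / q) * S powr (1 - 1 / q)" .
    have "Y powr (1 / q) * S powr (1 - 1 / q) / q + Y powr (1 / q) * S powr (1 - 1 / q) / q'
        = Y powr (1 / q) * S powr (1 - 1 / q) * (1 / q + 1 / q')" by (simp add: distrib_left)
    then show ?thesis unfolding 1 2 by (simp add: q'(2))
  qed
  finally show ?thesis .
qed

text \<open>The convention for zero times infinity is what yields finiteness of each factor
  separately.\<close>

lemma inf_multD:
  assumes "inf_mult x y \<le> ennreal B"
  shows "x < \<infinity>" "y < \<infinity>" "x * y \<le> ennreal B"
  using assms by (auto simp: inf_mult_def less_top[symmetric] top_unique split: if_splits)

text \<open>On each square both integrals are finite by \<open>inf_multD\<close>. Both are positive:
  if \<open>W\<close> vanished almost everywhere there, \<sigma> would be infinite, and if \<sigma>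
  vanished, \<open>W\<close> would be. After clearing the areas the characteristic bounds
  \<open>a * S powr (q - 1)\<close>, which is what \<open>holder_test\<close> leaves over.\<close>

lemma Ap_restricted_weight:
  assumes w: "w \<in> Ap_restricted q" and q: "1 < q"
    and W[measurable]: "W \<in> borel \<rightarrow>\<^sub>M borel" and ae: "AE z in lborel. ennreal (w z) = W z"
  obtains r K where "restricted_weight W q r K"
proof -
  define p' where "p' = q / (q - 1)"
  have e1: "- p' / q = - 1 / (q - 1)" and e2: "q / p' = q - 1" using q by (simp_all add: p'_def field_simps)
  from w obtain r where r: "0 < r" and
    sup: "(SUP c. inf_mult (mean (\<lambda>z. ennreal (w z)) (square c r))
                (epowr (mean (\<lambda>z. epowr (ennreal (w z)) (- 1 / (q - 1))) (square c r)) (q - 1))) < \<infinity>"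
    unfolding Ap_restricted_def Let_def using e1 e2 by (auto simp: p'_def)
  obtain B where B: "0 \<le> B" "(SUP c. inf_mult (mean (\<lambda>z. ennreal (w z)) (square c r))
                (epowr (mean (\<lambda>z. epowr (ennreal (w z)) (- 1 / (q - 1))) (square c r)) (q - 1))) = ennreal B"
    using sup[unfolded infinity_ennreal_def less_top_ennreal] by blast
  define \<sigma> where "\<sigma> z = epowr (W z) (- 1 / (q - 1))" for z
  have [measurable]: "\<sigma> \<in> borel \<rightarrow>\<^sub>M borel"
    unfolding \<sigma>_def by (rule measurable_compose[OF W epowr_measurable])
  have fin: "AE z in lborel. W z < \<infinity>" using ae by eventually_elim (metis ennreal_less_top infinity_ennreal_def)
  have A: "emeasure lborel (square c r) = ennreal (r\<^sup>2)" for c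
    using r by (simp add: emeasure_square)
  have main: "\<exists>a S. 0 < a \<and> 0 < S \<and> (\<integral>\<^sup>+z\<in>square c r. W z \<partial>lborel) = ennreal a
      \<and> (\<integral>\<^sup>+z\<in>square c r. \<sigma> z \<partial>lborel) = ennreal S \<and> a * S powr (q - 1) \<le> B * (r\<^sup>2) powr q" for c
  proof -
    let ?Q = "square c r"
    have m1: "mean (\<lambda>z. ennreal (w z)) ?Q = (\<integral>\<^sup>+z\<in>?Q. W z \<partial>lborel) / ennreal (r\<^sup>2)"
      unfolding mean_def mass_eq_nn_integral_lborel
      using ae by (subst nn_integral_cong_AE[where v = "\<lambda>z. W z * indicator ?Q z"]) (auto simp: A)
    have m2: "mean (\<lambda>z. epowr (ennreal (w z)) (- 1 / (q - 1))) ?Q = (\<integral>\<^sup>+z\<in>?Q. \<sigma> z \<partial>lborel) / ennreal (r\<^sup>2)"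
      unfolding mean_def mass_eq_nn_integral_lborel
      using ae by (subst nn_integral_cong_AE[where v = "\<lambda>z. \<sigma> z * indicator ?Q z"]) (auto simp: A \<sigma>_def)
    have "inf_mult (mean (\<lambda>z. ennreal (w z)) ?Q)
                (epowr (mean (\<lambda>z. epowr (ennreal (w z)) (- 1 / (q - 1))) ?Q) (q - 1)) \<le> ennreal B"
      unfolding B(2)[symmetric] by (rule SUP_upper) simp
    note * = inf_multD[OF this[unfolded m1 m2]]
    have "(\<integral>\<^sup>+z\<in>?Q. W z \<partial>lborel) \<noteq> \<infinity>"
      using *(1) r by (auto simp: ennreal_top_divide)
    then obtain a where a: "0 \<le> a" "(\<integral>\<^sup>+z\<in>?Q. W z \<partial>lborel) = ennreal a"
      by (cases "\<integral>\<^sup>+z\<in>?Q. W z \<partial>lborel") auto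
    have "(\<integral>\<^sup>+z\<in>?Q. \<sigma> z \<partial>lborel) \<noteq> \<infinity>"
      using *(2) r q by (auto simp: ennreal_top_divide epowr_def)
    then obtain S where S: "0 \<le> S" "(\<integral>\<^sup>+z\<in>?Q. \<sigma> z \<partial>lborel) = ennreal S"
      by (cases "\<integral>\<^sup>+z\<in>?Q. \<sigma> z \<partial>lborel") auto
    have nonnull: "\<not> (AE z in lborel. z \<notin> ?Q)"
      using r A[of c] by (subst AE_iff_measurable[of ?Q]) auto
    have "S \<noteq> 0"
    proof
      assume "S = 0"
      then have "AE z in lborel. \<sigma> z * indicator ?Q z = 0"
        using S \<open>S = 0\<close> nn_integral_0_iff_AE[of "\<lambda>z. \<sigma> z * indicator ?Q z" lborel] by simp
      with fin have "AE z in lborel. z \<notin> ?Q"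
        by eventually_elim (use q in \<open>auto simp: \<sigma>_def epowr_def indicator_def enn2real_eq_0_iff split: if_splits\<close>)
      then show False using nonnull by simp
    qed
    have "a \<noteq> 0"
    proof
      assume "a = 0"
      then have 0: "AE z in lborel. W z * indicator ?Q z = 0"
        using a \<open>a = 0\<close> nn_integral_0_iff_AE[of "\<lambda>z. W z * indicator ?Q z" lborel] by simp
      have "AE z in lborel. \<sigma> z * indicator ?Q z \<noteq> \<infinity>"
        using S by (intro nn_integral_noteq_infinite) auto
      with 0 have "AE z in lborel. z \<notin> ?Q"
        by eventually_elim (use q in \<open>auto simp: \<sigma>_def epowr_def indicator_def split: if_splits\<close>)
      then show False using nonnull by simp
    qed
    have "0 < a" "0 < S" using a S \<open>a \<noteq> 0\<close> \<open>S \<noteq> 0\<close> by auto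
    moreover have "a / r\<^sup>2 * (S / r\<^sup>2) powr (q - 1) \<le> B"
      using *(3) a S r q \<open>0 < a\<close> \<open>0 < S\<close> B(1) by (simp add: divide_ennreal epowr_def flip: ennreal_mult)
    then have "a * S powr (q - 1) \<le> B * (r\<^sup>2) powr q"
      using r \<open>0 < S\<close> by (simp add: powr_divide powr_diff field_simps)
    ultimately show ?thesis using a S by blast
  qed
  from main[of 0] obtain a S where "0 < a" "0 < S" "a * S powr (q - 1) \<le> B * (r\<^sup>2) powr q" by blast
  then have B': "0 < B * (r\<^sup>2) powr q" by (smt (verit) mult_pos_pos powr_gt_zero)
  \<comment> \<open>\<open>K powr q\<close> is the bound for \<open>a * S powr (q - 1)\<close>; the
    power \<open>(r\<^sup>2) powr q\<close> collects the areas from both means.\<close>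
  define K where "K = (B * (r\<^sup>2) powr q) powr (1 / q)"
  have "restricted_weight W q r K"
  proof
    show "0 < K" unfolding K_def powr_gt_zero using B' by linarith
    show "(\<integral>\<^sup>+z\<in>square c r. W z \<partial>lborel) < \<infinity>" "0 < (\<integral>\<^sup>+z\<in>square c r. W z \<partial>lborel)" for c
      using main[of c] by auto
    fix h :: "complex \<Rightarrow> real" and y c
    assume h: "h \<in> borel \<rightarrow>\<^sub>M borel" "\<And>z. 0 \<le> h z" and y: "0 < y"
      and le: "(\<integral>\<^sup>+z\<in>square c r. ennreal (h z powr q) * W z \<partial>lborel) \<le> ennreal y * (\<integral>\<^sup>+z\<in>square c r. W z \<partial>lborel)"
    obtain a S where aS: "0 < a" "0 < S" "(\<integral>\<^sup>+z\<in>square c r. W z \<partial>lborel) = ennreal a"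
      "(\<integral>\<^sup>+z\<in>square c r. \<sigma> z \<partial>lborel) = ennreal S" "a * S powr (q - 1) \<le> B * (r\<^sup>2) powr q"
      using main[of c] by blast
    have "(\<integral>\<^sup>+z\<in>square c r. ennreal (h z) \<partial>lborel) \<le> ennreal ((y * a) powr (1 / q) * S powr (1 - 1 / q))"
      using y aS h le
      by (intro holder_test[OF W fin q]) (auto simp: \<sigma>_def simp flip: ennreal_mult)
    also have "(y * a) powr (1 / q) * S powr (1 - 1 / q) = y powr (1 / q) * (a * S powr (q - 1)) powr (1 / q)"
      using y aS q by (simp add: powr_mult powr_powr diff_divide_distrib)
    also have "\<dots> \<le> y powr (1 / q) * K"
      unfolding K_def using aS q by (intro mult_left_mono powr_mono2) auto
    finally show "(\<integral>\<^sup>+z\<in>square c r. ennreal (h z) \<partial>lborel) \<le> ennreal (K * y powr (1 / q))"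
      by (simp add: mult.commute ennreal_leI)
  qed (use q r W in auto)
  then show ?thesis by (rule that)
qed

text \<open>The essential supremum \<open>s\<close> of \<open>1 / w\<close> on the square gives
  \<open>h \<le> s * h * W\<close> almost everywhere there. Integrating, the product
  \<open>a * s\<close> appears, which the characteristic bounds by
  \<open>B * r\<^sup>2\<close>.\<close>

lemma A1_restricted_weight:
  assumes w: "w \<in> A1_restricted"
    and W[measurable]: "W \<in> borel \<rightarrow>\<^sub>M borel" and ae: "AE z in lborel. ennreal (w z) = W z"
  obtains r K where "restricted_weight W 1 r K"
proof -
  from w obtain r where r: "0 < r" and
    sup: "(SUP c. inf_mult (mean (\<lambda>z. ennreal (w z)) (square c r))
               (esssup (restrict_space lebesgue (square c r)) (\<lambda>z. inverse (ennreal (w z))))) < \<infinity>"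
    unfolding A1_restricted_def by auto
  obtain B where B: "0 \<le> B" "(SUP c. inf_mult (mean (\<lambda>z. ennreal (w z)) (square c r))
               (esssup (restrict_space lebesgue (square c r)) (\<lambda>z. inverse (ennreal (w z))))) = ennreal B"
    using sup[unfolded infinity_ennreal_def less_top_ennreal] by blast
  have fin: "AE z in lborel. W z < \<infinity>" using ae by eventually_elim (metis ennreal_less_top infinity_ennreal_def)
  have A: "emeasure lborel (square c r) = ennreal (r\<^sup>2)" for c
    using r by (simp add: emeasure_square)
  have main: "\<exists>a s. 0 < a \<and> 0 < s \<and> (\<integral>\<^sup>+z\<in>square c r. W z \<partial>lborel) = ennreal a
      \<and> (AE z in lborel. z \<in> square c r \<longrightarrow> 1 \<le> ennreal s * W z) \<and> a * s \<le> B * r\<^sup>2" for c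
  proof -
    let ?Q = "square c r"
    have m1: "mean (\<lambda>z. ennreal (w z)) ?Q = (\<integral>\<^sup>+z\<in>?Q. W z \<partial>lborel) / ennreal (r\<^sup>2)"
      unfolding mean_def mass_eq_nn_integral_lborel
      using ae by (subst nn_integral_cong_AE[where v = "\<lambda>z. W z * indicator ?Q z"]) (auto simp: A)
    define e where "e = esssup (restrict_space lebesgue ?Q) (\<lambda>z. inverse (ennreal (w z)))"
    have "inf_mult (mean (\<lambda>z. ennreal (w z)) ?Q) e \<le> ennreal B"
      unfolding B(2)[symmetric] e_def by (rule SUP_upper) simp
    note * = inf_multD[OF this[unfolded m1]]
    have "(\<integral>\<^sup>+z\<in>?Q. W z \<partial>lborel) \<noteq> \<infinity>"
      using *(1) r by (auto simp: ennreal_top_divide)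
    then obtain a where a: "0 \<le> a" "(\<integral>\<^sup>+z\<in>?Q. W z \<partial>lborel) = ennreal a"
      by (cases "\<integral>\<^sup>+z\<in>?Q. W z \<partial>lborel") auto
    obtain s where s: "0 \<le> s" "e = ennreal s" using *(2) by (cases e) auto
    have "AE z in restrict_space lebesgue ?Q. inverse (ennreal (w z)) \<le> e"
      unfolding e_def by (rule esssup_AE)
    then have "AE z in lebesgue. z \<in> ?Q \<longrightarrow> inverse (ennreal (w z)) \<le> e"
      by (subst (asm) AE_restrict_space_iff) auto
    then have "AE z in lborel. z \<in> ?Q \<longrightarrow> inverse (ennreal (w z)) \<le> e"
      by (simp add: AE_completion_iff)
    with ae have inv: "AE z in lborel. z \<in> ?Q \<longrightarrow> inverse (W z) \<le> ennreal s"
      by eventually_elim (simp add: s)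
    have nonnull: "\<not> (AE z in lborel. z \<notin> ?Q)"
      using r A[of c] by (subst AE_iff_measurable[of ?Q]) auto
    have "s \<noteq> 0"
    proof
      assume "s = 0"
      from fin inv have "AE z in lborel. z \<notin> ?Q"
        by eventually_elim (use \<open>s = 0\<close> in \<open>auto simp: top_unique\<close>)
      then show False using nonnull by simp
    qed
    then have s0: "0 < s" using s by simp
    from fin inv have one: "AE z in lborel. z \<in> ?Q \<longrightarrow> 1 \<le> ennreal s * W z"
    proof eventually_elim
      case (elim z)
      show ?case
      proof
        assume z: "z \<in> ?Q"
        have "W z \<noteq> 0" using elim z by (auto simp: top_unique)
        then obtain x where x: "0 < x" "W z = ennreal x" using elim by (cases "W z") auto
        then have "1 \<le> s * x" using elim z s0 by (simp add: inverse_ennreal field_simps)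
        then show "1 \<le> ennreal s * W z" using x s0 by (simp flip: ennreal_mult)
      qed
    qed
    have "a \<noteq> 0"
    proof
      assume "a = 0"
      then have 0: "AE z in lborel. W z * indicator ?Q z = 0"
        using a \<open>a = 0\<close> nn_integral_0_iff_AE[of "\<lambda>z. W z * indicator ?Q z" lborel] by simp
      with one have "AE z in lborel. z \<notin> ?Q"
        by eventually_elim (auto simp: indicator_def split: if_splits)
      then show False using nonnull by simp
    qed
    then have "0 < a" using a by simp
    moreover have "a / r\<^sup>2 * s \<le> B"
      using *(3) a s r B(1) by (simp add: divide_ennreal flip: ennreal_mult)
    then have "a * s \<le> B * r\<^sup>2" using r by (simp add: field_simps)
    ultimately show ?thesis using a s0 one by blast
  qed
  from main[of 0] obtain a s where "0 < a" "0 < s" "a * s \<le> B * r\<^sup>2" by blast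
  then have B': "0 < B * r\<^sup>2" by (smt (verit) mult_pos_pos)
  have "restricted_weight W 1 r (B * r\<^sup>2)"
  proof
    show "0 < B * r\<^sup>2" by (rule B')
    show "(\<integral>\<^sup>+z\<in>square c r. W z \<partial>lborel) < \<infinity>" "0 < (\<integral>\<^sup>+z\<in>square c r. W z \<partial>lborel)" for c
      using main[of c] by auto
    fix h :: "complex \<Rightarrow> real" and y c
    assume h[measurable]: "h \<in> borel \<rightarrow>\<^sub>M borel" and h0: "\<And>z. 0 \<le> h z" and y: "0 < y"
      and le: "(\<integral>\<^sup>+z\<in>square c r. ennreal (h z powr 1) * W z \<partial>lborel) \<le> ennreal y * (\<integral>\<^sup>+z\<in>square c r. W z \<partial>lborel)"
    obtain a s where as: "0 < a" "0 < s" "(\<integral>\<^sup>+z\<in>square c r. W z \<partial>lborel) = ennreal a"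
      "AE z in lborel. z \<in> square c r \<longrightarrow> 1 \<le> ennreal s * W z" "a * s \<le> B * r\<^sup>2"
      using main[of c] by blast
    have "(\<integral>\<^sup>+z\<in>square c r. ennreal (h z) \<partial>lborel)
        \<le> (\<integral>\<^sup>+z. ennreal s * (ennreal (h z powr 1) * W z * indicator (square c r) z) \<partial>lborel)"
    proof (rule nn_integral_mono_AE)
      show "AE z in lborel. ennreal (h z) * indicator (square c r) z
          \<le> ennreal s * (ennreal (h z powr 1) * W z * indicator (square c r) z)"
        using as(4)
      proof eventually_elim
        case (elim z)
        show ?case
        proof (cases "z \<in> square c r")
          case True
          then have "ennreal (h z) * 1 \<le> ennreal (h z) * (ennreal s * W z)"
            using elim by (intro mult_left_mono) auto
          then show ?thesis using True h0[of z] by (simp add: mult_ac)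
        qed simp
      qed
    qed
    also have "\<dots> = ennreal s * (\<integral>\<^sup>+z\<in>square c r. ennreal (h z powr 1) * W z \<partial>lborel)"
      by (rule nn_integral_cmult) measurable
    also have "\<dots> \<le> ennreal s * (ennreal y * ennreal a)"
      using le as(3) by (intro mult_left_mono) auto
    also have "\<dots> = ennreal (a * s * y)"
      using as y by (simp add: mult_ac flip: ennreal_mult)
    also have "\<dots> \<le> ennreal (B * r\<^sup>2 * y powr (1 / 1))"
      using as y by (intro ennreal_leI) (simp add: mult_right_mono)
    finally show "(\<integral>\<^sup>+z\<in>square c r. ennreal (h z) \<partial>lborel) \<le> ennreal (B * r\<^sup>2 * y powr (1 / 1))" .
  qed (use r W in auto)
  then show ?thesis by (rule that)
qed

lemma Ainf_restricted_weight:
  assumes w: "w \<in> Ainf_restricted"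
  obtains W q r K where "restricted_weight W q r K" "AE z in lborel. ennreal (w z) = W z"
proof -
  have "is_weight w"
    using w by (auto simp: Ainf_restricted_def A1_restricted_def Ap_restricted_def)
  then obtain W :: "complex \<Rightarrow> ennreal" where W: "W \<in> borel \<rightarrow>\<^sub>M borel" "AE z in lborel. ennreal (w z) = W z"
    by (rule is_weight_borel_version)
  show ?thesis
  proof (cases "w \<in> A1_restricted")
    case True
    from A1_restricted_weight[OF this W] show ?thesis using that W by blast
  next
    case False
    then obtain q where "1 < q" "w \<in> Ap_restricted q" using w by (auto simp: Ainf_restricted_def)
    from Ap_restricted_weight[OF this(2,1) W] show ?thesis using that W by blast
  qed
qed

section \<open>Averaged weights and reverse Carleson measures\<close>

lemma emeasure_ball_complex: "0 \<le> \<rho> \<Longrightarrow> emeasure lborel (ball (a::complex) \<rho>) = ennreal (pi * \<rho>\<^sup>2)"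
  by (simp add: emeasure_ball unit_ball_vol_2)

text \<open>The relation \<open>dist z u < \<rho>\<close> is symmetric, so exchanging the integrals
  turns balls about \<open>z\<close> into balls about \<open>u\<close>. Two measures are allowed
  because one of them will be \<mu>.\<close>

lemma ball_Fubini:
  fixes M N :: "complex measure"
  assumes "sigma_finite_measure M" "sigma_finite_measure N"
    and [measurable_cong, simp]: "sets M = sets borel" "sets N = sets borel"
    and [measurable]: "F \<in> borel \<rightarrow>\<^sub>M borel" "H \<in> borel \<rightarrow>\<^sub>M borel"
  shows "(\<integral>\<^sup>+z. F z * (\<integral>\<^sup>+u\<in>ball z \<rho>. H u \<partial>N) \<partial>M) = (\<integral>\<^sup>+u. H u * (\<integral>\<^sup>+z\<in>ball u \<rho>. F z \<partial>M) \<partial>N)"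
proof -
  interpret pair_sigma_finite M N using assms by (simp add: pair_sigma_finite_def)
  have "(\<integral>\<^sup>+z. F z * (\<integral>\<^sup>+u\<in>ball z \<rho>. H u \<partial>N) \<partial>M) = (\<integral>\<^sup>+z. \<integral>\<^sup>+u. F z * (H u * indicator (ball z \<rho>) u) \<partial>N \<partial>M)"
    by (intro nn_integral_cong nn_integral_cmult[symmetric]) measurable
  also have "\<dots> = (\<integral>\<^sup>+u. \<integral>\<^sup>+z. F z * (H u * indicator (ball z \<rho>) u) \<partial>M \<partial>N)"
    by (rule Fubini'[symmetric]) measurable
  also have "\<dots> = (\<integral>\<^sup>+u. \<integral>\<^sup>+z. H u * (F z * indicator (ball u \<rho>) z) \<partial>M \<partial>N)"
    by (intro nn_integral_cong) (auto simp: indicator_def dist_commute mult_ac)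
  also have "\<dots> = (\<integral>\<^sup>+u. H u * (\<integral>\<^sup>+z\<in>ball u \<rho>. F z \<partial>M) \<partial>N)"
    by (intro nn_integral_cong nn_integral_cmult) measurable
  finally show ?thesis .
qed

lemma measurable_emeasure_ball:
  fixes M :: "complex measure"
  assumes "sigma_finite_measure M" and [measurable_cong]: "sets M = sets borel"
  shows "(\<lambda>z. emeasure M (ball z \<rho>)) \<in> borel \<rightarrow>\<^sub>M borel"
proof -
  interpret sigma_finite_measure M by fact
  have "(\<lambda>z. \<integral>\<^sup>+u. indicator (ball z \<rho>) u \<partial>M) \<in> borel \<rightarrow>\<^sub>M borel"
    by measurable
  then show ?thesis using assms(2) by simp
qed

section \<open>Integral estimates with the averaged weight\<close>

context restricted_weight
begin

abbreviation V :: "complex \<Rightarrow> ennreal" where "V z \<equiv> emeasure \<nu> (ball z 1)"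

lemma V_eq: "V z = (\<integral>\<^sup>+u\<in>ball z 1. W u \<partial>lborel)"
  by (simp add: emeasure_\<nu>)

lemma V_measurable [measurable]: "V \<in> borel \<rightarrow>\<^sub>M borel"
  unfolding V_eq by measurable

lemma V_doubling:
  fixes T :: real
  obtains D where "1 \<le> D" "\<And>z z'. dist z z' \<le> T \<Longrightarrow> V z \<le> ennreal D * V z'"
proof -
  obtain C where C: "0 < C" "\<And>z z'. dist z z' \<le> T \<Longrightarrow> V z \<le> ennreal C * V z'"
    by (rule doubling[of 1 T 1]) auto
  have "V z \<le> ennreal (max 1 C) * V z'" if "dist z z' \<le> T" for z z'
    by (rule order_trans[OF C(2)[OF that]]) (intro mult_right_mono ennreal_leI, auto)
  then show ?thesis using that[of "max 1 C"] by simp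
qed

lemma V_real:
  obtains v where "0 < v" "V z = ennreal v"
  using ball_fin[of z 1] ball_pos[of 1 z] by (cases "V z") auto

text \<open>After the sub-mean value inequality, Fubini moves the average from the integrand to
  \<open>W\<close>, where it produces \<open>V\<close>.\<close>

lemma fock_norm_le_averaged:
  assumes p: "0 < p" and \<alpha>: "0 < \<alpha>"
  obtains C where "0 < C" "\<And>f. f holomorphic_on UNIV \<Longrightarrow>
    (\<integral>\<^sup>+z. ennreal (fock_integrand p \<alpha> f z) * W z \<partial>lborel) \<le> ennreal C * (\<integral>\<^sup>+z. ennreal (fock_integrand p \<alpha> f z) * V z \<partial>lborel)"
proof -
  obtain C where C: "0 < C" and sm: "\<And>f a. f holomorphic_on UNIV \<Longrightarrow> ennreal (fock_integrand p \<alpha> f a)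
        \<le> ennreal C * (\<integral>\<^sup>+z\<in>ball a 1. ennreal (fock_integrand p \<alpha> f z) \<partial>lborel)"
    by (rule fock_submean[OF p \<alpha>, of 1]) auto
  show ?thesis
  proof (rule that[OF C])
    fix f :: "complex \<Rightarrow> complex" assume f: "f holomorphic_on UNIV"
    define N where "N z = ennreal (fock_integrand p \<alpha> f z)" for z
    have [measurable]: "N \<in> borel \<rightarrow>\<^sub>M borel"
      using fock_integrand_measurable[OF f p, of \<alpha>] unfolding N_def by measurable
    have "(\<integral>\<^sup>+z. N z * W z \<partial>lborel) \<le> (\<integral>\<^sup>+z. ennreal C * W z * (\<integral>\<^sup>+u\<in>ball z 1. N u \<partial>lborel) \<partial>lborel)"
    proof (intro nn_integral_mono, goal_cases)
      case (1 z)
      have "N z * W z \<le> (ennreal C * (\<integral>\<^sup>+u\<in>ball z 1. N u \<partial>lborel)) * W z"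
        unfolding N_def by (intro mult_right_mono sm[OF f]) auto
      then show ?case by (simp add: mult_ac)
    qed
    also have "\<dots> = (\<integral>\<^sup>+u. N u * (\<integral>\<^sup>+z\<in>ball u 1. ennreal C * W z \<partial>lborel) \<partial>lborel)"
      by (rule ball_Fubini) (auto intro: sigma_finite_lborel)
    also have "\<dots> = (\<integral>\<^sup>+u. ennreal C * (N u * V u) \<partial>lborel)"
      by (simp add: V_eq nn_integral_cmult mult_ac)
    also have "\<dots> = ennreal C * (\<integral>\<^sup>+u. N u * V u \<partial>lborel)"
      by (rule nn_integral_cmult) measurable
    finally show "(\<integral>\<^sup>+z. ennreal (fock_integrand p \<alpha> f z) * W z \<partial>lborel)
        \<le> ennreal C * (\<integral>\<^sup>+z. ennreal (fock_integrand p \<alpha> f z) * V z \<partial>lborel)"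
      unfolding N_def .
  qed
qed

text \<open>This direction needs the test inequality, through \<open>weighted_submean\<close>. It
  supplies the finiteness of the averaged integral on which both absorptions depend.\<close>

lemma averaged_le_fock_norm:
  assumes p: "0 < p" and \<alpha>: "0 < \<alpha>"
  obtains C where "0 < C" "\<And>f. f holomorphic_on UNIV \<Longrightarrow>
    (\<integral>\<^sup>+z. ennreal (fock_integrand p \<alpha> f z) * V z \<partial>lborel) \<le> ennreal C * (\<integral>\<^sup>+z. ennreal (fock_integrand p \<alpha> f z) * W z \<partial>lborel)"
proof -
  obtain C where C: "0 < C" and sm: "\<And>f z. f holomorphic_on UNIV \<Longrightarrow> ennreal (fock_integrand p \<alpha> f z) * V z
      \<le> ennreal C * (\<integral>\<^sup>+u\<in>ball z (2 * r). ennreal (fock_integrand p \<alpha> f u) * W u \<partial>lborel)"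
    by (rule weighted_submean[OF p \<alpha>]) auto
  define C' where "C' = C * (pi * (2 * r)\<^sup>2)"
  have C': "0 < C'" using C r by (simp add: C'_def)
  show ?thesis
  proof (rule that[OF C'])
    fix f :: "complex \<Rightarrow> complex" assume f: "f holomorphic_on UNIV"
    define N where "N z = ennreal (fock_integrand p \<alpha> f z)" for z
    have [measurable]: "N \<in> borel \<rightarrow>\<^sub>M borel"
      using fock_integrand_measurable[OF f p, of \<alpha>] unfolding N_def by measurable
    have "(\<integral>\<^sup>+z. N z * V z \<partial>lborel) \<le> (\<integral>\<^sup>+z. ennreal C * (\<integral>\<^sup>+u\<in>ball z (2 * r). N u * W u \<partial>lborel) \<partial>lborel)"
      unfolding N_def by (intro nn_integral_mono sm[OF f])
    also have "\<dots> = (\<integral>\<^sup>+u. (N u * W u) * (\<integral>\<^sup>+z\<in>ball u (2 * r). ennreal C \<partial>lborel) \<partial>lborel)"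
      by (rule ball_Fubini) (auto intro: sigma_finite_lborel)
    also have "\<dots> = (\<integral>\<^sup>+u. ennreal C' * (N u * W u) \<partial>lborel)"
    proof (intro nn_integral_cong, goal_cases)
      case (1 u)
      have "(\<integral>\<^sup>+z\<in>ball u (2 * r). ennreal C \<partial>lborel) = ennreal C'"
        using C r by (subst nn_integral_cmult_indicator) (auto simp: emeasure_ball_complex C'_def simp flip: ennreal_mult)
      then show ?case by (simp add: mult.commute)
    qed
    also have "\<dots> = ennreal C' * (\<integral>\<^sup>+u. N u * W u \<partial>lborel)"
      by (rule nn_integral_cmult) measurable
    finally show "(\<integral>\<^sup>+z. ennreal (fock_integrand p \<alpha> f z) * V z \<partial>lborel)
        \<le> ennreal C' * (\<integral>\<^sup>+z. ennreal (fock_integrand p \<alpha> f z) * W z \<partial>lborel)"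
      unfolding N_def .
  qed
qed

lemma integral_V_ball:
  fixes T :: real
  assumes T: "0 < T"
  obtains C where "0 < C" "\<And>u. (\<integral>\<^sup>+z\<in>ball u T. V z \<partial>lborel) \<le> ennreal C * V u"
proof -
  obtain D where D: "1 \<le> D" "\<And>z z'. dist z z' \<le> T \<Longrightarrow> V z \<le> ennreal D * V z'"
    by (rule V_doubling[of T]) auto
  define C where "C = D * (pi * T\<^sup>2)"
  have "0 < C" using D T by (simp add: C_def)
  moreover have "(\<integral>\<^sup>+z\<in>ball u T. V z \<partial>lborel) \<le> ennreal C * V u" for u
  proof -
    have "(\<integral>\<^sup>+z\<in>ball u T. V z \<partial>lborel) \<le> (\<integral>\<^sup>+z. (ennreal D * V u) * indicator (ball u T) z \<partial>lborel)"
      by (intro nn_integral_mono) (auto simp: indicator_def dist_commute intro!: D(2))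
    also have "\<dots> = ennreal D * V u * ennreal (pi * T\<^sup>2)"
      using T by (subst nn_integral_cmult_indicator) (auto simp: emeasure_ball_complex)
    also have "\<dots> = ennreal C * V u" using D T by (simp add: C_def ennreal_mult mult_ac)
    finally show ?thesis .
  qed
  ultimately show ?thesis using that by blast
qed

text \<open>Integrating \<open>fock_density_submean\<close> against \<open>V\<close> and exchanging
  integrals costs the factor \<open>B\<close>. The first term is then a fraction of the left-hand
  side and is absorbed, the integral being finite.\<close>

lemma averaged_le_dense_set:
  fixes p \<alpha> R \<theta> :: real
  assumes p: "0 < p" and \<alpha>: "0 < \<alpha>" and R: "0 < R" and \<theta>: "0 < \<theta>" "\<theta> \<le> 1"
  obtains C where "0 < C" "\<And>f G. f holomorphic_on UNIV \<Longrightarrow> G \<in> sets borel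
    \<Longrightarrow> (\<And>a. ennreal \<theta> * emeasure lborel (ball a R) \<le> emeasure lborel (G \<inter> ball a R))
    \<Longrightarrow> (\<integral>\<^sup>+z. ennreal (fock_integrand p \<alpha> f z) * V z \<partial>lborel) < \<infinity>
    \<Longrightarrow> (\<integral>\<^sup>+z. ennreal (fock_integrand p \<alpha> f z) * V z \<partial>lborel)
        \<le> ennreal C * (\<integral>\<^sup>+z\<in>G. ennreal (fock_integrand p \<alpha> f z) * V z \<partial>lborel)"
proof -
  obtain B where B: "0 < B" "\<And>u. (\<integral>\<^sup>+z\<in>ball u R. V z \<partial>lborel) \<le> ennreal B * V u"
    by (rule integral_V_ball[OF R]) auto
  \<comment> \<open>Fixed by the absorption: \<eta> times the factor \<open>B\<close> from
    exchanging integrals is one half.\<close>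
  define \<eta> where "\<eta> = 1 / (2 * B)"
  have \<eta>: "0 < \<eta>" using B by (simp add: \<eta>_def)
  obtain C where C: "0 < C" and sm: "\<And>f (a::complex) E. f holomorphic_on UNIV \<Longrightarrow> E \<in> sets borel
      \<Longrightarrow> ennreal \<theta> * emeasure lborel (ball a R) \<le> emeasure lborel (E \<inter> ball a R)
      \<Longrightarrow> ennreal (fock_integrand p \<alpha> f a)
        \<le> ennreal \<eta> * (\<integral>\<^sup>+z\<in>ball a R. ennreal (fock_integrand p \<alpha> f z) \<partial>lborel)
          + ennreal C * (\<integral>\<^sup>+z\<in>E \<inter> ball a R. ennreal (fock_integrand p \<alpha> f z) \<partial>lborel)"
    by (rule fock_density_submean[OF p \<alpha> R \<theta> \<eta>]) auto
  have C2: "0 < 2 * C * B" using C B by simp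
  show ?thesis
  proof (rule that[OF C2])
    fix f :: "complex \<Rightarrow> complex" and G :: "complex set"
    assume f: "f holomorphic_on UNIV" and G[measurable]: "G \<in> sets borel"
      and dens: "\<And>a. ennreal \<theta> * emeasure lborel (ball a R) \<le> emeasure lborel (G \<inter> ball a R)"
      and fin: "(\<integral>\<^sup>+z. ennreal (fock_integrand p \<alpha> f z) * V z \<partial>lborel) < \<infinity>"
    define N where "N z = ennreal (fock_integrand p \<alpha> f z)" for z
    have [measurable]: "N \<in> borel \<rightarrow>\<^sub>M borel"
      using fock_integrand_measurable[OF f p, of \<alpha>] unfolding N_def by measurable
    define X where "X = (\<integral>\<^sup>+z. N z * V z \<partial>lborel)"
    define Y where "Y = (\<integral>\<^sup>+z. (N z * indicator G z) * V z \<partial>lborel)"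
    have swap: "(\<integral>\<^sup>+a. V a * (\<integral>\<^sup>+z\<in>ball a R. H z \<partial>lborel) \<partial>lborel) \<le> ennreal B * (\<integral>\<^sup>+z. H z * V z \<partial>lborel)"
      if [measurable]: "H \<in> borel \<rightarrow>\<^sub>M borel" for H :: "complex \<Rightarrow> ennreal"
    proof -
      have "(\<integral>\<^sup>+a. V a * (\<integral>\<^sup>+z\<in>ball a R. H z \<partial>lborel) \<partial>lborel)
          = (\<integral>\<^sup>+z. H z * (\<integral>\<^sup>+a\<in>ball z R. V a \<partial>lborel) \<partial>lborel)"
        by (rule ball_Fubini) (auto intro: sigma_finite_lborel)
      also have "\<dots> \<le> (\<integral>\<^sup>+z. H z * (ennreal B * V z) \<partial>lborel)"
        by (intro nn_integral_mono mult_left_mono B(2)) auto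
      also have "\<dots> = (\<integral>\<^sup>+z. ennreal B * (H z * V z) \<partial>lborel)" by (simp add: mult_ac)
      also have "\<dots> = ennreal B * (\<integral>\<^sup>+z. H z * V z \<partial>lborel)"
        by (rule nn_integral_cmult) measurable
      finally show ?thesis .
    qed
    have "X \<le> (\<integral>\<^sup>+a. ennreal \<eta> * (V a * (\<integral>\<^sup>+z\<in>ball a R. N z \<partial>lborel))
        + ennreal C * (V a * (\<integral>\<^sup>+z\<in>ball a R. N z * indicator G z \<partial>lborel)) \<partial>lborel)"
      unfolding X_def
    proof (intro nn_integral_mono, goal_cases)
      case (1 a)
      have "(\<integral>\<^sup>+z\<in>G \<inter> ball a R. N z \<partial>lborel) = (\<integral>\<^sup>+z\<in>ball a R. N z * indicator G z \<partial>lborel)"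
        by (intro nn_integral_cong) (auto simp: indicator_def)
      then have "N a \<le> ennreal \<eta> * (\<integral>\<^sup>+z\<in>ball a R. N z \<partial>lborel)
          + ennreal C * (\<integral>\<^sup>+z\<in>ball a R. N z * indicator G z \<partial>lborel)"
        using sm[OF f G dens[of a]] unfolding N_def by simp
      then have "N a * V a \<le> (ennreal \<eta> * (\<integral>\<^sup>+z\<in>ball a R. N z \<partial>lborel)
          + ennreal C * (\<integral>\<^sup>+z\<in>ball a R. N z * indicator G z \<partial>lborel)) * V a"
        by (rule mult_right_mono) simp
      then show ?case by (simp add: distrib_left mult_ac)
    qed
    also have "\<dots> = ennreal \<eta> * (\<integral>\<^sup>+a. V a * (\<integral>\<^sup>+z\<in>ball a R. N z \<partial>lborel) \<partial>lborel)
        + ennreal C * (\<integral>\<^sup>+a. V a * (\<integral>\<^sup>+z\<in>ball a R. N z * indicator G z \<partial>lborel) \<partial>lborel)"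
      by (simp add: nn_integral_add nn_integral_cmult)
    also have "\<dots> \<le> ennreal \<eta> * (ennreal B * X) + ennreal C * (ennreal B * Y)"
      unfolding X_def Y_def by (intro add_mono mult_left_mono swap) auto
    also have "\<dots> = ennreal (1 / 2) * X + ennreal (C * B) * Y"
      using B C \<eta> by (simp add: mult.assoc[symmetric] \<eta>_def flip: ennreal_mult)
    finally have le: "X \<le> ennreal (1 / 2) * X + ennreal (C * B) * Y" .
    have "X \<le> ennreal (2 * C * B) * Y"
    proof (cases Y)
      case top
      then show ?thesis using C B by (simp add: ennreal_mult_top)
    next
      case (real y)
      have "X < \<infinity>" using fin unfolding X_def N_def .
      then obtain x where x: "0 \<le> x" "X = ennreal x" by (cases X) auto
      have "ennreal (1 / 2) * X + ennreal (C * B) * Y = ennreal (1 / 2 * x + C * B * y)"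
      proof -
        have "ennreal (1 / 2) * X = ennreal (1 / 2 * x)"
          unfolding x(2) by (rule ennreal_mult[symmetric]) (use x in auto)
        moreover have "ennreal (C * B) * Y = ennreal (C * B * y)"
          unfolding real(2) by (rule ennreal_mult[symmetric]) (use C B(1) real in auto)
        moreover have "0 \<le> C * B * y" using C B(1) real by simp
        ultimately show ?thesis using x by (simp only: ennreal_plus)
      qed
      then have "ennreal x \<le> ennreal (1 / 2 * x + C * B * y)" using le x by simp
      then have "x \<le> 1 / 2 * x + C * B * y"
        using x C B(1) real by (subst (asm) ennreal_le_iff) auto
      then have "x \<le> 2 * C * B * y" by simp
      then show ?thesis using x real C B by (simp flip: ennreal_mult)
    qed
    then show "(\<integral>\<^sup>+z. ennreal (fock_integrand p \<alpha> f z) * V z \<partial>lborel)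
        \<le> ennreal (2 * C * B) * (\<integral>\<^sup>+z\<in>G. ennreal (fock_integrand p \<alpha> f z) * V z \<partial>lborel)"
      unfolding X_def Y_def N_def by (simp add: mult_ac)
  qed
qed

text \<open>The essential supremum gives its bound only almost everywhere. Each half-radius disk
  contains a point \<open>y\<close> where the bound holds, and its unit disk contains the
  half-radius disk; finitely many of these cover the disk of radius 3. That radius leaves room for a
  disk of radius 2 enlarged by \<rho> in \<open>good_set_integral_le\<close>.\<close>

lemma ball_measure_bound:
  obtains C where "0 < C" "\<And>(\<mu> :: complex measure) (m::real). sets \<mu> = sets borel \<Longrightarrow> 0 \<le> m
    \<Longrightarrow> (AE z in lborel. emeasure \<mu> (ball z 1) \<le> ennreal m * V z)
    \<Longrightarrow> (\<And>z. emeasure \<mu> (ball z 3) \<le> ennreal (C * m) * V z)"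
proof -
  have cover: "cball (0::complex) 3 \<subseteq> (\<Union>x\<in>UNIV. ball x (1 / 2))"
  proof
    fix x :: complex
    have "x \<in> ball x (1 / 2)" by simp
    then show "x \<in> (\<Union>x\<in>UNIV. ball x (1 / 2))" by blast
  qed
  obtain F where "F \<subseteq> UNIV" and F: "finite F" "cball (0::complex) 3 \<subseteq> (\<Union>x\<in>F. ball x (1 / 2))"
    by (rule compactE_image[where S = "cball (0::complex) 3" and C = UNIV and f = "\<lambda>x. ball x (1 / 2)"])
       (use cover in auto)
  have "bounded F" using F by (intro finite_imp_bounded)
  then obtain B where B: "\<And>x. x \<in> F \<Longrightarrow> norm x \<le> B" unfolding bounded_iff by blast
  obtain D where D: "1 \<le> D" "\<And>z z'. dist z z' \<le> B + 1 \<Longrightarrow> V z \<le> ennreal D * V z'"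
    by (rule V_doubling[of "B + 1"]) auto
  define C where "C = (real (card F) + 1) * D"
  have C: "0 < C" using D by (simp add: C_def)
  show ?thesis
  proof (rule that[OF C])
    fix \<mu> :: "complex measure" and m :: real and z
    assume s: "sets \<mu> = sets borel" and m: "0 \<le> m"
      and ae: "AE z in lborel. emeasure \<mu> (ball z 1) \<le> ennreal m * V z"
    have one: "emeasure \<mu> (ball (z + x) (1 / 2)) \<le> ennreal (m * D) * V z" if x: "x \<in> F" for x
    proof -
      have "\<exists>y\<in>ball (z + x) (1 / 2). emeasure \<mu> (ball y 1) \<le> ennreal m * V y"
      proof (rule ccontr)
        assume neg: "\<not> ?thesis"
        from ae have "AE y in lborel. y \<notin> ball (z + x) (1 / 2)"
          by eventually_elim (use neg in auto)
        then have "emeasure lborel (ball (z + x) (1 / 2)) = 0"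
          by (subst (asm) AE_iff_measurable[of "ball (z + x) (1 / 2)"]) auto
        then show False by (simp add: emeasure_ball_complex)
      qed
      then obtain y where y: "dist (z + x) y < 1 / 2" "emeasure \<mu> (ball y 1) \<le> ennreal m * V y" by auto
      have "ball (z + x) (1 / 2) \<subseteq> ball y 1"
      proof
        fix t assume "t \<in> ball (z + x) (1 / 2)"
        then show "t \<in> ball y 1"
          using y(1) dist_triangle[of y t "z + x"] by (simp add: dist_commute)
      qed
      then have "emeasure \<mu> (ball (z + x) (1 / 2)) \<le> emeasure \<mu> (ball y 1)"
        using s by (intro emeasure_mono) auto
      also have "\<dots> \<le> ennreal m * V y" by (rule y)
      also have "dist y z \<le> B + 1"
      proof -
        have "dist y z \<le> dist y (z + x) + dist (z + x) z" by (rule dist_triangle)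
        also have "dist (z + x) z = norm x" by (simp add: dist_norm)
        finally show ?thesis using y(1) B[OF x] by (simp add: dist_commute)
      qed
      then have "ennreal m * V y \<le> ennreal m * (ennreal D * V z)"
        by (intro mult_left_mono D(2)) auto
      also have "\<dots> = ennreal (m * D) * V z" using m D by (simp add: ennreal_mult mult.assoc)
      finally show ?thesis .
    qed
    have "ball z 3 \<subseteq> (\<Union>x\<in>F. ball (z + x) (1 / 2))"
    proof
      fix y assume "y \<in> ball z 3"
      then have "y - z \<in> cball 0 3" by (simp add: dist_norm norm_minus_commute)
      then obtain x where "x \<in> F" "y - z \<in> ball x (1 / 2)" using F by blast
      then show "y \<in> (\<Union>x\<in>F. ball (z + x) (1 / 2))"
        by (auto simp: dist_norm algebra_simps intro!: bexI[of _ x])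
    qed
    then have "emeasure \<mu> (ball z 3) \<le> emeasure \<mu> (\<Union>x\<in>F. ball (z + x) (1 / 2))"
      using F s by (intro emeasure_mono) (auto intro!: sets.finite_UN)
    also have "\<dots> \<le> (\<Sum>x\<in>F. emeasure \<mu> (ball (z + x) (1 / 2)))"
      using F s by (intro emeasure_subadditive_finite) auto
    also have "\<dots> \<le> (\<Sum>x\<in>F. ennreal (m * D) * V z)"
      by (intro sum_mono one)
    also have "\<dots> = ennreal (real (card F) * (m * D)) * V z"
      using m D by (simp add: ennreal_mult mult.assoc ennreal_of_nat_eq_real_of_nat)
    also have "\<dots> \<le> ennreal (C * m) * V z"
      using m D by (intro mult_right_mono ennreal_leI) (auto simp: C_def algebra_simps)
    finally show "emeasure \<mu> (ball z 3) \<le> ennreal (C * m) * V z" .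
  qed
qed

text \<open>\<mu> is an arbitrary Borel measure, so the \<sigma>-finiteness needed for Fubini has to
  be extracted from the bound on disks; disks about a countable dense set cover the plane.\<close>

lemma sigma_finite_of_ball_fin:
  fixes \<mu> :: "complex measure"
  assumes s: "sets \<mu> = sets borel" and fin: "\<And>z. emeasure \<mu> (ball z 3) < \<infinity>"
  shows "sigma_finite_measure \<mu>"
proof
  obtain D :: "complex set" where D: "countable D" "\<And>X. open X \<Longrightarrow> X \<noteq> {} \<Longrightarrow> \<exists>d\<in>D. d \<in> X"
    using countable_dense_exists by (metis (no_types, lifting))
  have "space \<mu> = UNIV" using sets_eq_imp_space_eq[OF s] by simp
  moreover have "(\<Union>d\<in>D. ball d 3) = UNIV"
  proof (intro set_eqI iffI UNIV_I)
    fix x :: complex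
    from D(2)[of "ball x 3"] obtain d where "d \<in> D" "d \<in> ball x 3" by auto
    then show "x \<in> (\<Union>d\<in>D. ball d 3)" by (auto simp: dist_commute)
  qed
  ultimately show "\<exists>A. countable A \<and> A \<subseteq> sets \<mu> \<and> \<Union> A = space \<mu> \<and> (\<forall>a\<in>A. emeasure \<mu> a \<noteq> \<infinity>)"
    using D(1) s fin by (intro exI[of _ "(\<lambda>d. ball d 3) ` D"]) (auto simp: less_top)
qed

text \<open>The factors \<open>\<rho>\<^sup>2\<close> from the hypothesis on \<open>G\<close> and from the area of \<open>ball z \<rho>\<close> cancel, so
  only the small factor \<open>\<rho> powr p\<close> of \<open>fock_near\<close> survives.\<close>

lemma good_set_integral_le:
  assumes p: "0 < p" and \<alpha>: "0 < \<alpha>"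
  obtains C1 C2 where "0 < C1" "0 < C2"
    "\<And>f (\<mu> :: complex measure) m c \<rho> G. f holomorphic_on UNIV \<Longrightarrow> sets \<mu> = sets borel \<Longrightarrow> sigma_finite_measure \<mu>
     \<Longrightarrow> 0 \<le> m \<Longrightarrow> (\<And>z. emeasure \<mu> (ball z 3) \<le> ennreal m * V z) \<Longrightarrow> G \<in> sets borel
     \<Longrightarrow> 0 < \<rho> \<Longrightarrow> \<rho> \<le> 1 / 2 \<Longrightarrow> 0 \<le> c \<Longrightarrow> (\<And>z. z \<in> G \<Longrightarrow> ennreal (c * \<rho>\<^sup>2) * V z \<le> emeasure \<mu> (ball z \<rho>))
     \<Longrightarrow> ennreal c * (\<integral>\<^sup>+z\<in>G. ennreal (fock_integrand p \<alpha> f z) * V z \<partial>lborel)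
       \<le> ennreal C1 * (\<integral>\<^sup>+z. ennreal (fock_integrand p \<alpha> f z) \<partial>\<mu>)
         + ennreal (C2 * \<rho> powr p * m) * (\<integral>\<^sup>+z. ennreal (fock_integrand p \<alpha> f z) * V z \<partial>lborel)"
proof -
  obtain D1 D2 where D1: "0 < D1" and D2: "0 < D2" and near:
    "\<And>f a u r. f holomorphic_on UNIV \<Longrightarrow> dist a u < r \<Longrightarrow> r \<le> 1 / 2 \<Longrightarrow> ennreal (fock_integrand p \<alpha> f a)
        \<le> ennreal D1 * ennreal (fock_integrand p \<alpha> f u)
          + ennreal (D2 * r powr p) * (\<integral>\<^sup>+z\<in>ball a 2. ennreal (fock_integrand p \<alpha> f z) \<partial>lborel)"
    by (rule fock_near[OF p \<alpha>]) auto
  have C1: "0 < pi * D1" and C2: "0 < pi * D2" using D1 D2 by auto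
  show ?thesis
  proof (rule that[OF C1 C2])
    fix f :: "complex \<Rightarrow> complex" and \<mu> :: "complex measure" and m c \<rho> :: real and G :: "complex set"
    assume f: "f holomorphic_on UNIV" and s[measurable_cong, simp]: "sets \<mu> = sets borel"
      and sf: "sigma_finite_measure \<mu>" and m: "0 \<le> m"
      and b3: "\<And>z. emeasure \<mu> (ball z 3) \<le> ennreal m * V z" and G[measurable]: "G \<in> sets borel"
      and \<rho>: "0 < \<rho>" "\<rho> \<le> 1 / 2" and c: "0 \<le> c"
      and good: "\<And>z. z \<in> G \<Longrightarrow> ennreal (c * \<rho>\<^sup>2) * V z \<le> emeasure \<mu> (ball z \<rho>)"
    interpret sigma_finite_measure \<mu> by (rule sf)
    define N where "N z = ennreal (fock_integrand p \<alpha> f z)" for z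
    have N[measurable]: "N \<in> borel \<rightarrow>\<^sub>M borel"
      using fock_integrand_measurable[OF f p, of \<alpha>] unfolding N_def by measurable
    define I where "I z = (\<integral>\<^sup>+v\<in>ball z 2. N v \<partial>lborel)" for z
    have [measurable]: "I \<in> borel \<rightarrow>\<^sub>M borel" unfolding I_def by measurable
    have bm[measurable]: "(\<lambda>z. emeasure \<mu> (ball z \<rho>)) \<in> borel \<rightarrow>\<^sub>M borel"
      by (rule measurable_emeasure_ball[OF sf s])
    have vol: "emeasure lborel (ball u \<rho>) = ennreal (pi * \<rho>\<^sup>2)" for u :: complex
      using \<rho> by (simp add: emeasure_ball_complex)
    define X where "X = (\<integral>\<^sup>+z. N z * V z \<partial>lborel)"
    define Y where "Y = (\<integral>\<^sup>+z\<in>G. N z * V z \<partial>lborel)"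
    define J where "J = (\<integral>\<^sup>+z. N z \<partial>\<mu>)"
    \<comment> \<open>By Fubini each point \<open>u\<close> contributes at most the area of
      \<open>ball u \<rho>\<close>, and only if \<open>u\<close> is within \<open>2 + \<rho>\<close>
      of \<open>v\<close>, hence in \<open>ball v 3\<close>.\<close>
    have inner: "(\<integral>\<^sup>+z\<in>ball v 2. emeasure \<mu> (ball z \<rho>) \<partial>lborel) \<le> ennreal (pi * \<rho>\<^sup>2 * m) * V v" for v
    proof -
      have "(\<integral>\<^sup>+z\<in>ball v 2. emeasure \<mu> (ball z \<rho>) \<partial>lborel)
          = (\<integral>\<^sup>+z. indicator (ball v 2) z * (\<integral>\<^sup>+u\<in>ball z \<rho>. 1 \<partial>\<mu>) \<partial>lborel)"
        by (simp add: mult.commute)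
      also have "\<dots> = (\<integral>\<^sup>+u. 1 * (\<integral>\<^sup>+z\<in>ball u \<rho>. indicator (ball v 2) z \<partial>lborel) \<partial>\<mu>)"
        by (rule ball_Fubini) (auto intro: sigma_finite_lborel sf)
      also have "\<dots> \<le> (\<integral>\<^sup>+u. ennreal (pi * \<rho>\<^sup>2) * indicator (ball v 3) u \<partial>\<mu>)"
      proof (intro nn_integral_mono, goal_cases)
        case (1 u)
        show ?case
        proof (cases "u \<in> ball v 3")
          case True
          have "(\<integral>\<^sup>+z\<in>ball u \<rho>. indicator (ball v 2) z \<partial>lborel) \<le> (\<integral>\<^sup>+z. indicator (ball u \<rho>) z \<partial>lborel)"
            by (intro nn_integral_mono) (auto simp: indicator_def)
          then show ?thesis using True vol[of u] by simp
        next
          case False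
          have "z \<notin> ball v 2" if "z \<in> ball u \<rho>" for z
          proof
            assume "z \<in> ball v 2"
            then have "dist v u < 2 + \<rho>"
              using that dist_triangle[of v u z] by (simp add: dist_commute)
            then show False using False \<rho> by simp
          qed
          then have "(\<integral>\<^sup>+z\<in>ball u \<rho>. indicator (ball v 2) z \<partial>lborel) = (\<integral>\<^sup>+(z::complex). 0 \<partial>lborel)"
            by (intro nn_integral_cong) (auto simp: indicator_def)
          then show ?thesis by simp
        qed
      qed
      also have "\<dots> = ennreal (pi * \<rho>\<^sup>2) * emeasure \<mu> (ball v 3)"
        by (rule nn_integral_cmult_indicator) simp
      also have "\<dots> \<le> ennreal (pi * \<rho>\<^sup>2) * (ennreal m * V v)"
        by (intro mult_left_mono b3) auto
      also have "\<dots> = ennreal (pi * \<rho>\<^sup>2 * m) * V v"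
        using m by (simp add: ennreal_mult mult.assoc)
      finally show ?thesis .
    qed
    have "ennreal (c * \<rho>\<^sup>2) * Y = (\<integral>\<^sup>+z. ennreal (c * \<rho>\<^sup>2) * (N z * V z * indicator G z) \<partial>lborel)"
      unfolding Y_def by (rule nn_integral_cmult[symmetric]) measurable
    also have "\<dots> \<le> (\<integral>\<^sup>+z. N z * emeasure \<mu> (ball z \<rho>) \<partial>lborel)"
    proof (intro nn_integral_mono, goal_cases)
      case (1 z)
      show ?case
      proof (cases "z \<in> G")
        case True
        then show ?thesis using mult_left_mono[OF good[OF True], of "N z"] by (simp add: mult_ac)
      qed simp
    qed
    \<comment> \<open>\<open>fock_near\<close> is integrated over \<open>u\<close> in
      \<open>ball z \<rho>\<close> against \<mu>; its error term does not depend on \<open>u\<close>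
      and picks up the mass of that ball.\<close>
    also have "\<dots> \<le> (\<integral>\<^sup>+z. ennreal D1 * (\<integral>\<^sup>+u\<in>ball z \<rho>. N u \<partial>\<mu>)
        + ennreal (D2 * \<rho> powr p) * (emeasure \<mu> (ball z \<rho>) * I z) \<partial>lborel)"
    proof (intro nn_integral_mono, goal_cases)
      case (1 z)
      have "N z * emeasure \<mu> (ball z \<rho>) = (\<integral>\<^sup>+u. N z * indicator (ball z \<rho>) u \<partial>\<mu>)"
        by (rule nn_integral_cmult_indicator[symmetric]) simp
      also have "\<dots> \<le> (\<integral>\<^sup>+u. ennreal D1 * (N u * indicator (ball z \<rho>) u)
          + ennreal (D2 * \<rho> powr p) * I z * indicator (ball z \<rho>) u \<partial>\<mu>)"
      proof (intro nn_integral_mono, goal_cases)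
        case (1 u)
        show ?case
          using near[OF f, of z u \<rho>] \<rho> by (auto simp: indicator_def I_def N_def)
      qed
      also have "\<dots> = ennreal D1 * (\<integral>\<^sup>+u\<in>ball z \<rho>. N u \<partial>\<mu>)
          + ennreal (D2 * \<rho> powr p) * I z * emeasure \<mu> (ball z \<rho>)"
        by (subst nn_integral_add) (auto simp: nn_integral_cmult nn_integral_cmult_indicator)
      finally show ?case by (simp add: mult_ac)
    qed
    also have "\<dots> = ennreal D1 * (\<integral>\<^sup>+z. (\<integral>\<^sup>+u\<in>ball z \<rho>. N u \<partial>\<mu>) \<partial>lborel)
        + ennreal (D2 * \<rho> powr p) * (\<integral>\<^sup>+z. emeasure \<mu> (ball z \<rho>) * I z \<partial>lborel)"
      by (subst nn_integral_add) (simp_all add: nn_integral_cmult)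
    also have "(\<integral>\<^sup>+z. (\<integral>\<^sup>+u\<in>ball z \<rho>. N u \<partial>\<mu>) \<partial>lborel) = ennreal (pi * \<rho>\<^sup>2) * J"
    proof -
      have "(\<integral>\<^sup>+z. (\<integral>\<^sup>+u\<in>ball z \<rho>. N u \<partial>\<mu>) \<partial>lborel) = (\<integral>\<^sup>+z. 1 * (\<integral>\<^sup>+u\<in>ball z \<rho>. N u \<partial>\<mu>) \<partial>lborel)"
        by simp
      also have "\<dots> = (\<integral>\<^sup>+u. N u * (\<integral>\<^sup>+z\<in>ball u \<rho>. 1 \<partial>lborel) \<partial>\<mu>)"
        by (rule ball_Fubini) (auto intro: sigma_finite_lborel sf)
      also have "\<dots> = (\<integral>\<^sup>+u. ennreal (pi * \<rho>\<^sup>2) * N u \<partial>\<mu>)"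
        by (simp add: vol mult.commute)
      also have "\<dots> = ennreal (pi * \<rho>\<^sup>2) * J"
        unfolding J_def by (rule nn_integral_cmult) measurable
      finally show ?thesis .
    qed
    also have "(\<integral>\<^sup>+z. emeasure \<mu> (ball z \<rho>) * I z \<partial>lborel) \<le> ennreal (pi * \<rho>\<^sup>2 * m) * X"
    proof -
      have "(\<integral>\<^sup>+z. emeasure \<mu> (ball z \<rho>) * I z \<partial>lborel)
          = (\<integral>\<^sup>+v. N v * (\<integral>\<^sup>+z\<in>ball v 2. emeasure \<mu> (ball z \<rho>) \<partial>lborel) \<partial>lborel)"
        unfolding I_def by (rule ball_Fubini) (auto intro: sigma_finite_lborel)
      also have "\<dots> \<le> (\<integral>\<^sup>+v. N v * (ennreal (pi * \<rho>\<^sup>2 * m) * V v) \<partial>lborel)"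
        by (intro nn_integral_mono mult_left_mono inner) auto
      also have "\<dots> = (\<integral>\<^sup>+v. ennreal (pi * \<rho>\<^sup>2 * m) * (N v * V v) \<partial>lborel)"
        by (simp add: mult_ac)
      also have "\<dots> = ennreal (pi * \<rho>\<^sup>2 * m) * X"
        unfolding X_def by (rule nn_integral_cmult) measurable
      finally show ?thesis .
    qed
    finally have "ennreal (c * \<rho>\<^sup>2) * Y \<le> ennreal D1 * (ennreal (pi * \<rho>\<^sup>2) * J)
        + ennreal (D2 * \<rho> powr p) * (ennreal (pi * \<rho>\<^sup>2 * m) * X)"
      by (simp add: add_left_mono mult_left_mono)
    also have "ennreal D1 * (ennreal (pi * \<rho>\<^sup>2) * J) = ennreal (\<rho>\<^sup>2) * (ennreal (pi * D1) * J)"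
    proof -
      have "ennreal D1 * ennreal (pi * \<rho>\<^sup>2) = ennreal (\<rho>\<^sup>2) * ennreal (pi * D1)"
        using D1 by (simp add: mult_ac flip: ennreal_mult)
      then show ?thesis by (simp add: mult.assoc[symmetric])
    qed
    also have "ennreal (D2 * \<rho> powr p) * (ennreal (pi * \<rho>\<^sup>2 * m) * X)
        = ennreal (\<rho>\<^sup>2) * (ennreal (pi * D2 * \<rho> powr p * m) * X)"
    proof -
      have "ennreal (D2 * \<rho> powr p) * ennreal (pi * \<rho>\<^sup>2 * m) = ennreal (\<rho>\<^sup>2) * ennreal (pi * D2 * \<rho> powr p * m)"
        using D2 m by (simp add: mult_ac flip: ennreal_mult)
      then show ?thesis by (simp add: mult.assoc[symmetric])
    qed
    also have "ennreal (c * \<rho>\<^sup>2) * Y = ennreal (\<rho>\<^sup>2) * (ennreal c * Y)"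
      using c by (simp add: ennreal_mult mult_ac)
    finally have "ennreal (\<rho>\<^sup>2) * (ennreal c * Y)
        \<le> ennreal (\<rho>\<^sup>2) * (ennreal (pi * D1) * J + ennreal (pi * D2 * \<rho> powr p * m) * X)"
      by (simp add: distrib_left)
    then have "ennreal c * Y \<le> ennreal (pi * D1) * J + ennreal (pi * D2 * \<rho> powr p * m) * X"
      using \<rho> by (subst (asm) ennreal_mult_le_mult_iff) auto
    then show "ennreal c * (\<integral>\<^sup>+z\<in>G. ennreal (fock_integrand p \<alpha> f z) * V z \<partial>lborel)
       \<le> ennreal (pi * D1) * (\<integral>\<^sup>+z. ennreal (fock_integrand p \<alpha> f z) \<partial>\<mu>)
         + ennreal (pi * D2 * \<rho> powr p * m) * (\<integral>\<^sup>+z. ennreal (fock_integrand p \<alpha> f z) * V z \<partial>lborel)"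
      unfolding X_def Y_def J_def N_def .
  qed
qed

end

section \<open>Transfer from \<open>w\<close> to its Borel version and the final absorption\<close>

lemma ennreal_divide_mult_cancel:
  fixes x m :: ennreal
  assumes "m \<noteq> 0" "m \<noteq> \<infinity>"
  shows "x / m * m = x"
  using assms by (simp add: ennreal_divide_times ennreal_divide_self less_top)

context restricted_weight
begin

lemma integral_V_ball_ge:
  assumes D: "1 \<le> D" "\<And>z z'. dist z z' \<le> T \<Longrightarrow> V z \<le> ennreal D * V z'"
    and \<rho>: "0 \<le> \<rho>" "\<rho> \<le> T" and v: "0 < v" "V z = ennreal v"
  shows "ennreal (v / D) * ennreal (pi * \<rho>\<^sup>2) \<le> (\<integral>\<^sup>+u\<in>ball z \<rho>. V u \<partial>lborel)"
proof -
  have "ennreal (v / D) * ennreal (pi * \<rho>\<^sup>2) = (\<integral>\<^sup>+u\<in>ball z \<rho>. ennreal (v / D) \<partial>lborel)"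
    using \<rho> by (subst nn_integral_cmult_indicator) (auto simp: emeasure_ball_complex)
  also have "\<dots> \<le> (\<integral>\<^sup>+u\<in>ball z \<rho>. V u \<partial>lborel)"
  proof (intro nn_integral_mono, goal_cases)
    case (1 u)
    show ?case
    proof (cases "u \<in> ball z \<rho>")
      case True
      obtain v' where v': "0 < v'" "V u = ennreal v'" by (rule V_real)
      have "V z \<le> ennreal D * V u" using True \<rho> by (intro D) auto
      then have "v \<le> D * v'" using v v' D by (simp flip: ennreal_mult)
      then have "v / D \<le> v'" using D by (simp add: field_simps)
      then show ?thesis using v' by (auto simp: indicator_def intro: ennreal_leI)
    qed simp
  qed
  finally show ?thesis .
qed

context
  fixes w :: "complex \<Rightarrow> real"
  assumes ae: "AE z in lborel. ennreal (w z) = W z"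
begin

lemma mass_eq_W: "mass (\<lambda>z. ennreal (w z)) E = (\<integral>\<^sup>+z\<in>E. W z \<partial>lborel)"
  unfolding mass_eq_nn_integral_lborel
proof (rule nn_integral_cong_AE)
  show "AE z in lborel. ennreal (w z) * indicator E z = W z * indicator E z"
    using ae by eventually_elim simp
qed

lemma hat_weight_eq: "hat_weight w z = ennreal (1 / pi) * V z"
proof -
  have "hat_weight w z = V z / ennreal pi"
    unfolding hat_weight_def mean_def mass_eq_W by (simp add: V_eq emeasure_ball_complex)
  also have "\<dots> = ennreal (1 / pi) * V z"
    by (simp add: divide_ennreal_def inverse_ennreal inverse_eq_divide mult.commute)
  finally show ?thesis .
qed

lemma mass_hat_weight:
  assumes [measurable]: "E \<in> sets borel"
  shows "mass (hat_weight w) E = ennreal (1 / pi) * (\<integral>\<^sup>+z\<in>E. V z \<partial>lborel)"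
  unfolding mass_eq_nn_integral_lborel hat_weight_eq
  by (subst nn_integral_cmult[symmetric]) (auto simp: mult.assoc)

lemma hat_measure_eq: "hat_measure w \<mu> z = emeasure \<mu> (ball z 1) / V z"
  unfolding hat_measure_def mass_eq_W by (simp add: V_eq)

lemma fock_norm_pow_eq:
  "fock_norm_pow p \<alpha> w f = (\<integral>\<^sup>+z. ennreal (fock_integrand p \<alpha> f z) * W z \<partial>lborel)"
  unfolding fock_norm_pow_def nn_integral_completion
proof (rule nn_integral_cong_AE)
  show "AE z in lborel. ennreal (fock_integrand p \<alpha> f z * w z) = ennreal (fock_integrand p \<alpha> f z) * W z"
    using ae by eventually_elim (simp add: ennreal_mult' fock_integrand_nonneg)
qed

lemma V_ne: "V z \<noteq> 0" "V z \<noteq> \<infinity>"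
  using ball_pos[of 1 z] ball_fin[of z 1] by auto

lemma AE_ball_le:
  assumes "hat_measure_norm w \<mu> = ennreal m"
  shows "AE z in lborel. emeasure \<mu> (ball z 1) \<le> ennreal m * V z"
proof -
  have "AE z in lborel. hat_measure w \<mu> z \<le> ennreal m"
    using esssup_AE[of "hat_measure w \<mu>" lebesgue] assms
    by (simp add: hat_measure_norm_def AE_completion_iff)
  then show ?thesis
  proof eventually_elim
    case (elim z)
    then have "emeasure \<mu> (ball z 1) / V z * V z \<le> ennreal m * V z"
      by (intro mult_right_mono) (simp_all add: hat_measure_eq)
    then show ?case by (simp only: ennreal_divide_mult_cancel[OF V_ne])
  qed
qed

lemma good_set_borel:
  assumes "sets \<mu> = sets borel" "sigma_finite_measure \<mu>"
  shows "good_set w \<mu> \<rho> \<epsilon> \<in> sets borel"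
proof -
  have [measurable]: "(\<lambda>z. emeasure \<mu> (ball z \<rho>)) \<in> borel \<rightarrow>\<^sub>M borel"
    by (rule measurable_emeasure_ball[OF assms(2,1)])
  have [measurable]: "(\<lambda>z. mass (hat_weight w) (ball z \<rho>)) \<in> borel \<rightarrow>\<^sub>M borel"
    by (simp add: mass_hat_weight)
  have "Measurable.pred borel (\<lambda>z. emeasure \<mu> (ball z \<rho>) / mass (hat_weight w) (ball z \<rho>) > ennreal \<epsilon> * hat_measure_norm w \<mu>)"
    by measurable
  then show ?thesis unfolding good_set_def by (simp add: pred_def)
qed

text \<open>For \<rho> at most 1 the averaged weight is at least \<open>V z / (pi * D)\<close> on
  the disk, so its mass there is at least \<open>\<rho>\<^sup>2 * V z / D\<close>. The defining
  inequality of the good set then becomes a lower bound with the same power of \<rho> as the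
  area.\<close>

lemma good_setD:
  assumes D: "1 \<le> D" "\<And>z z'. dist z z' \<le> 1 \<Longrightarrow> V z \<le> ennreal D * V z'"
    and \<rho>: "0 < \<rho>" "\<rho> \<le> 1" and \<epsilon>: "0 < \<epsilon>" and m: "0 \<le> m" "hat_measure_norm w \<mu> = ennreal m"
    and z: "z \<in> good_set w \<mu> \<rho> \<epsilon>"
  shows "ennreal (\<epsilon> / D * m * \<rho>\<^sup>2) * V z \<le> emeasure \<mu> (ball z \<rho>)"
proof -
  obtain v where v: "0 < v" "V z = ennreal v" by (rule V_real)
  define M where "M = mass (hat_weight w) (ball z \<rho>)"
  have "ennreal (1 / pi) * (ennreal (v / D) * ennreal (pi * \<rho>\<^sup>2)) \<le> M"
  proof -
    have "ennreal (v / D) * ennreal (pi * \<rho>\<^sup>2) \<le> (\<integral>\<^sup>+u\<in>ball z \<rho>. V u \<partial>lborel)"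
      using \<rho> by (intro integral_V_ball_ge[OF D _ _ v]) auto
    then show ?thesis
      unfolding M_def by (subst mass_hat_weight) (auto intro: mult_left_mono)
  qed
  moreover have "ennreal (1 / pi) * (ennreal (v / D) * ennreal (pi * \<rho>\<^sup>2)) = ennreal (v / D * \<rho>\<^sup>2)"
    using v D by (simp flip: ennreal_mult)
  ultimately have M: "ennreal (v / D * \<rho>\<^sup>2) \<le> M" by simp
  have "0 < ennreal (v / D * \<rho>\<^sup>2)" using v D \<rho> by simp
  then have M0: "M \<noteq> 0" using M by auto
  have lt: "ennreal \<epsilon> * ennreal m < emeasure \<mu> (ball z \<rho>) / M"
    using z m by (simp add: good_set_def M_def)
  \<comment> \<open>A quotient with infinite denominator would be 0 and could not exceed anything
    strictly.\<close>
  then have Mt: "M \<noteq> \<infinity>" by auto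
  have "ennreal (\<epsilon> / D * m * \<rho>\<^sup>2) * V z = ennreal \<epsilon> * ennreal m * ennreal (v / D * \<rho>\<^sup>2)"
    using v D \<epsilon> m \<rho> by (simp add: mult_ac flip: ennreal_mult)
  also have "\<dots> \<le> emeasure \<mu> (ball z \<rho>) / M * M"
    using lt M by (intro mult_mono) auto
  finally show ?thesis by (simp only: ennreal_divide_mult_cancel[OF M0 Mt])
qed

text \<open>On \<open>ball a R\<close> the density \<open>V\<close> lies between
  \<open>V a / D\<close> and \<open>D * V a\<close>. One factor \<open>D\<close> is lost in the
  lower bound for the disk and one in the upper bound for its intersection with
  \<open>G\<close>.\<close>

lemma density_transfer:
  assumes D: "1 \<le> D" "\<And>z z'. dist z z' \<le> R \<Longrightarrow> V z \<le> ennreal D * V z'"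
    and R: "0 < R" and \<delta>: "0 < \<delta>" and G[measurable]: "G \<in> sets borel"
    and dens: "ennreal \<delta> * mass (hat_weight w) (ball a R) < mass (hat_weight w) (G \<inter> ball a R)"
  shows "ennreal (\<delta> / D\<^sup>2) * emeasure lborel (ball a R) \<le> emeasure lborel (G \<inter> ball a R)"
proof -
  obtain v where v: "0 < v" "V a = ennreal v" by (rule V_real)
  have vol: "emeasure lborel (ball a R) = ennreal (pi * R\<^sup>2)"
    using R by (simp add: emeasure_ball_complex)
  have "emeasure lborel (G \<inter> ball a R) \<le> emeasure lborel (ball a R)"
    by (intro emeasure_mono) auto
  then obtain g where g: "0 \<le> g" "emeasure lborel (G \<inter> ball a R) = ennreal g"
    unfolding vol by (cases "emeasure lborel (G \<inter> ball a R)") (auto simp: top_unique)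
  have lower: "ennreal (v / D) * ennreal (pi * R\<^sup>2) \<le> (\<integral>\<^sup>+u\<in>ball a R. V u \<partial>lborel)"
    using R by (intro integral_V_ball_ge[OF D _ _ v]) auto
  have upper: "(\<integral>\<^sup>+u\<in>G \<inter> ball a R. V u \<partial>lborel) \<le> ennreal (D * v) * ennreal g"
  proof -
    have "(\<integral>\<^sup>+u\<in>G \<inter> ball a R. V u \<partial>lborel) \<le> (\<integral>\<^sup>+u\<in>G \<inter> ball a R. ennreal D * V a \<partial>lborel)"
      by (intro nn_integral_mono) (auto simp: indicator_def dist_commute intro!: D(2))
    also have "\<dots> = ennreal D * V a * ennreal g"
      by (subst nn_integral_cmult_indicator) (auto simp: g)
    finally show ?thesis using v D by (simp add: ennreal_mult)
  qed
  have "ennreal \<delta> * (ennreal (1 / pi) * (ennreal (v / D) * ennreal (pi * R\<^sup>2)))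
      \<le> ennreal \<delta> * mass (hat_weight w) (ball a R)"
    using lower by (subst mass_hat_weight) (auto intro!: mult_left_mono)
  also have "\<dots> \<le> mass (hat_weight w) (G \<inter> ball a R)" using dens by simp
  also have "\<dots> \<le> ennreal (1 / pi) * (ennreal (D * v) * ennreal g)"
    using upper by (subst mass_hat_weight) (auto intro!: mult_left_mono)
  finally have "\<delta> * (1 / pi * (v / D * (pi * R\<^sup>2))) \<le> 1 / pi * (D * v * g)"
    using \<delta> v D g by (simp flip: ennreal_mult)
  then have "v * (\<delta> * (pi * R\<^sup>2)) \<le> v * (D\<^sup>2 * g)"
    using D by (simp add: field_simps power2_eq_square)
  then have "\<delta> * (pi * R\<^sup>2) \<le> D\<^sup>2 * g" using v by simp
  then have "\<delta> / D\<^sup>2 * (pi * R\<^sup>2) \<le> g" using D by (simp add: field_simps)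
  then show ?thesis unfolding vol g(2) using \<delta> by (simp add: ennreal_leI flip: ennreal_mult)
qed

lemma reverse_Carleson_uniform:
  fixes p \<alpha> R \<epsilon> \<delta> :: real
  assumes p: "0 < p" and \<alpha>: "0 < \<alpha>" and R: "0 < R" and \<epsilon>: "0 < \<epsilon>" and \<delta>: "0 < \<delta>"
  obtains \<rho>\<^sub>0 where "0 < \<rho>\<^sub>0" "\<And>\<rho> (\<mu> :: complex measure). 0 < \<rho> \<Longrightarrow> \<rho> < \<rho>\<^sub>0 \<Longrightarrow> sets \<mu> = sets borel
    \<Longrightarrow> hat_measure_norm w \<mu> < \<infinity>
    \<Longrightarrow> (\<And>a. ennreal \<delta> * mass (hat_weight w) (ball a R) < mass (hat_weight w) (good_set w \<mu> \<rho> \<epsilon> \<inter> ball a R))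
    \<Longrightarrow> reverse_Carleson p \<alpha> w \<mu>"
proof -
  obtain D1 where D1: "1 \<le> D1" "\<And>z z'. dist z z' \<le> 1 \<Longrightarrow> V z \<le> ennreal D1 * V z'"
    by (rule V_doubling[of 1]) auto
  obtain DR where DR: "1 \<le> DR" "\<And>z z'. dist z z' \<le> R \<Longrightarrow> V z \<le> ennreal DR * V z'"
    by (rule V_doubling[of R]) auto
  \<comment> \<open>Truncated at 1, as \<open>averaged_le_dense_set\<close> asks for a density of at
    most 1.\<close>
  define \<theta> where "\<theta> = min 1 (\<delta> / DR\<^sup>2)"
  have \<theta>: "0 < \<theta>" "\<theta> \<le> 1" using \<delta> DR by (auto simp: \<theta>_def)
  obtain CA where CA: "0 < CA" "\<And>f. f holomorphic_on UNIV \<Longrightarrow>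
    (\<integral>\<^sup>+z. ennreal (fock_integrand p \<alpha> f z) * W z \<partial>lborel) \<le> ennreal CA * (\<integral>\<^sup>+z. ennreal (fock_integrand p \<alpha> f z) * V z \<partial>lborel)"
    by (rule fock_norm_le_averaged[OF p \<alpha>]) auto
  obtain CB where CB: "0 < CB" "\<And>f. f holomorphic_on UNIV \<Longrightarrow>
    (\<integral>\<^sup>+z. ennreal (fock_integrand p \<alpha> f z) * V z \<partial>lborel) \<le> ennreal CB * (\<integral>\<^sup>+z. ennreal (fock_integrand p \<alpha> f z) * W z \<partial>lborel)"
    by (rule averaged_le_fock_norm[OF p \<alpha>]) auto
  obtain CL where CL: "0 < CL" and dense: "\<And>f G. f holomorphic_on UNIV \<Longrightarrow> G \<in> sets borel
    \<Longrightarrow> (\<And>a. ennreal \<theta> * emeasure lborel (ball a R) \<le> emeasure lborel (G \<inter> ball a R))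
    \<Longrightarrow> (\<integral>\<^sup>+z. ennreal (fock_integrand p \<alpha> f z) * V z \<partial>lborel) < \<infinity>
    \<Longrightarrow> (\<integral>\<^sup>+z. ennreal (fock_integrand p \<alpha> f z) * V z \<partial>lborel)
        \<le> ennreal CL * (\<integral>\<^sup>+z\<in>G. ennreal (fock_integrand p \<alpha> f z) * V z \<partial>lborel)"
    by (rule averaged_le_dense_set[OF p \<alpha> R \<theta>]) blast
  obtain CM where CM: "0 < CM" and b3: "\<And>(\<mu> :: complex measure) m z. sets \<mu> = sets borel \<Longrightarrow> 0 \<le> m
    \<Longrightarrow> (AE z in lborel. emeasure \<mu> (ball z 1) \<le> ennreal m * V z)
    \<Longrightarrow> emeasure \<mu> (ball z 3) \<le> ennreal (CM * m) * V z"
    by (rule ball_measure_bound) blast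
  obtain C1 C2 where C1: "0 < C1" and C2: "0 < C2" and good_le:
    "\<And>f (\<mu> :: complex measure) m c \<rho> G. f holomorphic_on UNIV \<Longrightarrow> sets \<mu> = sets borel \<Longrightarrow> sigma_finite_measure \<mu>
     \<Longrightarrow> 0 \<le> m \<Longrightarrow> (\<And>z. emeasure \<mu> (ball z 3) \<le> ennreal m * V z) \<Longrightarrow> G \<in> sets borel
     \<Longrightarrow> 0 < \<rho> \<Longrightarrow> \<rho> \<le> 1 / 2 \<Longrightarrow> 0 \<le> c \<Longrightarrow> (\<And>z. z \<in> G \<Longrightarrow> ennreal (c * \<rho>\<^sup>2) * V z \<le> emeasure \<mu> (ball z \<rho>))
     \<Longrightarrow> ennreal c * (\<integral>\<^sup>+z\<in>G. ennreal (fock_integrand p \<alpha> f z) * V z \<partial>lborel)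
       \<le> ennreal C1 * (\<integral>\<^sup>+z. ennreal (fock_integrand p \<alpha> f z) \<partial>\<mu>)
         + ennreal (C2 * \<rho> powr p * m) * (\<integral>\<^sup>+z. ennreal (fock_integrand p \<alpha> f z) * V z \<partial>lborel)"
    by (rule good_set_integral_le[OF p \<alpha>]) blast
  define k where "k = \<epsilon> / D1"
  have k: "0 < k" using \<epsilon> D1 by (simp add: k_def)
  define L where "L = CL * C2 * CM"
  have L: "0 < L" using CL C2 CM by (simp add: L_def)
  \<comment> \<open>\<open>L\<close> collects the constants in front of the error term once the
    dense-set estimate is inserted. The second entry gives
    \<open>L * \<rho> powr p \<le> k / 2\<close>, so half of the left-hand side survives absorption;
    1/2 is the range of \<open>fock_near\<close>.\<close>
  define \<rho>\<^sub>0 where "\<rho>\<^sub>0 = min (1 / 2) ((k / (2 * L)) powr (1 / p))"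
  have \<rho>\<^sub>0: "0 < \<rho>\<^sub>0" using k L by (simp add: \<rho>\<^sub>0_def)
  show ?thesis
  proof (rule that[OF \<rho>\<^sub>0])
    fix \<rho> and \<mu> :: "complex measure"
    assume \<rho>: "0 < \<rho>" "\<rho> < \<rho>\<^sub>0" and s: "sets \<mu> = sets borel" and fin: "hat_measure_norm w \<mu> < \<infinity>"
      and dens: "\<And>a. ennreal \<delta> * mass (hat_weight w) (ball a R) < mass (hat_weight w) (good_set w \<mu> \<rho> \<epsilon> \<inter> ball a R)"
    have \<rho>half: "\<rho> \<le> 1 / 2" using \<rho> by (simp add: \<rho>\<^sub>0_def)
    have "\<rho> powr p \<le> ((k / (2 * L)) powr (1 / p)) powr p"
      using \<rho> p by (intro powr_mono2) (auto simp: \<rho>\<^sub>0_def)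
    also have "\<dots> = k / (2 * L)" using p k L by (simp add: powr_powr)
    finally have small: "2 * L * \<rho> powr p \<le> k" using L by (simp add: field_simps)
    obtain m where m: "0 \<le> m" "hat_measure_norm w \<mu> = ennreal m"
      using fin by (cases "hat_measure_norm w \<mu>") auto
    let ?G = "good_set w \<mu> \<rho> \<epsilon>"
    have \<mu>3: "emeasure \<mu> (ball z 3) \<le> ennreal (CM * m) * V z" for z
      by (rule b3[OF s m(1) AE_ball_le[OF m(2)]])
    have "emeasure \<mu> (ball z 3) < \<infinity>" for z
    proof -
      obtain v where "0 < v" "V z = ennreal v" by (rule V_real)
      then show ?thesis using \<mu>3[of z] by (auto simp: ennreal_mult_less_top elim: order_le_less_trans)
    qed
    then have sf: "sigma_finite_measure \<mu>" by (rule sigma_finite_of_ball_fin[OF s])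
    have G: "?G \<in> sets borel" by (rule good_set_borel[OF s sf])
    have dens': "ennreal \<theta> * emeasure lborel (ball a R) \<le> emeasure lborel (?G \<inter> ball a R)" for a
    proof -
      have "ennreal \<theta> * emeasure lborel (ball a R) \<le> ennreal (\<delta> / DR\<^sup>2) * emeasure lborel (ball a R)"
        by (intro mult_right_mono ennreal_leI) (auto simp: \<theta>_def)
      also have "\<dots> \<le> emeasure lborel (?G \<inter> ball a R)"
        by (rule density_transfer[OF DR R \<delta> G dens])
      finally show ?thesis .
    qed
    \<comment> \<open>If \<open>m\<close> were 0, \<mu> would vanish on every disk and the good set
      would be empty, against the strict density hypothesis.\<close>
    have "m \<noteq> 0"
    proof
      assume "m = 0"
      have "?G = {}"
      proof (intro equals0I)
        fix z assume "z \<in> ?G"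
        then have "0 < emeasure \<mu> (ball z \<rho>) / mass (hat_weight w) (ball z \<rho>)"
          using m \<open>m = 0\<close> by (simp add: good_set_def)
        moreover have "emeasure \<mu> (ball z \<rho>) \<le> emeasure \<mu> (ball z 3)"
          using s \<rho>half by (intro emeasure_mono) auto
        then have "emeasure \<mu> (ball z \<rho>) = 0" using \<mu>3[of z] \<open>m = 0\<close> by simp
        ultimately show False by simp
      qed
      then show False using dens[of 0] by (simp add: mass_def)
    qed
    then have m0: "0 < m" using m by simp
    define C where "C = CA * (2 * CL * C1 / (k * m))"
    have C: "0 < C" using CA CL C1 k m0 by (simp add: C_def)
    show "reverse_Carleson p \<alpha> w \<mu>"
      unfolding reverse_Carleson_def
    proof (intro exI[of _ C] conjI ballI C)
      fix f assume "f \<in> fock_space p \<alpha> w"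
      then have f: "f holomorphic_on UNIV"
        and ff: "(\<integral>\<^sup>+z. ennreal (fock_integrand p \<alpha> f z) * W z \<partial>lborel) < \<infinity>"
        by (auto simp: fock_space_def fock_norm_pow_eq)
      define X where "X = (\<integral>\<^sup>+z. ennreal (fock_integrand p \<alpha> f z) * V z \<partial>lborel)"
      define Y where "Y = (\<integral>\<^sup>+z\<in>?G. ennreal (fock_integrand p \<alpha> f z) * V z \<partial>lborel)"
      define J where "J = (\<integral>\<^sup>+z. ennreal (fock_integrand p \<alpha> f z) \<partial>\<mu>)"
      have Xfin: "X < \<infinity>"
        unfolding X_def using ff by (intro order_le_less_trans[OF CB(2)[OF f]]) (auto simp: ennreal_mult_less_top)
      then obtain x where x: "0 \<le> x" "X = ennreal x" by (cases X) auto
      have XY: "X \<le> ennreal CL * Y"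
        unfolding X_def Y_def by (rule dense[OF f G dens']) (use Xfin in \<open>simp add: X_def\<close>)
      have kY: "ennreal (k * m) * Y \<le> ennreal C1 * J + ennreal (C2 * \<rho> powr p * (CM * m)) * X"
        unfolding X_def Y_def J_def
      proof (rule good_le[OF f s sf _ \<mu>3 G \<rho>(1) \<rho>half])
        show "ennreal (k * m * \<rho>\<^sup>2) * V z \<le> emeasure \<mu> (ball z \<rho>)" if "z \<in> ?G" for z
          unfolding k_def using \<rho>half by (intro good_setD[OF D1 \<rho>(1) _ \<epsilon> m that]) auto
      qed (use CM m k in auto)
      have "X \<le> ennreal (2 * CL * C1 / (k * m)) * J"
      proof (cases J)
        case top
        then show ?thesis using CL C1 k m0 by (simp add: ennreal_mult_top)
      next
        case (real j)
        \<comment> \<open>The dense-set estimate is multiplied by \<open>k * m\<close> so that the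
          bound for the good set can be inserted. Both the left-hand side and the error term then
          carry \<open>m\<close>, and their comparison no longer involves it.\<close>
        have "ennreal (k * m) * X \<le> ennreal CL * (ennreal (k * m) * Y)"
          using mult_left_mono[OF XY, of "ennreal (k * m)"] by (simp add: mult_ac)
        also have "\<dots> \<le> ennreal CL * (ennreal C1 * J + ennreal (C2 * \<rho> powr p * (CM * m)) * X)"
          by (rule mult_left_mono[OF kY]) simp
        also have "\<dots> = ennreal (CL * (C1 * j + C2 * \<rho> powr p * (CM * m) * x))"
          using CL C1 C2 CM m x real by (simp flip: ennreal_mult ennreal_plus)
        finally have "k * m * x \<le> CL * (C1 * j + C2 * \<rho> powr p * (CM * m) * x)"
          using CL C1 C2 CM m k x real by (simp flip: ennreal_mult)
        also have "\<dots> = CL * C1 * j + L * \<rho> powr p * (m * x)"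
          by (simp add: L_def algebra_simps)
        also have "\<dots> \<le> CL * C1 * j + k / 2 * (m * x)"
          using small m x by (intro add_left_mono mult_right_mono) auto
        finally have "k * m * x \<le> 2 * CL * C1 * j" by (simp add: algebra_simps)
        then have "x \<le> 2 * CL * C1 / (k * m) * j" using k m0 by (simp add: field_simps)
        then show ?thesis using x real CL C1 k m0 by (simp flip: ennreal_mult)
      qed
      then have "ennreal CA * X \<le> ennreal CA * (ennreal (2 * CL * C1 / (k * m)) * J)"
        by (rule mult_left_mono) simp
      also have "\<dots> = ennreal C * J"
        using CA CL C1 k m0 unfolding C_def by (subst ennreal_mult) (auto simp: mult.assoc)
      finally show "fock_norm_pow p \<alpha> w f \<le> ennreal C * (\<integral>\<^sup>+z. ennreal (fock_integrand p \<alpha> f z) \<partial>\<mu>)"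
        unfolding fock_norm_pow_eq using CA(2)[OF f] by (simp add: X_def J_def)
    qed
  qed
qed

end

end

theorem theorem1p2:
  fixes p \<alpha> R \<epsilon> \<delta> :: real and w :: "complex \<Rightarrow> real"
  assumes "0 < p" and "0 < \<alpha>" and "0 < R" and "0 < \<epsilon>"
    and "0 < \<delta>" and "\<delta> < 1"
    and "w \<in> Ainf_restricted"
  shows "\<exists>r\<^sub>0>0. \<forall>r. 0 < r \<and> r < r\<^sub>0 \<longrightarrow>
    (\<forall>\<mu> :: complex measure.
       sets \<mu> = sets borel \<and>
       hat_measure_norm w \<mu> < \<infinity> \<and>
       (\<forall>a. mass (hat_weight w) (good_set w \<mu> r \<epsilon> \<inter> ball a R)
              > ennreal \<delta> * mass (hat_weight w) (ball a R)) \<longrightarrow>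
       reverse_Carleson p \<alpha> w \<mu>)"
proof -
  obtain W q s K where W: "restricted_weight W q s K" and ae: "AE z in lborel. ennreal (w z) = W z"
    using assms(7) by (rule Ainf_restricted_weight)
  obtain r\<^sub>0 where r\<^sub>0: "0 < r\<^sub>0" "\<And>r (\<mu> :: complex measure). 0 < r \<Longrightarrow> r < r\<^sub>0 \<Longrightarrow> sets \<mu> = sets borel
    \<Longrightarrow> hat_measure_norm w \<mu> < \<infinity>
    \<Longrightarrow> (\<And>a. ennreal \<delta> * mass (hat_weight w) (ball a R) < mass (hat_weight w) (good_set w \<mu> r \<epsilon> \<inter> ball a R))
    \<Longrightarrow> reverse_Carleson p \<alpha> w \<mu>"
    by (rule restricted_weight.reverse_Carleson_uniform[OF W ae assms(1-5)]) blast
  then show ?thesis by blast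
qed

end
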